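(* Let $\varepsilon>0$ and $\Lambda>0$. There is a constant $C=C(\varepsilon,\Lambda)$ such that for all $\ell,q\in\mathbb{Z}$ with $\ell\geq\max(1,|q|)$, all $\nu\in i\mathbb{R}$ and all $g\in\mathrm{SL}_2(\mathbb{C})$, $$\bigl|\varphi_{\nu,\ell}^{\ell,q}(g)\bigr|\leq C\left(\ell^{\varepsilon}\min\left(1,\ \frac{\|g\|}{\sqrt{\ell}\,\mathrm{dist}(g,K)^2\,\mathrm{dist}(g,\mathcal{D})}\right)+\ell^{-\Lambda}\right),$$ where an expression with zero denominator is understood as $+\infty$.
   Context: $G=\mathrm{SL}_2(\mathbb{C})$, $K=\mathrm{SU}_2(\mathbb{C})$ with probability Haar measure $dk$; $\mathcal{D}\subset G$ is the set of diagonal matrices in $G$. $\|g\|=\sqrt{\mathrm{tr}(gg^* )}$ is the Frobenius norm, and $\mathrm{dist}(g,\mathcal{H})=\inf_{h\in\mathcal{H}}\|g-h\|$. The spherical trace function is $$\varphi_{\nu,\ell}^{\ell}(g)=(2\ell+1)\int_K\psi_\ell(\kappa(k^{-1}gk))\,e^{(\nu-1)\rho(H(gk))}\,dk,$$ where $\psi_\ell\left(\begin{pmatrix}\alpha&\beta\\-\bar\beta&\bar\alpha\end{pmatrix}\right)=\bar\alpha^{2\ell}$ on $K$, and for $g=\begin{pmatrix}a&b\\c&d\end{pmatrix}\in G$, $\kappa(g)\in K$ is the matrix with first column $(a,c)^\top/\sqrt{|a|^2+|c|^2}$ and $e^{(\nu-1)\rho(H(g))}=(|a|^2+|c|^2)^{\nu-1}$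 (Iwasawa projections for $G=KAN$). Its averaged version is $$\varphi_{\nu,\ell}^{\ell,q}(g)=\frac1{2\pi}\int_0^{2\pi}\varphi_{\nu,\ell}^{\ell}\bigl(g\,\mathrm{diag}(e^{i\varrho},e^{-i\varrho})\bigr)e^{-2qi\varrho}\,d\varrho.$$ *)

theory Defs
  imports "HOL-Probability.Probability"
begin

section \<open>The groups\<close>

type_synonym cmat2 = "complex ^ 2 ^ 2"

definition conj_transpose :: "cmat2 \<Rightarrow> cmat2" where
  "conj_transpose A = map_matrix cnj (transpose A)"

definition SL2 :: "cmat2 set" where
  "SL2 = {g. det g = 1}"

definition SU2 :: "cmat2 set" where
  "SU2 = {k \<in> SL2. k ** conj_transpose k = mat 1}"

definition Diag2 :: "cmat2 set" where
  "Diag2 = {g \<in> SL2. \<forall>i j. i \<noteq> j \<longrightarrow> g $ i $ j = 0}"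

definition mat2 :: "complex \<Rightarrow> complex \<Rightarrow> complex \<Rightarrow> complex \<Rightarrow> cmat2" where
  "mat2 a b c d = vector [vector [a, b], vector [c, d]]"

lemma mat2_nth [simp]:
  "mat2 a b c d $ 1 $ 1 = a" "mat2 a b c d $ 1 $ 2 = b"
  "mat2 a b c d $ 2 $ 1 = c" "mat2 a b c d $ 2 $ 2 = d"
  by (simp_all add: mat2_def)

lemma cmat2_eq_iff:
  "(A::cmat2) = B \<longleftrightarrow> A$1$1 = B$1$1 \<and> A$1$2 = B$1$2 \<and> A$2$1 = B$2$1 \<and> A$2$2 = B$2$2"
  by (auto simp: vec_eq_iff forall_2)

lemma conj_transpose_nth [simp]: "conj_transpose A $ i $ j = cnj (A $ j $ i)"
  by (simp add: conj_transpose_def transpose_def)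

lemma cmat2_mult_nth: "((A::cmat2) ** B) $ i $ j = A$i$1 * B$1$j + A$i$2 * B$2$j"
  by (simp add: matrix_matrix_mult_def sum_2)

lemma cmat2_one_nth:
  "(mat 1 :: cmat2)$1$1 = 1" "(mat 1 :: cmat2)$1$2 = 0"
  "(mat 1 :: cmat2)$2$1 = 0" "(mat 1 :: cmat2)$2$2 = 1"
  by (simp_all add: mat_def)

text \<open>The norm that the library provides on matrices is the Frobenius norm, so that the
  distance to a set is \<^const>\<open>infdist\<close>.\<close>

lemma norm_eq_frobenius:
  fixes g :: cmat2
  shows "complex_of_real ((norm g)\<^sup>2) = trace (g ** conj_transpose g)"
    and "norm g = sqrt (Re (trace (g ** conj_transpose g)))"
proof -
  show *: "complex_of_real ((norm g)\<^sup>2) = trace (g ** conj_transpose g)"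
    by (simp add: norm_vec_def L2_set_def sum_2 trace_def cmat2_mult_nth
        complex_norm_square [symmetric] real_sqrt_pow2 sum_nonneg flip: of_real_add of_real_power)
  show "norm g = sqrt (Re (trace (g ** conj_transpose g)))"
    by (simp flip: *)
qed

lemma infdist_SU2_Diag2:
  fixes g :: cmat2
  shows "infdist g SU2 = (INF h\<in>SU2. norm (g - h))"
    and "infdist g Diag2 = (INF h\<in>Diag2. norm (g - h))"
proof -
  have "mat 1 \<in> SU2" "mat 1 \<in> Diag2"
    by (auto simp: SU2_def SL2_def Diag2_def det_2 cmat2_one_nth cmat2_eq_iff cmat2_mult_nth)
       (simp_all add: mat_def)
  then show "infdist g SU2 = (INF h\<in>SU2. norm (g - h))"
    and "infdist g Diag2 = (INF h\<in>Diag2. norm (g - h))"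
    by (auto simp: infdist_def dist_norm)
qed


section \<open>Haar measure on the compact group\<close>

definition is_haar_prob_SU2 :: "cmat2 measure \<Rightarrow> bool" where
  "is_haar_prob_SU2 M \<longleftrightarrow>
     prob_space M \<and> sets M = sets (restrict_space borel SU2) \<and>
     (\<forall>k\<in>SU2. distr M M (\<lambda>x. k ** x) = M)"

definition haar_SU2 :: "cmat2 measure" where
  "haar_SU2 = (THE M. is_haar_prob_SU2 M)"

text \<open>Existence and uniqueness.  The group is the unit sphere of the quaternions, and the
  measure is the radial projection of the uniform measure on the unit ball.\<close>

definition quat_mat :: "real ^ 4 \<Rightarrow> cmat2" where
  "quat_mat x = mat2 (Complex (x$1) (x$2)) (- Complex (x$3) (- x$4))
                     (Complex (x$3) (x$4)) (Complex (x$1) (- x$2))"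

definition quat_of :: "cmat2 \<Rightarrow> real ^ 4" where
  "quat_of A = vector [Re (A$1$1), Im (A$1$1), Re (A$2$1), Im (A$2$1)]"

definition quat_proj :: "real ^ 4 \<Rightarrow> cmat2" where
  "quat_proj x = (if x = 0 then mat 1 else quat_mat (x /\<^sub>R norm x))"

definition quat_measure :: "cmat2 measure" where
  "quat_measure = distr (uniform_measure lborel (ball 0 1)) (restrict_space borel SU2) quat_proj"

lemma vector4_nth [simp]:
  "(vector [a,b,c,d] :: real^4) $ 1 = a" "(vector [a,b,c,d] :: real^4) $ 2 = b"
  "(vector [a,b,c,d] :: real^4) $ 3 = c" "(vector [a,b,c,d] :: real^4) $ 4 = d"
  by (simp_all add: vector_def)

lemma quat_of_quat_mat [simp]: "quat_of (quat_mat x) = x"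
  by (simp add: quat_of_def quat_mat_def vec_eq_iff forall_4)

lemma det_quat_mat: "det (quat_mat x) = complex_of_real ((norm x)\<^sup>2)"
proof -
  have "(norm x)\<^sup>2 = (x$1)\<^sup>2 + (x$2)\<^sup>2 + (x$3)\<^sup>2 + (x$4)\<^sup>2"
    by (simp add: norm_vec_def L2_set_def sum_4 sum_nonneg)
  then show ?thesis
    by (simp add: quat_mat_def det_2 complex_eq_iff power2_eq_square)
qed

lemma quat_mat_mult: "\<exists>z. quat_mat x ** quat_mat y = quat_mat z"
  by (rule exI [where x = "quat_of (quat_mat x ** quat_mat y)"])
     (simp add: cmat2_eq_iff quat_mat_def quat_of_def cmat2_mult_nth complex_eq_iff algebra_simps)

lemma quat_mat_in_SU2:
  assumes "norm x = 1"
  shows "quat_mat x \<in> SU2"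
proof -
  have "(x$1)\<^sup>2 + (x$2)\<^sup>2 + (x$3)\<^sup>2 + (x$4)\<^sup>2 = (norm x)\<^sup>2"
    by (simp add: norm_vec_def L2_set_def sum_4 sum_nonneg)
  with assms have "x$1*x$1 + x$2*x$2 + x$3*x$3 + x$4*x$4 = 1"
    by (simp add: power2_eq_square)
  then show ?thesis
    using det_quat_mat [of x] assms
    by (auto simp: SU2_def SL2_def cmat2_eq_iff cmat2_mult_nth cmat2_one_nth quat_mat_def
        complex_eq_iff algebra_simps)
qed

lemma SU2_entries:
  assumes "k \<in> SU2"
  shows "k$2$2 = cnj (k$1$1)" "k$1$2 = - cnj (k$2$1)"
proof -
  have d: "k$1$1 * k$2$2 - k$1$2 * k$2$1 = 1"
    and e1: "k$1$1 * cnj (k$1$1) + k$1$2 * cnj (k$1$2) = 1"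
    and e2: "k$2$1 * cnj (k$1$1) + k$2$2 * cnj (k$1$2) = 0"
    using assms by (auto simp: SU2_def SL2_def det_2 cmat2_eq_iff cmat2_mult_nth cmat2_one_nth)
  have "k$2$2 = k$2$2 * (k$1$1 * cnj (k$1$1) + k$1$2 * cnj (k$1$2))"
    using e1 by simp
  also have "\<dots> = cnj (k$1$1) * (k$1$1 * k$2$2 - k$1$2 * k$2$1)
      + k$1$2 * (k$2$1 * cnj (k$1$1) + k$2$2 * cnj (k$1$2))"
    by (simp add: algebra_simps)
  finally show "k$2$2 = cnj (k$1$1)" using d e2 by simp
  have "k$2$1 = k$2$1 * (k$1$1 * cnj (k$1$1) + k$1$2 * cnj (k$1$2))"
    using e1 by simp
  also have "\<dots> = - cnj (k$1$2) * (k$1$1 * k$2$2 - k$1$2 * k$2$1)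
      + k$1$1 * (k$2$1 * cnj (k$1$1) + k$2$2 * cnj (k$1$2))"
    by (simp add: algebra_simps)
  finally have "k$2$1 = - cnj (k$1$2)" using d e2 by simp
  then show "k$1$2 = - cnj (k$2$1)" by simp
qed

lemma SU2_eq_quat_mat:
  assumes "k \<in> SU2"
  shows "quat_mat (quat_of k) = k"
  using SU2_entries [OF assms]
  by (simp add: cmat2_eq_iff quat_mat_def quat_of_def complex_eq_iff)

lemma SU2_mult: "k \<in> SU2 \<Longrightarrow> h \<in> SU2 \<Longrightarrow> k ** h \<in> SU2"
proof -
  assume k: "k \<in> SU2" and h: "h \<in> SU2"
  obtain z where z: "quat_mat (quat_of k) ** quat_mat (quat_of h) = quat_mat z"
    using quat_mat_mult by blast
  then have kh: "k ** h = quat_mat z"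
    using SU2_eq_quat_mat h k by simp
  have "det (k ** h) = 1" using k h by (simp add: SU2_def SL2_def det_mul)
  then have "complex_of_real ((norm z)\<^sup>2) = 1" using kh det_quat_mat [of z] by simp
  then have "(norm z)\<^sup>2 = 1" using of_real_eq_1_iff by blast
  then have "norm z = 1" by (simp add: power2_eq_1_iff)
      (use norm_ge_zero [of z] in linarith)
  then show "k ** h \<in> SU2" using kh quat_mat_in_SU2 by simp
qed

lemma quat_proj_in_SU2: "quat_proj x \<in> SU2"
proof (cases "x = 0")
  case True
  then show ?thesis
    by (simp add: quat_proj_def)
       (auto simp: SU2_def SL2_def det_2 cmat2_one_nth cmat2_eq_iff cmat2_mult_nth)
next
  case False
  then show ?thesis by (simp add: quat_proj_def quat_mat_in_SU2)
qed

lemma linear_quat_mat: "linear quat_mat"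
  by (rule linearI) (auto simp: quat_mat_def cmat2_eq_iff complex_eq_iff)

lemma linear_quat_of: "linear quat_of"
  by (rule linearI) (auto simp: quat_of_def vec_eq_iff forall_4)

lemma cmat2_mult_scaleR:
  "(A::cmat2) ** (c *\<^sub>R B) = c *\<^sub>R (A ** B)" "(c *\<^sub>R A) ** (B::cmat2) = c *\<^sub>R (A ** B)"
  by (simp_all add: cmat2_eq_iff cmat2_mult_nth scaleR_add_right)

lemma linear_cmat2_mult: "linear (\<lambda>B::cmat2. A ** B)" "linear (\<lambda>B::cmat2. B ** A)"
  by (auto intro!: linearI simp: cmat2_mult_scaleR) (simp_all add: cmat2_eq_iff cmat2_mult_nth algebra_simps)

lemma continuous_on_cmat2_mult [continuous_intros]:
  fixes f g :: "'a::topological_space \<Rightarrow> cmat2"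
  assumes "continuous_on S f" "continuous_on S g"
  shows "continuous_on S (\<lambda>x. f x ** g x)"
  unfolding matrix_matrix_mult_def
  by (intro continuous_intros assms)

text \<open>One-sided multiplication by a group element acts on the quaternions by an
  orthogonal transformation.\<close>

lemma quat_action:
  assumes F: "(F = (\<lambda>A. k ** A) \<or> F = (\<lambda>A. A ** k))" and k: "k \<in> SU2"
  obtains T where "orthogonal_transformation T" "\<And>x. F (quat_mat x) = quat_mat (T x)"
proof
  define T where "T = (\<lambda>x. quat_of (F (quat_mat x)))"
  have k': "k = quat_mat (quat_of k)" using SU2_eq_quat_mat k by simp
  show eq: "F (quat_mat x) = quat_mat (T x)" for x
  proof -
    have "\<exists>z. F (quat_mat x) = quat_mat z"
      using F quat_mat_mult k' by metis
    then show ?thesis by (auto simp: T_def)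
  qed
  have "linear F" using F linear_cmat2_mult by auto
  then have "linear (quat_of \<circ> (F \<circ> quat_mat))"
    by (intro linear_compose linear_quat_mat linear_quat_of)
  then have lin: "linear T" by (simp add: T_def o_def)
  have "norm (T x) = norm x" for x
  proof -
    have "det (F (quat_mat x)) = det (quat_mat x)"
      using F k by (auto simp: det_mul SU2_def SL2_def)
    then have "complex_of_real ((norm (T x))\<^sup>2) = complex_of_real ((norm x)\<^sup>2)"
      unfolding eq det_quat_mat .
    then have "(norm (T x))\<^sup>2 = (norm x)\<^sup>2" using of_real_eq_iff by blast
    then show ?thesis by simp
  qed
  with lin show "orthogonal_transformation T"
    by (simp add: orthogonal_transformation)
qed

lemma quat_proj_action:
  assumes "orthogonal_transformation T" "\<And>x. F (quat_mat x) = quat_mat (T x)" "x \<noteq> 0"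
  shows "F (quat_proj x) = quat_proj (T x)"
proof -
  have "T x \<noteq> 0" "norm (T x) = norm x"
    using assms by (metis norm_eq_zero orthogonal_transformation)+
  then show ?thesis
    using assms orthogonal_transformation_linear [OF assms(1)]
    by (simp add: quat_proj_def linear_cmul)
qed

lemma measurable_quat_proj [measurable]: "quat_proj \<in> borel \<rightarrow>\<^sub>M restrict_space borel SU2"
proof (rule measurable_restrict_space2)
  have [measurable]: "quat_mat \<in> borel_measurable borel"
    by (intro borel_measurable_continuous_onI linear_continuous_on
        linear_conv_bounded_linear [THEN iffD1] linear_quat_mat)
  show "quat_proj \<in> borel \<rightarrow>\<^sub>M borel"
    unfolding quat_proj_def by measurable
qed (use quat_proj_in_SU2 in auto)

lemma measurable_SU2_mult:
  assumes "f \<in> M \<rightarrow>\<^sub>M restrict_space borel SU2" "g \<in> M \<rightarrow>\<^sub>M restrict_space borel SU2"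
  shows "(\<lambda>x. f x ** g x) \<in> M \<rightarrow>\<^sub>M restrict_space borel SU2"
proof (rule measurable_restrict_space2)
  have in_SU2: "f x \<in> SU2" "g x \<in> SU2" if "x \<in> space M" for x
    using measurable_space [OF assms(1) that] measurable_space [OF assms(2) that]
    by (auto simp: space_restrict_space)
  then show "(\<lambda>x. f x ** g x) \<in> space M \<rightarrow> SU2"
    using SU2_mult by auto
  have fb: "f \<in> M \<rightarrow>\<^sub>M borel" "g \<in> M \<rightarrow>\<^sub>M borel"
    using assms by (auto simp: measurable_restrict_space2_iff)
  have "(\<lambda>p. fst p ** snd p) \<in> (borel :: (cmat2 \<times> cmat2) measure) \<rightarrow>\<^sub>M borel"
    by (intro borel_measurable_continuous_onI continuous_intros)
  then have "(\<lambda>p. fst p ** snd p) \<in> (borel :: cmat2 measure) \<Otimes>\<^sub>M (borel :: cmat2 measure) \<rightarrow>\<^sub>M borel"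
    by (simp add: borel_prod)
  from measurable_compose [OF measurable_Pair [OF fb] this]
  show "(\<lambda>x. f x ** g x) \<in> M \<rightarrow>\<^sub>M borel" by simp
qed

lemma emeasure_ball4: "emeasure lborel (ball (0::real^4) 1) \<noteq> 0"
    "emeasure lborel (ball (0::real^4) 1) \<noteq> \<infinity>"
proof -
  have "measure lborel (ball (0::real^4) 1) > 0"
    by (simp add: content_ball_pos)
  then show "emeasure lborel (ball (0::real^4) 1) \<noteq> 0"
    by (metis measure_eq_emeasure_eq_ennreal measure_eq_0_null_sets less_irrefl null_setsI
        emeasure_notin_sets enn2real_0 measure_def)
  show "emeasure lborel (ball (0::real^4) 1) \<noteq> \<infinity>"
    using emeasure_bounded_finite [OF bounded_ball] by (metis infinity_ennreal_def less_irrefl)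
qed

lemma prob_space_quat: "prob_space quat_measure"
  unfolding quat_measure_def
  by (intro prob_space.prob_space_distr prob_space_uniform_measure emeasure_ball4) simp

lemma sets_quat [simp]: "sets quat_measure = sets (restrict_space borel SU2)"
  by (simp add: quat_measure_def)

lemma uniform_ball_orthogonal:
  fixes T :: "real^4 \<Rightarrow> real^4"
  assumes T: "orthogonal_transformation T"
  shows "distr (uniform_measure lborel (ball 0 1)) borel T = uniform_measure lborel (ball 0 1)"
proof (rule measure_eqI)
  show "sets (distr (uniform_measure lborel (ball 0 1)) borel T)
      = sets (uniform_measure lborel (ball (0::real^4) 1))" by simp
  have [measurable]: "T \<in> borel_measurable borel"
    using T by (intro borel_measurable_continuous_onI linear_continuous_on
        linear_conv_bounded_linear [THEN iffD1] orthogonal_transformation_linear)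
  fix A assume "A \<in> sets (distr (uniform_measure lborel (ball (0::real^4) 1)) borel T)"
  then have A [measurable]: "A \<in> sets borel" by simp
  let ?B = "ball (0::real^4) 1"
  have B: "?B \<inter> T -` A \<in> sets borel"
    using measurable_sets_borel [of T borel A] A by auto
  have im: "T ` (?B \<inter> T -` A) = ?B \<inter> A"
  proof
    show "T ` (?B \<inter> T -` A) \<subseteq> ?B \<inter> A"
      using T by (auto simp: orthogonal_transformation)
    show "?B \<inter> A \<subseteq> T ` (?B \<inter> T -` A)"
    proof
      fix y assume y: "y \<in> ?B \<inter> A"
      obtain x where "y = T x" using orthogonal_transformation_surj [OF T] by (metis surjD)
      with y T show "y \<in> T ` (?B \<inter> T -` A)" by (auto simp: orthogonal_transformation)
    qed
  qed
  have fin: "emeasure lborel (?B \<inter> S) \<noteq> \<infinity>" for S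
    by (metis emeasure_bounded_finite bounded_Int bounded_ball infinity_ennreal_def less_irrefl)
  have "?B \<inter> T -` A \<in> lmeasurable"
    using B by (intro bounded_set_imp_lmeasurable) (auto simp: bounded_Int)
  from measure_orthogonal_image [OF T this]
  have "measure lebesgue (?B \<inter> T -` A) = measure lebesgue (?B \<inter> A)"
    by (simp add: im)
  then have "measure lborel (?B \<inter> T -` A) = measure lborel (?B \<inter> A)"
    using B A by (simp add: measure_completion)
  then have "emeasure lborel (?B \<inter> T -` A) = emeasure lborel (?B \<inter> A)"
    using fin by (simp add: emeasure_eq_ennreal_measure)
  then show "emeasure (distr (uniform_measure lborel ?B) borel T) A
      = emeasure (uniform_measure lborel ?B) A"
    using B measurable_sets_borel [of T borel A] A by (simp add: emeasure_distr)
qed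

lemma quat_measure_invariant:
  assumes F: "(F = (\<lambda>A. k ** A) \<or> F = (\<lambda>A. A ** k))" and k: "k \<in> SU2"
  shows "distr quat_measure quat_measure F = quat_measure"
proof -
  let ?U = "uniform_measure lborel (ball (0::real^4) 1)"
  let ?R = "restrict_space borel SU2 :: cmat2 measure"
  obtain T where T: "orthogonal_transformation T" "\<And>x. F (quat_mat x) = quat_mat (T x)"
    using quat_action F k by blast
  have [measurable]: "T \<in> borel_measurable borel"
    using T by (intro borel_measurable_continuous_onI linear_continuous_on
        linear_conv_bounded_linear [THEN iffD1] orthogonal_transformation_linear)
  have kc: "(\<lambda>_. k) \<in> ?R \<rightarrow>\<^sub>M ?R" using k by (intro measurable_const) (simp add: space_restrict_space)
  have mF: "F \<in> ?R \<rightarrow>\<^sub>M ?R"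
    using F measurable_SU2_mult [OF kc measurable_ident_sets] measurable_SU2_mult [OF measurable_ident_sets kc]
    by auto
  have "distr quat_measure quat_measure F = distr quat_measure ?R F"
    by (rule distr_cong) auto
  also have "\<dots> = distr ?U ?R (F \<circ> quat_proj)"
    unfolding quat_measure_def by (rule distr_distr) (use mF in auto)
  also have "\<dots> = distr ?U ?R (quat_proj \<circ> T)"
  proof (rule distr_cong_AE)
    have "AE x in lborel. x \<noteq> (0::real^4)" by (rule AE_lborel_singleton)
    then have "AE x in lborel. x \<in> ball (0::real^4) 1 \<longrightarrow> x \<noteq> 0" by eventually_elim simp
    then have "AE x in ?U. x \<noteq> 0"
      by (intro AE_uniform_measureI) auto
    then show "AE x in ?U. (F \<circ> quat_proj) x = (quat_proj \<circ> T) x"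
      by eventually_elim (use T quat_proj_action in auto)
    show "F \<circ> quat_proj \<in> ?U \<rightarrow>\<^sub>M ?R"
      by (rule measurable_comp [OF _ mF]) simp
    show "quat_proj \<circ> T \<in> ?U \<rightarrow>\<^sub>M ?R"
      by (rule measurable_comp [where N = borel]) simp_all
  qed auto
  also have "\<dots> = distr (distr ?U borel T) ?R quat_proj"
    by (rule distr_distr [symmetric]) auto
  also have "\<dots> = quat_measure"
    unfolding quat_measure_def by (subst uniform_ball_orthogonal [OF T(1)]) simp
  finally show ?thesis .
qed

lemma is_haar_prob_SU2_quat_measure: "is_haar_prob_SU2 quat_measure"
  unfolding is_haar_prob_SU2_def
  using prob_space_quat quat_measure_invariant by auto

lemma is_haar_prob_SU2_unique:
  assumes "is_haar_prob_SU2 M"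
  shows "M = quat_measure"
proof (rule measure_eqI)
  let ?R = "restrict_space borel SU2 :: cmat2 measure"
  let ?Q = quat_measure
  interpret M: prob_space M using assms by (simp add: is_haar_prob_SU2_def)
  interpret Q: prob_space ?Q by (rule prob_space_quat)
  interpret pair_sigma_finite ?Q M ..
  have sM: "sets M = sets ?R" using assms by (simp add: is_haar_prob_SU2_def)
  then show "sets M = sets ?Q" by simp
  have spM: "space M = SU2" "space ?Q = SU2"
    using sets_eq_imp_space_eq [OF sM] sets_eq_imp_space_eq [OF sets_quat]
    by (simp_all add: space_restrict_space)
  fix A assume AM: "A \<in> sets M"
  then have AR: "A \<in> sets ?R" and AQ: "A \<in> sets ?Q" using sM by auto
  have cong: "f \<in> N \<rightarrow>\<^sub>M ?R \<longleftrightarrow> f \<in> N \<rightarrow>\<^sub>M M" "f \<in> N \<rightarrow>\<^sub>M ?R \<longleftrightarrow> f \<in> N \<rightarrow>\<^sub>M ?Q"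
    for f and N :: "'z measure"
    using measurable_cong_sets [OF refl sM, of N] measurable_cong_sets [OF refl sets_quat, of N]
    by auto
  have m1: "fst \<in> ?Q \<Otimes>\<^sub>M M \<rightarrow>\<^sub>M ?R" "snd \<in> ?Q \<Otimes>\<^sub>M M \<rightarrow>\<^sub>M ?R"
    unfolding cong(2) [of fst] cong(1) [of snd] by measurable
  have mult: "(\<lambda>p. fst p ** snd p) \<in> ?Q \<Otimes>\<^sub>M M \<rightarrow>\<^sub>M ?R"
    by (rule measurable_SU2_mult [OF m1])
  have ind: "(\<lambda>(x, y). indicator A (x ** y) :: ennreal) \<in> borel_measurable (?Q \<Otimes>\<^sub>M M)"
    using measurable_compose [OF mult borel_measurable_indicator [OF AR]]
    by (simp add: case_prod_beta')
  have idR: "(\<lambda>x. x) \<in> ?R \<rightarrow>\<^sub>M ?R" by simp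
  have L: "(\<lambda>y. x ** y) \<in> ?R \<rightarrow>\<^sub>M ?R" and R: "(\<lambda>y. y ** x) \<in> ?R \<rightarrow>\<^sub>M ?R" if "x \<in> SU2" for x
    using measurable_SU2_mult [OF measurable_const idR, of x] measurable_SU2_mult [OF idR measurable_const, of x] that
    by (simp_all add: space_restrict_space)
  have lM: "(\<integral>\<^sup>+y. indicator A (x ** y) \<partial>M) = emeasure M A" if x: "x \<in> SU2" for x
  proof -
    have "(\<lambda>y. x ** y) \<in> M \<rightarrow>\<^sub>M M"
      using L [OF x] measurable_cong_sets [OF sM sM] by blast
    then have "(\<integral>\<^sup>+y. indicator A (x ** y) \<partial>M) = (\<integral>\<^sup>+y. indicator A y \<partial>distr M M (\<lambda>y. x ** y))"
      using AM by (intro nn_integral_distr [symmetric]) auto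
    also have "distr M M (\<lambda>y. x ** y) = M"
      using assms x by (simp add: is_haar_prob_SU2_def)
    also have "(\<integral>\<^sup>+y. indicator A y \<partial>M) = emeasure M A"
      using AM by simp
    finally show ?thesis .
  qed
  have rQ: "(\<integral>\<^sup>+y. indicator A (y ** x) \<partial>?Q) = emeasure ?Q A" if x: "x \<in> SU2" for x
  proof -
    have "(\<lambda>y. y ** x) \<in> ?Q \<rightarrow>\<^sub>M ?Q"
      using R [OF x] measurable_cong_sets [OF sets_quat sets_quat] by blast
    then have "(\<integral>\<^sup>+y. indicator A (y ** x) \<partial>?Q) = (\<integral>\<^sup>+y. indicator A y \<partial>distr ?Q ?Q (\<lambda>y. y ** x))"
      by (intro nn_integral_distr [symmetric] borel_measurable_indicator) (use AQ in simp_all)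
    also have "distr ?Q ?Q (\<lambda>y. y ** x) = ?Q"
      using quat_measure_invariant [of "\<lambda>y. y ** x" x] x by simp
    also have "(\<integral>\<^sup>+y. indicator A y \<partial>?Q) = emeasure ?Q A"
      using AQ by simp
    finally show ?thesis .
  qed
  have "emeasure M A = (\<integral>\<^sup>+x. emeasure M A \<partial>?Q)" by (simp add: Q.emeasure_space_1)
  also have "\<dots> = (\<integral>\<^sup>+x. \<integral>\<^sup>+y. indicator A (x ** y) \<partial>M \<partial>?Q)"
    by (rule nn_integral_cong) (simp add: lM spM)
  also have "\<dots> = (\<integral>\<^sup>+y. \<integral>\<^sup>+x. indicator A (x ** y) \<partial>?Q \<partial>M)"
    by (rule Fubini' [OF ind, symmetric])
  also have "\<dots> = (\<integral>\<^sup>+y. emeasure ?Q A \<partial>M)"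
    by (rule nn_integral_cong) (simp add: rQ spM)
  also have "\<dots> = emeasure ?Q A" by (simp add: M.emeasure_space_1)
  finally show "emeasure M A = emeasure ?Q A" .
qed

lemma haar_SU2_eq: "haar_SU2 = quat_measure"
  unfolding haar_SU2_def
  using is_haar_prob_SU2_quat_measure is_haar_prob_SU2_unique by (rule the_equality)

lemma is_haar_prob_haar_SU2: "is_haar_prob_SU2 haar_SU2"
  by (simp add: haar_SU2_eq is_haar_prob_SU2_quat_measure)


section \<open>Spherical trace functions\<close>

definition col_norm_sq :: "cmat2 \<Rightarrow> real" where
  "col_norm_sq g = (cmod (g$1$1))\<^sup>2 + (cmod (g$2$1))\<^sup>2"

text \<open>For the Iwasawa decomposition \<open>g = k a n\<close>, \<open>a\<close> is the diagonal matrix with entries \<open>r\<close>, \<open>1 / r\<close>,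
  where \<open>r\<close> is the norm of the first column of \<open>g\<close>.  Thus \<open>col_norm_sq g\<close> is
  the exponential of \<open>\<rho> (H g)\<close>, and the first column of \<open>k\<close> determines \<open>k\<close>.\<close>

definition iwasawa_kappa :: "cmat2 \<Rightarrow> cmat2" where
  "iwasawa_kappa g =
     (let r = complex_of_real (sqrt (col_norm_sq g)); a = g$1$1 / r; c = g$2$1 / r
      in mat2 a (- cnj c) c (cnj a))"

lemma iwasawa_kappa_iff:
  assumes "g \<in> SL2"
  shows "k = iwasawa_kappa g \<longleftrightarrow>
    k \<in> SU2 \<and> k$1$1 = g$1$1 / complex_of_real (sqrt (col_norm_sq g))
            \<and> k$2$1 = g$2$1 / complex_of_real (sqrt (col_norm_sq g))"
proof -
  define r where "r = complex_of_real (sqrt (col_norm_sq g))"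
  define a c where "a = g$1$1 / r" and "c = g$2$1 / r"
  have "g$1$1 \<noteq> 0 \<or> g$2$1 \<noteq> 0"
    using assms by (auto simp: SL2_def det_2)
  then have "col_norm_sq g > 0"
    unfolding col_norm_sq_def by (auto intro: add_pos_nonneg add_nonneg_pos)
  then have "(cmod a)\<^sup>2 + (cmod c)\<^sup>2 = 1"
    by (simp add: a_def c_def r_def norm_divide power_divide add_divide_distrib [symmetric])
       (simp add: col_norm_sq_def)
  then have "a * cnj a + c * cnj c = 1"
    by (metis complex_norm_square of_real_1 of_real_add)
  then have "mat2 a (- cnj c) c (cnj a) \<in> SU2"
    by (auto simp: SU2_def SL2_def det_2 cmat2_eq_iff cmat2_mult_nth cmat2_one_nth algebra_simps)
  moreover have "iwasawa_kappa g = mat2 a (- cnj c) c (cnj a)"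
    by (simp add: iwasawa_kappa_def Let_def a_def c_def r_def)
  ultimately show ?thesis
    using SU2_entries [of k] unfolding a_def [symmetric] c_def [symmetric] r_def [symmetric]
    by (metis cmat2_eq_iff mat2_nth)
qed

definition psi :: "int \<Rightarrow> cmat2 \<Rightarrow> complex" where
  "psi l k = cnj (k$1$1) powi (2 * l)"

definition spherical_trace :: "complex \<Rightarrow> int \<Rightarrow> cmat2 \<Rightarrow> complex" where
  "spherical_trace \<nu> l g =
     of_int (2 * l + 1) *
     (LINT k|haar_SU2. psi l (iwasawa_kappa (matrix_inv k ** g ** k)) *
                       complex_of_real (col_norm_sq (g ** k)) powr (\<nu> - 1))"

definition spherical_trace_avg :: "complex \<Rightarrow> int \<Rightarrow> int \<Rightarrow> cmat2 \<Rightarrow> complex" where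
  "spherical_trace_avg \<nu> l q g =
     1 / (2 * complex_of_real pi) *
     (LINT \<rho>:{0..2 * pi}|lborel.
        spherical_trace \<nu> l (g ** mat2 (cis \<rho>) 0 0 (cis (- \<rho>))) * cis (- 2 * of_int q * \<rho>))"

text \<open>The truncated quotient \<open>min 1 (x / y)\<close>, where \<open>x / 0\<close> means \<open>+\<infinity>\<close>.\<close>

definition min_one_quotient :: "real \<Rightarrow> real \<Rightarrow> real" where
  "min_one_quotient x y = (if y = 0 then 1 else min 1 (x / y))"

end

theory Submission
  imports Defs "HOL-Computational_Algebra.Polynomial" "HOL-Real_Asymp.Real_Asymp"
begin

text \<open>Conjugating by \<open>K\<close> and using the Cartan decomposition \<open>g = k\<^sub>1 diag(s, 1/s) k\<^sub>2\<close>, the spherical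
  trace function of \<open>g diag(e\<^bsup>i\<rho>\<^esup>, e\<^bsup>-i\<rho>\<^esup>)\<close> is that of \<open>k\<^sub>0 diag(s, 1/s)\<close> with \<open>k\<^sub>0\<close> depending on \<open>\<rho>\<close>.
  Averaging the defining integral over the diagonal torus leaves the weight \<open>|gu|\<close>, hence \<open>\<nu>\<close>, untouched
  and turns the remaining factor into the constant term of a power of a trinomial
  \<open>p + m/w + n w\<close>. This constant term depends on \<open>m\<close> and \<open>n\<close> only through \<open>m n\<close>, so the trinomial may be
  replaced by \<open>p + 2 i t cos \<theta>\<close>, after which absolute values suffice: the integrand is at most
  \<open>(1 - E/R)\<^sup>l / R\<close> in the uniformly distributed variable \<open>x = |k\<^sub>1\<^sub>1|\<^sup>2\<close>, and \<open>exp (-z) \<le> z\<^sup>-\<^sup>3\<^sup>/\<^sup>2\<close> leads to an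
  elementary integral of size \<open>1 / (\<surd>l (s - 1/s)\<^sup>2 |\<beta>|)\<close>, where \<open>\<beta>\<close> is the off-diagonal entry of \<open>k\<^sub>0\<close>.
  As a function of \<open>\<rho>\<close>, \<open>|\<beta>|\<close> is bounded below by a multiple of \<open>|sin (2 (\<rho> + c))|\<close>, so the average over
  \<open>\<rho>\<close> only costs a logarithm.
  The bound by \<open>1\<close> comes from unitarity: averaging over \<open>\<rho>\<close> first produces a product of two square roots of
  binomial densities, to which the arithmetic-geometric mean inequality and the Jacobian of the action of
  \<open>g\<close> on \<open>K\<close> apply.\<close>

section \<open>The radial integral\<close>

text \<open>At the identity the unaveraged function equals 2l+1, so a bound by 1 must integrate over
  \<rho> before taking absolute values. The decaying bound can be proved for each \<rho> and
  integrated afterwards. There the coefficients \<open>m\<close> and \<open>n\<close> carry the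
  factors 1/s and s, and absolute values taken at once would keep this imbalance. With equal
  coefficients the maximum of the squared modulus over the circle is exactly \<open>R - E\<close>,
  and \<open>E\<close> is positive when \<open>T\<close> and \<open>B\<close> are. The exponent 3/2
  fits both sides: n * n^(-3/2) is the wanted n^(-1/2), and \<open>E\<close> is h^2 (T^2 + u^2) with
  u = (B d + c h) / h and c = 2 A or - 2 A, while du = B p / (2 h^3) dx. Hence p / E^(3/2) dx is (2
  / B) du / (T^2 + u^2)^(3/2), which has an algebraic primitive bounded by 1 / T^2 in modulus. As 1
  / |sin| is not integrable, the trivial bound of order n is mixed in with weight n^(-\<Lambda>-2).
  This and an error of order n 2^(-n) account for the term l^(-\<Lambda>).\<close>

lemma exp_minus_le_inverse_mult_sqrt:
  fixes z :: real
  assumes "z > 0"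
  shows "exp (- z) \<le> 1 / (z * sqrt z)"
proof -
  \<comment> \<open>The inequality sqrt z <= (z + 1) / 2 turns z^(3/2) into a polynomial lying below
    the quadratic Taylor polynomial of exp.\<close>
  have "0 \<le> (sqrt z - 1)\<^sup>2" by simp
  then have "2 * sqrt z \<le> z + 1"
    using assms by (simp add: power2_diff)
  then have "z * sqrt z \<le> z * ((z + 1) / 2)"
    using assms by (intro mult_left_mono) auto
  also have "\<dots> \<le> 1 + z + z\<^sup>2 / 2"
    using assms by (simp add: power2_eq_square field_simps)
  also have "\<dots> \<le> exp z"
    using assms exp_lower_Taylor_quadratic by simp
  finally have "z * sqrt z \<le> exp z" .
  with assms show ?thesis
    by (simp add: exp_minus field_simps)
qed

text \<open>In the application \<open>A = |Im \<alpha>|\<close> and \<open>B = |\<beta>|\<close> for the first row \<open>(\<alpha>, \<beta>)\<close> of \<open>k\<^sub>0\<close>. Then \<open>R\<close> is the squared norm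
  of the image vector and \<open>R - E\<close> the bound for the squared modulus of the trinomial; the second square
  in \<open>E\<close> is the defect in a Cauchy-Schwarz inequality.\<close>

locale cartan_profile =
  fixes s A B :: real
  assumes s: "s > 0" and A: "A \<ge> 0" and B: "B \<ge> 0"
begin

text \<open>With \<open>x\<close> the squared modulus of the entry (1,1) of \<open>k\<close>,
  \<open>h x\<close> is the product of the moduli of the entries in its first column. The factors of
  Re \<alpha> and Im \<alpha> in the constant coefficient of the trinomial are \<open>p x\<close>
  and \<open>d x\<close>. \<open>T\<close> bounds the distance from \<open>K\<close>.\<close>

definition "T = \<bar>s - 1 / s\<bar>"
definition "h x = sqrt (x * (1 - x))"
definition "d x = s * x - (1 - x) / s"
definition "p x = s * x + (1 - x) / s"
definition "R x = s\<^sup>2 * x + (1 - x) / s\<^sup>2"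
definition "E x = (h x * T)\<^sup>2 + (2 * A * h x - B * \<bar>d x\<bar>)\<^sup>2"

lemma h_sq: "0 \<le> x \<Longrightarrow> x \<le> 1 \<Longrightarrow> (h x)\<^sup>2 = x * (1 - x)"
  by (simp add: h_def)

lemma h_pos: "0 < x \<Longrightarrow> x < 1 \<Longrightarrow> h x > 0"
  by (simp add: h_def)

lemma p_pos: "0 \<le> x \<Longrightarrow> x \<le> 1 \<Longrightarrow> p x > 0"
  using s unfolding p_def by (cases "x = 0") (auto intro!: add_pos_nonneg)

lemma R_pos: "0 \<le> x \<Longrightarrow> x \<le> 1 \<Longrightarrow> R x > 0"
  using s unfolding R_def by (cases "x = 0") (auto intro!: add_pos_nonneg)

text \<open>A variance identity: a variable with values s and 1/s, taken with probabilities x and 1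
  - x, has mean \<open>p x\<close>, second moment \<open>R x\<close> and variance
  \<open>(h x * T)^2\<close>.\<close>

lemma R_eq_p: "0 \<le> x \<Longrightarrow> x \<le> 1 \<Longrightarrow> R x = (p x)\<^sup>2 + (h x * T)\<^sup>2"
  unfolding power_mult_distrib h_sq T_def power2_abs R_def p_def using s
  by (simp add: field_simps power2_eq_square)

lemma p_eq_d: "0 \<le> x \<Longrightarrow> x \<le> 1 \<Longrightarrow> (p x)\<^sup>2 = (d x)\<^sup>2 + 4 * (h x)\<^sup>2"
  unfolding h_sq p_def d_def using s by (simp add: field_simps power2_eq_square)

lemma R_ge_h: "0 \<le> x \<Longrightarrow> x \<le> 1 \<Longrightarrow> R x \<ge> 2 * h x"
proof -
  assume x: "0 \<le> x" "x \<le> 1"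
  have "R x - 2 * h x = (s * sqrt x - sqrt (1 - x) / s)\<^sup>2"
    using x s by (simp add: R_def h_def power2_diff power_mult_distrib power_divide real_sqrt_mult)
  then show ?thesis by (smt (verit) zero_le_power2)
qed

text \<open>This equals (1 - A^2 - B^2) p^2 + (A |d| + 2 B h)^2, the bound that the trinomial
  produces when (Re \<alpha>)^2 = 1 - A^2 - B^2. In the form below nonnegativity is visible once A
  and B are at most 1.\<close>

lemma R_minus_E:
  assumes "0 \<le> x" "x \<le> 1"
  shows "R x - E x = (d x)\<^sup>2 * (1 - B\<^sup>2) + 4 * (h x)\<^sup>2 * (1 - A\<^sup>2) + 4 * A * B * h x * \<bar>d x\<bar>"
  unfolding R_eq_p [OF assms] E_def p_eq_d [OF assms]
  by (simp add: power2_diff power_mult_distrib algebra_simps)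

text \<open>Splits off the region where the root of \<open>R\<close> is not controlled by
  \<open>p\<close>. There the power decays like 2^(-n). Elsewhere sqrt R <= 2 p supplies the
  numerator \<open>p\<close> that makes the integrand an exact derivative.\<close>

lemma E_ge_half:
  assumes x: "0 \<le> x" "x \<le> 1" and R: "R x > 4 * (p x)\<^sup>2"
  shows "E x \<ge> R x / 2"
proof -
  have "E x \<ge> (h x * T)\<^sup>2" by (simp add: E_def)
  with R R_eq_p [OF x] zero_le_power2 [of "p x"] show ?thesis by linarith
qed

text \<open>This is \<open>u / (T\<^sup>2 * sqrt (T\<^sup>2 + u\<^sup>2))\<close> for \<open>u = (B * d x + c * h x) / h x\<close>, an antiderivative of
  \<open>1 / (T\<^sup>2 + u\<^sup>2)\<^bsup>3/2\<^esup>\<close> in \<open>u\<close>, rewritten so that it is continuous at the endpoints, where \<open>h\<close> vanishes.\<close>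

definition "prim c x = (B * d x + c * h x) / (T\<^sup>2 * sqrt ((h x * T)\<^sup>2 + (B * d x + c * h x)\<^sup>2))"

text \<open>\<open>E\<close> with its absolute value resolved: according to the sign of
  \<open>d x\<close>, \<open>E x\<close> is \<open>E' (- 2 * A) x\<close> or
  \<open>E' (2 * A) x\<close>. Unlike \<open>E\<close>, it is smooth inside the interval.\<close>

definition "E' c x = (h x * T)\<^sup>2 + (B * d x + c * h x)\<^sup>2"

lemma E'_pos:
  assumes "T > 0" "B > 0" "0 \<le> x" "x \<le> 1"
  shows "E' c x > 0"
proof (cases "0 < x \<and> x < 1")
  case True
  then show ?thesis using h_pos [of x] assms(1) by (auto simp: E'_def intro!: add_pos_nonneg)
next
  case False
  then have "h x = 0" "d x \<noteq> 0"
    using assms s by (auto simp: h_def d_def)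
  then show ?thesis using assms by (simp add: E'_def)
qed

lemma prim_has_derivative:
  assumes T: "T > 0" and B': "B > 0" and x: "0 < x" "x < 1"
  shows "(prim c has_real_derivative B * p x / (2 * (E' c x * sqrt (E' c x)))) (at x)"
proof -
  define h' where "h' = (1 - 2 * x) / (2 * h x)"
  have h: "(h has_real_derivative h') (at x)"
    unfolding h_def h'_def using x
    by (auto intro!: derivative_eq_intros simp: field_simps)
  have d: "(d has_real_derivative s + 1 / s) (at x)"
    unfolding d_def using s by (auto intro!: derivative_eq_intros simp: field_simps)
  define v where "v x = B * d x + c * h x" for x
  define v' where "v' = B * (s + 1 / s) + c * h'"
  have v: "(v has_real_derivative v') (at x)"
    unfolding v_def v'_def by (intro DERIV_add DERIV_cmult h d)
  define Q where "Q x = (h x * T)\<^sup>2 + (v x)\<^sup>2" for x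
  define Q' where "Q' = 2 * (T\<^sup>2 * h x * h' + v x * v')"
  have QE: "Q = E' c" by (simp add: Q_def E'_def v_def fun_eq_iff)
  have Q: "(Q has_real_derivative Q') (at x)"
    unfolding Q_def Q'_def
    by (auto intro!: derivative_eq_intros h v simp: power2_eq_square algebra_simps)
  have Qpos: "Q x > 0" using E'_pos [OF T B'] x by (simp add: QE)
  define q where "q = sqrt (Q x)"
  have q: "q > 0" "Q x = q\<^sup>2" using Qpos by (auto simp: q_def)
  have "((\<lambda>x. v x / (T\<^sup>2 * sqrt (Q x))) has_real_derivative
     (v' * (T\<^sup>2 * q) - v x * (T\<^sup>2 * (Q' / (2 * q)))) / (T\<^sup>2 * q)\<^sup>2) (at x)"
    using Qpos q(1) T unfolding q_def
    by (auto intro!: derivative_eq_intros v Q simp: field_simps power2_eq_square)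
  also have "(v' * (T\<^sup>2 * q) - v x * (T\<^sup>2 * (Q' / (2 * q)))) / (T\<^sup>2 * q)\<^sup>2
      = (v' * q\<^sup>2 - v x * (Q' / 2)) / (T\<^sup>2 * (q\<^sup>2 * q))"
    using T q(1) by (simp add: divide_simps) (simp add: power2_eq_square power4_eq_xxxx algebra_simps)
  also have "v' * q\<^sup>2 - v x * (Q' / 2) = T\<^sup>2 * (h x * (v' * h x - v x * h'))"
    unfolding q(2) [symmetric] Q_def Q'_def by (simp add: power2_eq_square algebra_simps)
  \<comment> \<open>The second factor is the numerator of the derivative of v / h. The terms with
    \<open>c\<close> cancel in it; only the part \<open>B * d\<close> of \<open>v\<close>
    contributes.\<close>
  also have "h x * (v' * h x - v x * h') = B * p x / 2"
  proof -
    have hp: "h x > 0" using x by (rule h_pos)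
    have "h x * (v' * h x - v x * h') = B * ((s + 1 / s) * (h x)\<^sup>2 - d x * (1 - 2 * x) / 2)"
      unfolding v'_def v_def h'_def using hp s by (simp add: field_simps power2_eq_square)
    also have "(s + 1 / s) * (h x)\<^sup>2 - d x * (1 - 2 * x) / 2 = p x / 2"
      using x s by (simp add: h_sq d_def p_def field_simps)
    finally show ?thesis by simp
  qed
  also have "T\<^sup>2 * (B * p x / 2) / (T\<^sup>2 * (q\<^sup>2 * q)) = B * p x / (2 * (E' c x * sqrt (E' c x)))"
    using T q(1) by (simp add: q(2) [symmetric] QE q_def)
  finally show ?thesis
    by (simp add: prim_def [abs_def] v_def Q_def)
qed

lemma continuous_on_hd [continuous_intros]:
  "continuous_on X h" "continuous_on X d" "continuous_on X p" "continuous_on X R" "continuous_on X E"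
  unfolding h_def [abs_def] d_def [abs_def] p_def [abs_def] R_def [abs_def] E_def [abs_def]
  using s by (auto intro!: continuous_intros)

lemma prim_bound: "T > 0 \<Longrightarrow> \<bar>prim c x\<bar> \<le> 1 / T\<^sup>2"
proof -
  assume T: "T > 0"
  let ?v = "B * d x + c * h x"
  have "\<bar>?v\<bar> \<le> sqrt ((h x * T)\<^sup>2 + ?v\<^sup>2)"
    by (metis real_sqrt_abs real_sqrt_le_iff le_add_same_cancel2 zero_le_power2)
  then have "\<bar>?v\<bar> / sqrt ((h x * T)\<^sup>2 + ?v\<^sup>2) \<le> 1"
    by (smt (verit) abs_ge_zero divide_le_eq_1)
  then have "\<bar>?v / sqrt ((h x * T)\<^sup>2 + ?v\<^sup>2)\<bar> \<le> 1"
    by (simp add: abs_divide)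
  then have "\<bar>?v / sqrt ((h x * T)\<^sup>2 + ?v\<^sup>2)\<bar> / T\<^sup>2 \<le> 1 / T\<^sup>2"
    by (intro divide_right_mono) auto
  then show ?thesis by (simp add: prim_def abs_divide abs_mult mult.commute)
qed

lemma integral_prim:
  assumes T: "T > 0" and B': "B > 0"
  shows "((\<lambda>x. p x / (E' c x * sqrt (E' c x))) has_integral (2 / B) * (prim c 1 - prim c 0)) {0..1}"
proof -
  have "continuous_on {0..1} (prim c)"
  proof -
    have "E' c x \<noteq> 0" if "x \<in> {0..1}" for x
      using E'_pos [OF T B', of x c] that by auto
    then show ?thesis using T unfolding prim_def [abs_def] E'_def
      by (intro continuous_intros) auto
  qed
  then have "((\<lambda>x. B * p x / (2 * (E' c x * sqrt (E' c x)))) has_integral (prim c 1 - prim c 0)) {0..1}"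
    by (intro fundamental_theorem_of_calculus_interior)
      (auto intro: prim_has_derivative [OF T B'] simp: has_real_derivative_iff_has_vector_derivative [symmetric])
  from has_integral_mult_right [OF this, of "2 / B"] show ?thesis
    using B' by simp
qed

lemma integral_inverse_h: "((\<lambda>x. 1 / h x) has_integral pi) {0..1}"
proof -
  have "((\<lambda>x. arcsin (2 * x - 1)) has_real_derivative 1 / h x) (at x)" if "x \<in> {0<..<1}" for x
  proof -
    have "1 - (2 * x - 1)\<^sup>2 = 4 * (x * (1 - x))" by (simp add: power2_eq_square algebra_simps)
    then have "sqrt (1 - (2 * x - 1)\<^sup>2) = 2 * h x" by (simp add: h_def real_sqrt_mult)
    then show ?thesis using that
      by (auto intro!: derivative_eq_intros simp: divide_simps)
  qed
  moreover have "continuous_on {0..1} (\<lambda>x. arcsin (2 * x - 1 :: real))"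
    by (intro continuous_intros) auto
  ultimately have "((\<lambda>x. 1 / h x) has_integral (arcsin (2 * 1 - 1) - arcsin (2 * 0 - 1))) {0..1}"
    by (intro fundamental_theorem_of_calculus_interior)
      (auto simp: has_real_derivative_iff_has_vector_derivative [symmetric])
  then show ?thesis by simp
qed

text \<open>Majorant for the average of the kernel over one torus orbit. The factor 1 /
  \<open>R x\<close> is the modulus of R^(\<nu> - 1) for imaginary \<nu>; the power comes from the
  trinomial and the Iwasawa normalisation.\<close>

definition "G n x = ((R x - E x) / R x) ^ n / R x"

lemma continuous_on_G: "continuous_on {0..1} (G n)"
  unfolding G_def [abs_def]
  by (intro continuous_intros) (use R_pos in force)+

context
  assumes AB: "A\<^sup>2 + B\<^sup>2 \<le> 1"
begin

lemma R_minus_E_nonneg: "0 \<le> x \<Longrightarrow> x \<le> 1 \<Longrightarrow> R x - E x \<ge> 0"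
proof -
  assume x: "0 \<le> x" "x \<le> 1"
  have "A\<^sup>2 \<le> 1" "B\<^sup>2 \<le> 1" using AB by (smt (verit) zero_le_power2)+
  moreover have "h x \<ge> 0" using x by (simp add: h_def)
  ultimately show ?thesis using A B x by (simp add: R_minus_E)
qed

lemma G_le_trivial:
  assumes x: "0 < x" "x < 1"
  shows "G n x \<le> (1 / 2) * (1 / h x)"
proof -
  have "((R x - E x) / R x) ^ n \<le> 1"
    using R_minus_E_nonneg R_pos [of x] x by (intro power_le_one) (auto simp: E_def field_simps)
  then have "G n x \<le> 1 / R x"
    unfolding G_def using R_pos [of x] x by (intro divide_right_mono) auto
  also have "\<dots> \<le> 1 / (2 * h x)"
    using R_ge_h [of x] h_pos [of x] x by (intro divide_left_mono) (auto intro!: mult_pos_pos R_pos)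
  finally show ?thesis by simp
qed

text \<open>Both signs of \<open>c\<close> occur because \<open>d\<close> changes sign inside the
  interval. Adding the two nonnegative integrands avoids splitting it there.\<close>

lemma G_le:
  assumes x: "0 < x" "x < 1" and T: "T > 0" and B': "B > 0" and n: "n > 0"
  shows "G n x \<le> 2 / (real n * sqrt (real n)) * (p x / (E' (2 * A) x * sqrt (E' (2 * A) x))
            + p x / (E' (- 2 * A) x * sqrt (E' (- 2 * A) x)))
          + (1 / 2) ^ n * (1 / h x)" (is "_ \<le> ?C * (?I1 + ?I2) + ?J")
proof -
  have x': "0 \<le> x" "x \<le> 1" using x by auto
  have R: "R x > 0" and p: "p x > 0" and h: "h x > 0"
    using R_pos p_pos h_pos x x' by auto
  have I: "?I1 \<ge> 0" "?I2 \<ge> 0" using p E'_pos [OF T B' x'] by (auto intro!: divide_nonneg_pos mult_pos_pos)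
  have J: "?J \<ge> 0" using h by simp
  have EE: "E x = E' (2 * A) x \<or> E x = E' (- 2 * A) x"
    unfolding E_def E'_def by (cases "d x \<ge> 0") (auto simp: abs_if power2_eq_square algebra_simps)
  then have Ep: "E x > 0" using E'_pos [OF T B' x'] by metis
  show ?thesis
  proof (cases "R x > 4 * (p x)\<^sup>2")
    case True
    then have "E x \<ge> R x / 2" by (rule E_ge_half [OF x'])
    then have "((R x - E x) / R x) ^ n \<le> (1 / 2) ^ n"
      using R_minus_E_nonneg [OF x'] R by (intro power_mono) (auto simp: field_simps)
    then have "G n x \<le> (1 / 2) ^ n / R x"
      unfolding G_def using R by (intro divide_right_mono) auto
    also have "\<dots> \<le> (1 / 2) ^ n / h x"
      using R_ge_h [OF x'] h R by (intro divide_left_mono) (auto intro!: mult_pos_pos)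
    finally have "G n x \<le> ?J" by simp
    then show ?thesis using I by (smt (verit) divide_nonneg_nonneg mult_nonneg_nonneg of_nat_0_le_iff real_sqrt_ge_zero)
  next
    case False
    define z where "z = real n * (E x / R x)"
    have z: "z > 0" using n Ep R by (simp add: z_def)
    have "((R x - E x) / R x) ^ n \<le> exp (- (E x / R x)) ^ n"
    proof (rule power_mono)
      show "(R x - E x) / R x \<le> exp (- (E x / R x))"
        using exp_ge_add_one_self [of "- (E x / R x)"] R by (simp add: diff_divide_distrib)
      show "0 \<le> (R x - E x) / R x" using R_minus_E_nonneg [OF x'] R by simp
    qed
    also have "\<dots> = exp (- z)" by (simp add: z_def exp_of_nat_mult [symmetric])
    also have "\<dots> \<le> 1 / (z * sqrt z)" using z by (rule exp_minus_le_inverse_mult_sqrt)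
    finally have "G n x \<le> 1 / (z * sqrt z) / R x"
      unfolding G_def using R by (intro divide_right_mono) auto
    also have "\<dots> = sqrt (R x) / (real n * sqrt (real n) * (E x * sqrt (E x)))"
      using n Ep R real_sqrt_mult_self [of "R x"]
      by (simp add: z_def real_sqrt_mult real_sqrt_divide divide_simps)
    also have "\<dots> \<le> 2 * p x / (real n * sqrt (real n) * (E x * sqrt (E x)))"
    proof (rule divide_right_mono)
      have "sqrt (R x) \<le> sqrt (4 * (p x)\<^sup>2)" using False by simp
      then show "sqrt (R x) \<le> 2 * p x" using p by (simp add: real_sqrt_mult)
    qed (use Ep in auto)
    also have "\<dots> = ?C * (p x / (E x * sqrt (E x)))" by simp
    also have "\<dots> \<le> ?C * (?I1 + ?I2)"
      using EE I by (intro mult_left_mono) auto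
    finally show ?thesis using J by linarith
  qed
qed

lemma integral_G_le_trivial: "integral {0..1} (G n) \<le> pi / 2"
proof -
  have g: "((\<lambda>x. (1 / 2) * (1 / h x)) has_integral (1/2) * pi) {0..1}"
    using has_integral_mult_right [OF integral_inverse_h, of "1/2"] .
  have "(G n has_integral integral {0..1} (G n)) {0..1}"
    using continuous_on_G integrable_continuous_real by blast
  then have "integral {0..1} (G n) \<le> (1/2) * pi"
    \<comment> \<open>At the endpoints \<open>h\<close> vanishes and 1 / 0 = 0, so the pointwise
      bound is available only in the open interval.\<close>
    using g unfolding has_integral_Icc_iff_Ioo
    by (rule has_integral_le) (use G_le_trivial in auto)
  then show ?thesis by simp
qed

lemma integral_G_le:
  assumes T: "T > 0" and B': "B > 0" and n: "n > 0"
  shows "integral {0..1} (G n) \<le> 16 / (real n * sqrt (real n) * (T\<^sup>2 * B)) + pi * (1/2) ^ n"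
proof -
  let ?C = "2 / (real n * sqrt (real n))"
  let ?S = "\<lambda>c. (2 / B) * (prim c 1 - prim c 0)"
  have g: "((\<lambda>x. ?C * (p x / (E' (2 * A) x * sqrt (E' (2 * A) x))
            + p x / (E' (- 2 * A) x * sqrt (E' (- 2 * A) x)))
          + (1 / 2) ^ n * (1 / h x)) has_integral ?C * (?S (2 * A) + ?S (- 2 * A)) + (1/2) ^ n * pi) {0..1}"
    by (intro has_integral_add has_integral_mult_right integral_prim integral_inverse_h T B')
  have "(G n has_integral integral {0..1} (G n)) {0..1}"
    using continuous_on_G integrable_continuous_real by blast
  then have "integral {0..1} (G n) \<le> ?C * (?S (2 * A) + ?S (- 2 * A)) + (1/2) ^ n * pi"
    using g unfolding has_integral_Icc_iff_Ioo
    by (rule has_integral_le) (use G_le [OF _ _ T B' n] in auto)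
  \<comment> \<open>Each difference of values of \<open>prim\<close> is at most 2 / T^2, whatever
    \<open>c\<close> is. Two of them, times 2 / B and the 2 in \<open>?C\<close>, give the
    16.\<close>
  also have "\<dots> \<le> ?C * ((2 / B) * (2 / T\<^sup>2) + (2 / B) * (2 / T\<^sup>2)) + (1/2) ^ n * pi"
  proof -
    have "?S c \<le> (2 / B) * (2 / T\<^sup>2)" for c
      using prim_bound [OF T, of c 1] prim_bound [OF T, of c 0] B'
      by (intro mult_left_mono) (auto simp: abs_le_iff)
    from add_mono [OF this this] show ?thesis
      by (intro add_right_mono mult_left_mono [where c = ?C]) auto
  qed
  finally show ?thesis by (simp add: mult_ac)
qed

end

end

section \<open>Haar measure in the variable \<open>|k\<^sub>1\<^sub>1|\<^sup>2\<close>\<close>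

text \<open>Identifies R^4 with pairs of complex numbers, so that Fubini can treat the two entries
  of the first column of a quaternion matrix separately.\<close>

lemma lborel_vec4_eq_distr:
  "(lborel :: (real^4) measure) =
     distr (lborel :: (complex \<times> complex) measure) borel
       (\<lambda>p. vector [Re (fst p), Im (fst p), Re (snd p), Im (snd p)])"
proof (rule lborel_eqI)
  define J :: "complex \<times> complex \<Rightarrow> real^4"
    where "J = (\<lambda>p. vector [Re (fst p), Im (fst p), Re (snd p), Im (snd p)])"
  have "linear J" unfolding J_def
    by (intro linearI) (simp_all add: vec_eq_iff forall_4)
  then have [measurable]: "J \<in> borel \<rightarrow>\<^sub>M borel"
    by (intro borel_measurable_continuous_onI linear_continuous_on)
      (simp add: linear_conv_bounded_linear)
  have Basis4: "(Basis :: (real^4) set) = {axis 1 1, axis 2 1, axis 3 1, axis 4 1}"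
    unfolding Basis_vec_def by (auto simp: UNIV_4)
  have ax: "axis i (1::real) \<noteq> (axis j 1 :: real^4)" if "i \<noteq> j" for i j
    using that by (simp add: axis_eq_axis)
  fix l u :: "real^4"
  assume le: "\<And>b. b \<in> Basis \<Longrightarrow> l \<bullet> b \<le> u \<bullet> b"
  have le': "l $ i \<le> u $ i" for i
    using le [of "axis i 1"] by (simp add: inner_axis axis_in_Basis_iff)
  have "J -` box l u = box (Complex (l$1) (l$2), Complex (l$3) (l$4)) (Complex (u$1) (u$2), Complex (u$3) (u$4))"
    unfolding J_def
    by (auto simp: box_def Basis4 inner_axis Basis_prod_def Basis_complex_def inner_complex_def)
  then have "emeasure (distr lborel borel J) (box l u) =
     emeasure lborel (box (Complex (l$1) (l$2), Complex (l$3) (l$4)) (Complex (u$1) (u$2), Complex (u$3) (u$4)))"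
    by (simp add: emeasure_distr)
  also have "\<dots> = ennreal ((u$1 - l$1) * (u$2 - l$2) * ((u$3 - l$3) * (u$4 - l$4)))"
    using le' by (subst emeasure_lborel_box_eq)
      (auto simp: Basis_prod_def Basis_complex_def inner_complex_def prod.union_disjoint
        disjoint_iff prod.reindex inj_on_def complex_eq_iff zero_prod_def)
  also have "\<dots> = (\<Prod>b\<in>Basis. (u - l) \<bullet> b)"
    by (simp add: Basis4 ax inner_axis axis_eq_axis mult_ac)
  finally show "emeasure (distr lborel borel J) (box l u) = (\<Prod>b\<in>Basis. (u - l) \<bullet> b)" .
qed simp

lemma nn_integral_lborel_scale:
  fixes f :: "'a::euclidean_space \<Rightarrow> ennreal"
  assumes [measurable]: "f \<in> borel_measurable borel" and c: "c > 0"
  shows "(\<integral>\<^sup>+x. f x \<partial>lborel) = ennreal (c ^ DIM('a)) * (\<integral>\<^sup>+x. f (c *\<^sub>R x) \<partial>lborel)"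
  using c by (subst lborel_affine [of c 0])
    (simp_all add: nn_integral_density nn_integral_distr nn_integral_cmult ennreal_power)

text \<open>The slice over a point with |z|^2 = s of the cone |z|^2 <= t |(z, w)|^2 in the unit
  ball. It is an annulus with squared radii s / t - s and 1 - s, so its area is linear in s as long
  as s <= t.\<close>

lemma emeasure_disc_annulus:
  fixes s t :: real
  assumes "0 \<le> s" "0 < t" "t \<le> 1"
  shows "emeasure lborel {w::complex. s + (cmod w)\<^sup>2 < 1 \<and> s \<le> t * (s + (cmod w)\<^sup>2)}
     = ennreal (pi * max 0 (1 - s / t))"
proof (cases "s \<le> t")
  case False
  then have "s / t > 1" using assms by simp
  have "\<not> (s + (cmod w)\<^sup>2 < 1 \<and> s \<le> t * (s + (cmod w)\<^sup>2))" for w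
  proof
    assume *: "s + (cmod w)\<^sup>2 < 1 \<and> s \<le> t * (s + (cmod w)\<^sup>2)"
    then have "t * (s + (cmod w)\<^sup>2) \<le> t * 1" using assms by (intro mult_left_mono) auto
    with * False show False by linarith
  qed
  then have *: "{w. s + (cmod w)\<^sup>2 < 1 \<and> s \<le> t * (s + (cmod w)\<^sup>2)} = {}" by blast
  show ?thesis unfolding * using \<open>s / t > 1\<close> by simp
next
  case True
  define a b where "a = sqrt (1 - s)" and "b = sqrt (s / t - s)"
  have st: "s / t \<ge> s" "s / t \<le> 1" using assms True by (simp_all add: pos_le_divide_eq mult_left_le)
  have a: "a \<ge> 0" "a\<^sup>2 = 1 - s" and b: "b \<ge> 0" "b\<^sup>2 = s / t - s"
    using assms True st by (auto simp: a_def b_def)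
  have ba: "b \<le> a" using st by (simp add: a_def b_def)
  have "{w::complex. s + (cmod w)\<^sup>2 < 1 \<and> s \<le> t * (s + (cmod w)\<^sup>2)} = ball 0 a - ball 0 b"
  proof -
    have "s + (cmod w)\<^sup>2 < 1 \<longleftrightarrow> cmod w < a" for w
    proof -
      have "cmod w < a \<longleftrightarrow> (cmod w)\<^sup>2 < a\<^sup>2"
        using a(1) power_strict_mono [of "cmod w" a 2] power2_less_imp_less [of "cmod w" a] by auto
      then show ?thesis using a(2) by auto
    qed
    moreover have "s \<le> t * (s + (cmod w)\<^sup>2) \<longleftrightarrow> \<not> cmod w < b" for w
    proof -
      have "s \<le> t * (s + (cmod w)\<^sup>2) \<longleftrightarrow> b\<^sup>2 \<le> (cmod w)\<^sup>2"
        unfolding b(2) using assms by (simp add: field_simps)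
      also have "\<dots> \<longleftrightarrow> b \<le> cmod w"
        using b(1) power_mono [of b "cmod w" 2] power2_le_imp_le [of b "cmod w"] by auto
      finally show ?thesis by auto
    qed
    ultimately show ?thesis by (auto simp: dist_norm)
  qed
  moreover have "emeasure lborel (ball (0::complex) a - ball 0 b)
     = emeasure lborel (ball (0::complex) a) - emeasure lborel (ball (0::complex) b)"
    using ba b by (intro emeasure_Diff) (auto simp: emeasure_ball subset_ball)
  moreover have "\<dots> = ennreal (pi * (1 - s / t))"
  proof -
    have "pi * a\<^sup>2 - pi * b\<^sup>2 = pi * (1 - s / t)"
      unfolding a(2) b(2) by (simp add: algebra_simps)
    then show ?thesis
      using a(1) b(1) by (simp add: emeasure_ball unit_ball_vol_2 ennreal_minus)
  qed
  ultimately show ?thesis using st by simp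
qed

text \<open>By Fubini over the first complex coordinate the slices are annuli. Scaling that
  coordinate by sqrt t turns their area pi (1 - |z|^2 / t) into the one for t = 1 and produces the
  factor t = (sqrt t)^2. This linearity in t is why the squared modulus of the entry (1,1) is
  uniformly distributed.\<close>

lemma emeasure_cone4:
  assumes t: "0 < t" "t \<le> 1"
  shows "emeasure lborel {x::real^4. norm x < 1 \<and> (x$1)\<^sup>2 + (x$2)\<^sup>2 \<le> t * (norm x)\<^sup>2}
     = ennreal t * (\<integral>\<^sup>+z. ennreal (pi * max 0 (1 - (cmod (z::complex))\<^sup>2)) \<partial>lborel)"
proof -
  define J :: "complex \<times> complex \<Rightarrow> real^4"
    where "J = (\<lambda>p. vector [Re (fst p), Im (fst p), Re (snd p), Im (snd p)])"
  define X :: "(complex \<times> complex) set"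
    where "X = {p. (cmod (fst p))\<^sup>2 + (cmod (snd p))\<^sup>2 < 1 \<and>
       (cmod (fst p))\<^sup>2 \<le> t * ((cmod (fst p))\<^sup>2 + (cmod (snd p))\<^sup>2)}"
  have "linear J" unfolding J_def
    by (intro linearI) (simp_all add: vec_eq_iff forall_4)
  then have [measurable]: "J \<in> borel \<rightarrow>\<^sub>M borel"
    by (intro borel_measurable_continuous_onI linear_continuous_on)
      (simp add: linear_conv_bounded_linear)
  have nJ: "(norm (J p))\<^sup>2 = (cmod (fst p))\<^sup>2 + (cmod (snd p))\<^sup>2" for p
    by (simp add: J_def norm_vec_def L2_set_def sum_4 sum_nonneg cmod_power2)
  have "J -` {x. norm x < 1 \<and> (x$1)\<^sup>2 + (x$2)\<^sup>2 \<le> t * (norm x)\<^sup>2} = X"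
  proof -
    have "norm x < 1 \<longleftrightarrow> (norm x)\<^sup>2 < 1" for x :: "real^4"
      by (simp add: abs_square_less_1)
    then show ?thesis
      by (auto simp: X_def nJ) (auto simp: J_def cmod_power2)
  qed
  then have "emeasure lborel {x::real^4. norm x < 1 \<and> (x$1)\<^sup>2 + (x$2)\<^sup>2 \<le> t * (norm x)\<^sup>2}
     = emeasure lborel X"
    unfolding lborel_vec4_eq_distr J_def [symmetric] by (subst emeasure_distr) auto
  also have "\<dots> = emeasure (lborel \<Otimes>\<^sub>M lborel) X" by (simp only: lborel_prod)
  also have "\<dots> = (\<integral>\<^sup>+z. emeasure lborel (Pair z -` X) \<partial>lborel)"
  proof (rule lborel.emeasure_pair_measure_alt)
    have "X \<in> sets (borel :: (complex \<times> complex) measure)"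
    proof -
      have 1: "open {p :: complex \<times> complex. (cmod (fst p))\<^sup>2 + (cmod (snd p))\<^sup>2 < 1}"
        by (intro open_Collect_less continuous_intros)
      have 2: "closed {p :: complex \<times> complex. (cmod (fst p))\<^sup>2 \<le> t * ((cmod (fst p))\<^sup>2 + (cmod (snd p))\<^sup>2)}"
        by (intro closed_Collect_le continuous_intros)
      show ?thesis unfolding X_def Collect_conj_eq
        using 1 2 by (intro sets.Int borel_open borel_closed)
    qed
    then show "X \<in> sets (lborel \<Otimes>\<^sub>M lborel)" unfolding lborel_prod by simp
  qed
  also have "\<dots> = (\<integral>\<^sup>+z. ennreal (pi * max 0 (1 - (cmod (z::complex))\<^sup>2 / t)) \<partial>lborel)"
    using t by (intro nn_integral_cong) (simp add: X_def vimage_def emeasure_disc_annulus)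
  also have "\<dots> = ennreal ((sqrt t) ^ DIM(complex)) *
      (\<integral>\<^sup>+z. ennreal (pi * max 0 (1 - (cmod (sqrt t *\<^sub>R (z::complex)))\<^sup>2 / t)) \<partial>lborel)"
    using t by (intro nn_integral_lborel_scale) auto
  also have "\<dots> = ennreal t * (\<integral>\<^sup>+z. ennreal (pi * max 0 (1 - (cmod (z::complex))\<^sup>2)) \<partial>lborel)"
    using t by (simp add: power_mult_distrib)
  finally show ?thesis .
qed

lemma prob_space_haar: "prob_space haar_SU2"
  using is_haar_prob_haar_SU2 by (simp add: is_haar_prob_SU2_def)

lemma sets_haar [measurable_cong]: "sets haar_SU2 = sets (restrict_space borel SU2)"
  using is_haar_prob_haar_SU2 by (simp add: is_haar_prob_SU2_def)

lemma space_haar: "space haar_SU2 = SU2"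
  using sets_eq_imp_space_eq [OF sets_haar] by (simp add: space_restrict_space)

lemma borel_measurable_haar:
  "f \<in> borel_measurable borel \<Longrightarrow> f \<in> borel_measurable haar_SU2"
  using measurable_cong_sets [OF sets_haar refl, of borel] measurable_restrict_space1 by blast

lemma borel_measurable_entry: "(\<lambda>k::cmat2. k $ i $ j) \<in> borel_measurable borel"
  by (intro borel_measurable_continuous_onI continuous_intros)

lemma measurable_entry_haar [measurable]: "(\<lambda>k. k $ i $ j) \<in> borel_measurable haar_SU2"
  by (intro borel_measurable_haar borel_measurable_entry)

lemma SU2_column_norm:
  assumes "k \<in> SU2"
  shows "(cmod (k$1$1))\<^sup>2 + (cmod (k$2$1))\<^sup>2 = 1"
proof -
  have "k$1$1 * k$2$2 - k$1$2 * k$2$1 = 1"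
    using assms by (simp add: SU2_def SL2_def det_2)
  then have "k$1$1 * cnj (k$1$1) + k$2$1 * cnj (k$2$1) = 1"
    by (simp add: SU2_entries [OF assms] mult.commute)
  then have "complex_of_real ((cmod (k$1$1))\<^sup>2 + (cmod (k$2$1))\<^sup>2) = 1"
    by (simp only: of_real_add complex_norm_square)
  then show ?thesis using of_real_eq_1_iff by blast
qed

lemma measure_haar_cap:
  assumes t: "0 < t" "t \<le> 1"
  shows "measure haar_SU2 {k \<in> SU2. (cmod (k$1$1))\<^sup>2 \<le> t} = t"
proof -
  let ?B = "ball (0::real^4) 1"
  let ?U = "uniform_measure lborel ?B"
  let ?S = "\<lambda>t. {x::real^4. norm x < 1 \<and> (x$1)\<^sup>2 + (x$2)\<^sup>2 \<le> t * (norm x)\<^sup>2}"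
  define V where "V = (\<integral>\<^sup>+z. ennreal (pi * max 0 (1 - (cmod (z::complex))\<^sup>2)) \<partial>lborel)"
  \<comment> \<open>The whole ball is the case t = 1. The integral in \<open>emeasure_cone4\<close>
    is therefore the volume of the ball and cancels without being evaluated.\<close>
  have "?S 1 = ?B"
    by (auto simp: dist_norm norm_vec_def L2_set_def sum_4 sum_nonneg)
  then have V: "emeasure lborel ?B = V"
    using emeasure_cone4 [of 1] by (simp add: V_def)
  have mS: "{k \<in> SU2. (cmod (k$1$1))\<^sup>2 \<le> t} \<in> sets (restrict_space borel SU2)"
  proof -
    have "{k::cmat2. (cmod (k$1$1))\<^sup>2 \<le> t} \<in> sets borel"
      by (intro borel_closed closed_Collect_le continuous_intros)
    then have "SU2 \<inter> {k::cmat2. (cmod (k$1$1))\<^sup>2 \<le> t} \<in> sets (restrict_space borel SU2)"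
      unfolding sets_restrict_space by (rule imageI)
    then show ?thesis by (simp add: Int_def)
  qed
  have "emeasure haar_SU2 {k \<in> SU2. (cmod (k$1$1))\<^sup>2 \<le> t}
    = emeasure ?U (quat_proj -` {k \<in> SU2. (cmod (k$1$1))\<^sup>2 \<le> t} \<inter> space ?U)"
    unfolding haar_SU2_eq quat_measure_def
    using mS by (intro emeasure_distr) (auto simp: measurable_quat_proj)
  also have "\<dots> = emeasure lborel (?B \<inter> (quat_proj -` {k \<in> SU2. (cmod (k$1$1))\<^sup>2 \<le> t})) / V"
    using measurable_sets [OF measurable_quat_proj mS]
    by (subst emeasure_uniform_measure) (simp_all add: V)
  also have "emeasure lborel (?B \<inter> (quat_proj -` {k \<in> SU2. (cmod (k$1$1))\<^sup>2 \<le> t})) = emeasure lborel (?S t)"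
  proof (rule emeasure_eq_AE)
    have key: "(cmod (quat_proj x $1$1))\<^sup>2 \<le> t \<longleftrightarrow> (x$1)\<^sup>2 + (x$2)\<^sup>2 \<le> t * (norm x)\<^sup>2"
      if "x \<noteq> 0" for x
    proof -
      have "(cmod (quat_proj x $1$1))\<^sup>2 = ((x$1)\<^sup>2 + (x$2)\<^sup>2) / (norm x)\<^sup>2"
        using that by (simp add: quat_proj_def quat_mat_def cmod_power2 power_divide add_divide_distrib divide_inverse power_mult_distrib power_inverse algebra_simps)
      then show ?thesis using that by (simp add: pos_divide_le_eq)
    qed
    \<comment> \<open>The origin has to be excluded, since \<open>quat_proj\<close> takes a default
      value there.\<close>
    have "AE x in lborel. x \<noteq> (0::real^4)" by (rule AE_lborel_singleton)
    then show "AE x in lborel. (x \<in> ?B \<inter> (quat_proj -` {k \<in> SU2. (cmod (k$1$1))\<^sup>2 \<le> t})) = (x \<in> ?S t)"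
      by eventually_elim (use key quat_proj_in_SU2 in auto)
    show "?S t \<in> sets lborel" by measurable
    show "?B \<inter> quat_proj -` {k \<in> SU2. (cmod (k$1$1))\<^sup>2 \<le> t} \<in> sets lborel"
      using measurable_sets [OF measurable_quat_proj mS] by simp
  qed
  also have "\<dots> = ennreal t * V" using emeasure_cone4 [OF t] by (simp add: V_def)
  also have "ennreal t * V / V = ennreal t"
  proof -
    have "V / V = 1"
      using emeasure_ball4 V by (intro ennreal_divide_self) (auto simp: less_top)
    then show ?thesis by (simp add: ennreal_times_divide [symmetric])
  qed
  finally show ?thesis using t by (simp add: measure_def)
qed

lemma distr_haar_entry:
  "distr haar_SU2 borel (\<lambda>k. (cmod (k$1$1))\<^sup>2) = uniform_measure lborel {0..1::real}"
proof (rule cdf_unique)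
  interpret H: prob_space haar_SU2 by (rule prob_space_haar)
  let ?f = "\<lambda>k::cmat2. (cmod (k$1$1))\<^sup>2"
  have P1: "prob_space (distr haar_SU2 borel ?f)"
    by (intro H.prob_space_distr) measurable
  then show 1: "real_distribution (distr haar_SU2 borel ?f)"
    by (simp add: real_distribution_def real_distribution_axioms_def)
  have P2: "prob_space (uniform_measure lborel {0..1::real})"
    by (intro prob_space_uniform_measure) auto
  then show "real_distribution (uniform_measure lborel {0..1::real})"
    by (simp add: real_distribution_def real_distribution_axioms_def)
  interpret P1: real_distribution "distr haar_SU2 borel ?f" by fact
  have c: "cdf (distr haar_SU2 borel ?f) t = measure haar_SU2 {k \<in> SU2. ?f k \<le> t}" for t
  proof -
    have "?f -` {..t} \<inter> space haar_SU2 = {k \<in> SU2. ?f k \<le> t}" by (auto simp: space_haar)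
    then show ?thesis by (simp add: cdf_def measure_distr)
  qed
  have le1: "?f k \<le> 1" if "k \<in> SU2" for k
    using SU2_column_norm [OF that] zero_le_power2 [of "cmod (k$2$1)"] by linarith
  have "cdf (distr haar_SU2 borel ?f) t = cdf (uniform_measure lborel {0..1}) t" for t
  proof -
    have u: "cdf (uniform_measure lborel {0..1::real}) t = measure lborel ({0..1} \<inter> {..t})"
      by (simp add: cdf_def measure_uniform_measure)
    consider "t < 0" | "t = 0" | "0 < t" "t \<le> 1" | "t > 1" by linarith
    then show ?thesis
    proof cases
      case 1
      then have e: "{k \<in> SU2. ?f k \<le> t} = {}" "{0..1} \<inter> {..t} = {}"
        by (auto simp: not_le) (smt (verit) zero_le_power2)
      show ?thesis unfolding c u e by simp
    next
      \<comment> \<open>The cap formula covers only t > 0; the value at 0 follows by monotonicity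
        from arbitrarily small caps.\<close>
      case 2
      have *: "cdf (distr haar_SU2 borel ?f) t \<le> e" if e: "0 < e" "e \<le> 1" for e
        using P1.cdf_nondecreasing [of t e] measure_haar_cap [OF e] 2 e by (simp add: c)
      then have "cdf (distr haar_SU2 borel ?f) t \<le> 0"
        using field_le_epsilon [of "cdf (distr haar_SU2 borel ?f) t" 0] *
        by (smt (verit) P1.cdf_bounded_prob)
      moreover have "cdf (distr haar_SU2 borel ?f) t \<ge> 0" by (simp add: cdf_def)
      moreover have "{0..1} \<inter> {..t} = {0}" using 2 by auto
      ultimately show ?thesis by (simp add: u)
    next
      case 3
      then have "{0..1} \<inter> {..t} = {0..t}" by auto
      with 3 show ?thesis by (simp add: c u measure_haar_cap)
    next
      case 4
      then have e: "{k \<in> SU2. ?f k \<le> t} = space haar_SU2" "{0..1} \<inter> {..t} = {0..1}"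
        using le1 by (force simp: space_haar)+
      show ?thesis unfolding c u e by (simp add: H.prob_space)
    qed
  qed
  then show "cdf (distr haar_SU2 borel ?f) = cdf (uniform_measure lborel {0..1})" by auto
qed

lemma integral_haar_entry:
  fixes F :: "real \<Rightarrow> real"
  assumes F: "continuous_on {0..1} F"
  shows "(LINT k|haar_SU2. F ((cmod (k$1$1))\<^sup>2)) = integral {0..1} F"
proof -
  define F' where "F' x = indicator {0..1} x * F x" for x
  have mF [measurable]: "F' \<in> borel_measurable borel"
    unfolding F'_def using borel_measurable_continuous_on_indicator [OF _ F] by simp
  have le1: "(cmod (k$1$1))\<^sup>2 \<le> 1" if "k \<in> SU2" for k
    using SU2_column_norm [OF that] zero_le_power2 [of "cmod (k$2$1)"] by linarith
  have "(LINT k|haar_SU2. F ((cmod (k$1$1))\<^sup>2)) = (LINT k|haar_SU2. F' ((cmod (k$1$1))\<^sup>2))"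
    by (intro Bochner_Integration.integral_cong) (use le1 in \<open>auto simp: F'_def space_haar\<close>)
  also have "\<dots> = (LINT x|uniform_measure lborel {0..1}. F' x)"
    unfolding distr_haar_entry [symmetric] by (subst integral_distr) auto
  also have "\<dots> = (LINT x|lborel. F' x)"
  proof -
    have "uniform_measure lborel {0..1::real} = density lborel (\<lambda>x. ennreal (indicator {0..1} x))"
      unfolding uniform_measure_def by (intro density_cong) (auto simp: ennreal_indicator divide_ennreal_def)
    then show ?thesis
    by (simp, subst integral_density) (auto intro!: Bochner_Integration.integral_cong simp: F'_def indicator_def)
  qed
  also have "\<dots> = (LINT x:{0..1}|lborel. F x)"
    by (simp add: F'_def set_lebesgue_integral_def)
  also have "\<dots> = integral {0..1} F"
    by (rule set_borel_integral_eq_integral) (rule borel_integrable_atLeastAtMost', rule F)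
  finally show ?thesis .
qed

section \<open>Averages over the circle and the torus\<close>

definition torus :: "real \<Rightarrow> cmat2" where
  "torus \<theta> = mat2 (cis \<theta>) 0 0 (cis (- \<theta>))"

definition circ :: "real measure" where
  "circ = uniform_measure lborel {0..2 * pi}"

lemma sets_circ [simp, measurable_cong]: "sets circ = sets borel"
  and space_circ [simp]: "space circ = UNIV"
  by (simp_all add: circ_def)

lemma prob_space_circ: "prob_space circ"
  unfolding circ_def by (rule prob_space_uniform_measure) auto

lemma integral_circ:
  fixes f :: "real \<Rightarrow> 'a::{banach, second_countable_topology}"
  assumes [measurable]: "f \<in> borel_measurable borel"
  shows "(LINT \<theta>|circ. f \<theta>) = (1 / (2 * pi)) *\<^sub>R (LINT \<theta>:{0..2*pi}|lborel. f \<theta>)"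
proof -
  have eq: "circ = density lborel (\<lambda>x. ennreal (indicator {0..2 * pi} x / (2 * pi)))"
    unfolding circ_def uniform_measure_def
    by (intro density_cong) (auto simp: indicator_def divide_ennreal [symmetric])
  have "(LINT \<theta>|circ. f \<theta>) = (LINT \<theta>|lborel. (indicator {0..2 * pi} \<theta> / (2 * pi)) *\<^sub>R f \<theta>)"
    unfolding eq by (subst integral_density) auto
  also have "\<dots> = (LINT \<theta>|lborel. (1 / (2 * pi)) *\<^sub>R (indicator {0..2 * pi} \<theta> *\<^sub>R f \<theta>))"
    by simp
  finally show ?thesis
    by (simp only: set_lebesgue_integral_def integral_scaleR_right)
qed

lemma integral_circ_continuous:
  fixes f :: "real \<Rightarrow> 'a::euclidean_space"
  assumes f: "continuous_on UNIV f"
  shows "(LINT \<theta>|circ. f \<theta>) = (1 / (2 * pi)) *\<^sub>R integral {0..2 * pi} f"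
proof -
  have "f \<in> borel_measurable borel" using f by (rule borel_measurable_continuous_onI)
  moreover have "(LINT \<theta>:{0..2*pi}|lborel. f \<theta>) = integral {0..2 * pi} f"
    by (rule set_borel_integral_eq_integral)
      (use f in \<open>auto intro!: borel_integrable_atLeastAtMost' intro: continuous_on_subset\<close>)
  ultimately show ?thesis by (simp add: integral_circ)
qed

lemma integrable_circ_continuous:
  fixes f :: "real \<Rightarrow> 'a::euclidean_space"
  assumes f: "continuous_on UNIV f"
  shows "integrable circ f"
proof -
  interpret C: prob_space circ by (rule prob_space_circ)
  have m: "f \<in> borel_measurable borel" using f by (rule borel_measurable_continuous_onI)
  have "compact (f ` {0..2 * pi})"
    using f by (intro compact_continuous_image) (auto intro: continuous_on_subset)
  then obtain B where B: "\<And>x. x \<in> {0..2 * pi} \<Longrightarrow> norm (f x) \<le> B"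
    by (meson bounded_iff compact_imp_bounded image_eqI)
  show ?thesis
  proof (rule C.integrable_const_bound [where B = B])
    show "AE x in circ. norm (f x) \<le> B"
      unfolding circ_def by (intro AE_uniform_measureI always_eventually) (use B in auto)
    show "f \<in> borel_measurable circ" using m by simp
  qed
qed

lemma integral_circ_cis:
  "(LINT \<theta>|circ. cis (2 * real_of_int j * \<theta>)) = (if j = 0 then 1 else 0)"
proof (cases "j = 0")
  case True
  then show ?thesis
    using prob_space.prob_space [OF prob_space_circ] by simp
next
  case False
  let ?c = "2 * real_of_int j"
  have "((\<lambda>\<theta>. cis (?c * \<theta>)) has_integral
      (cis (?c * (2 * pi)) / (\<i> * of_real ?c) - cis (?c * 0) / (\<i> * of_real ?c))) {0..2 * pi}"
  proof (rule fundamental_theorem_of_calculus)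
    fix x
    define c where "c = complex_of_real ?c"
    have c: "c \<noteq> 0" using False by (simp add: c_def)
    have "((\<lambda>z. exp (\<i> * c * z) / (\<i> * c)) has_field_derivative exp (\<i> * c * of_real x)) (at (of_real x))"
      using c by (auto intro!: derivative_eq_intros)
    from has_vector_derivative_real_field [OF this]
    show "((\<lambda>\<theta>. cis (?c * \<theta>) / (\<i> * of_real ?c)) has_vector_derivative cis (?c * x))
        (at x within {0..2*pi})"
      by (simp add: cis_conv_exp c_def mult.assoc)
  qed simp
  moreover have "cis (?c * (2 * pi)) = 1"
    using cis_multiple_2pi [of "?c"] by (simp add: mult_ac)
  ultimately have "integral {0..2*pi} (\<lambda>\<theta>. cis (?c * \<theta>)) = 0"
    by (simp add: integral_unique)
  then show ?thesis
    using False by (subst integral_circ_continuous) (auto intro!: continuous_intros)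
qed

text \<open>Only the product \<open>m * n\<close> matters: this is the contour shift in \<open>w = cis (2 * \<theta>)\<close>.\<close>

lemma integral_circ_trinomial:
  fixes p m n :: complex
  assumes n: "n \<noteq> 0"
  shows "(LINT \<theta>|circ. (p + m * cis (- 2 * \<theta>) + n * cis (2 * \<theta>)) ^ N) = coeff ([:m * n, p, 1:] ^ N) N"
proof -
  let ?q = "[:m * n, p, 1:] ^ N"
  have "(p + m * cis (- 2 * \<theta>) + n * cis (2 * \<theta>)) ^ N
     = (\<Sum>i\<le>degree ?q. coeff ?q i * n ^ i / n ^ N * cis (2 * real_of_int (int i - int N) * \<theta>))" for \<theta>
  proof -
    define w where "w = cis (2 * \<theta>)"
    have "cis (- 2 * \<theta>) * w = 1" "w \<noteq> 0" by (simp_all add: w_def cis_mult)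
    then have w: "w \<noteq> 0" "cis (- 2 * \<theta>) = 1 / w" by (simp_all add: nonzero_eq_divide_eq)
    have "p + m * (1 / w) + n * w = poly [:m * n, p, 1:] (n * w) / (n * w)"
      using w n by (simp add: field_simps)
    then have "(p + m * (1 / w) + n * w) ^ N = poly ?q (n * w) / (n * w) ^ N"
      by (simp add: power_divide poly_power)
    also have "\<dots> = (\<Sum>i\<le>degree ?q. coeff ?q i * (n * w) ^ i / (n * w) ^ N)"
      by (simp add: poly_altdef sum_divide_distrib)
    also have "\<dots> = (\<Sum>i\<le>degree ?q. coeff ?q i * n ^ i / n ^ N * (w ^ i / w ^ N))"
      by (simp add: power_mult_distrib mult.assoc)
    also have "\<dots> = (\<Sum>i\<le>degree ?q. coeff ?q i * n ^ i / n ^ N * cis (2 * real_of_int (int i - int N) * \<theta>))"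
      by (simp add: w_def Complex.DeMoivre cis_divide algebra_simps)
    finally show ?thesis unfolding w(2) w_def [symmetric] .
  qed
  then have "(LINT \<theta>|circ. (p + m * cis (- 2 * \<theta>) + n * cis (2 * \<theta>)) ^ N)
     = (\<Sum>i\<le>degree ?q. coeff ?q i * n ^ i / n ^ N * (LINT \<theta>|circ. cis (2 * real_of_int (int i - int N) * \<theta>)))"
    by (simp add: integrable_circ_continuous continuous_intros Bochner_Integration.integral_sum)
  also have "\<dots> = (\<Sum>i\<le>degree ?q. if i = N then coeff ?q N else 0)"
    unfolding integral_circ_cis using n by (intro sum.cong) auto
  also have "\<dots> = coeff ?q N"
    by (simp add: coeff_eq_0 not_le)
  finally show ?thesis .
qed

text \<open>The choice m = n = i s has the same product and turns the trinomial into p + 2 i s cos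
  (2 \<theta>), so that only Im p competes with the oscillating term. The equivalence of n = 0 and m
  = 0 settles the degenerate case, in which \<open>integral_circ_trinomial\<close> is not
  applicable.\<close>

lemma norm_integral_circ_trinomial_le:
  fixes p m n :: complex
  assumes mn: "m * n = - of_real (s\<^sup>2)" "n = 0 \<longleftrightarrow> m = 0" and s: "s \<ge> 0"
  shows "norm (LINT \<theta>|circ. (p + m * cis (- 2 * \<theta>) + n * cis (2 * \<theta>)) ^ (2 * N))
      \<le> ((Re p)\<^sup>2 + (\<bar>Im p\<bar> + 2 * s)\<^sup>2) ^ N"
proof -
  interpret C: prob_space circ by (rule prob_space_circ)
  let ?J = "\<lambda>m n. LINT \<theta>|circ. (p + m * cis (- 2 * \<theta>) + n * cis (2 * \<theta>)) ^ (2 * N)"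
  have "?J m n = ?J (\<i> * of_real s) (\<i> * of_real s)"
  proof (cases "n = 0")
    case True
    with mn have "s = 0" by simp
    with True mn(2) show ?thesis by simp
  next
    case False
    with mn have "s \<noteq> 0" by auto
    moreover have "\<i> * of_real s * (\<i> * of_real s) = m * n"
      unfolding mn by (simp add: complex_eq_iff power2_eq_square)
    ultimately show ?thesis
      using integral_circ_trinomial [OF False, of p m "2 * N"]
        integral_circ_trinomial [of "\<i> * of_real s" p "\<i> * of_real s" "2 * N"]
      by (metis complex_i_not_zero mult_eq_0_iff of_real_eq_0_iff)
  qed
  moreover have "norm (?J (\<i> * of_real s) (\<i> * of_real s)) \<le> ((Re p)\<^sup>2 + (\<bar>Im p\<bar> + 2 * s)\<^sup>2) ^ N"
  proof (rule order_trans [OF integral_norm_bound], rule C.integral_le_const)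
    let ?z = "\<lambda>\<theta>. p + \<i> * of_real s * cis (- 2 * \<theta>) + \<i> * of_real s * cis (2 * \<theta>)"
    show "integrable circ (\<lambda>\<theta>. norm (?z \<theta> ^ (2 * N)))"
      by (intro integrable_norm integrable_circ_continuous continuous_intros)
    have "norm (?z \<theta> ^ (2 * N)) \<le> ((Re p)\<^sup>2 + (\<bar>Im p\<bar> + 2 * s)\<^sup>2) ^ N" for \<theta>
    proof -
      have z: "Re (?z \<theta>) = Re p" "Im (?z \<theta>) = Im p + 2 * s * cos (2 * \<theta>)" by simp_all
      have "\<bar>Im p + 2 * s * cos (2 * \<theta>)\<bar> \<le> \<bar>Im p\<bar> + 2 * s * 1"
        using s abs_cos_le_one [of "2 * \<theta>"]
        by (intro order_trans [OF abs_triangle_ineq] add_mono) (auto simp: abs_mult mult_left_le)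
      then have "(Im p + 2 * s * cos (2 * \<theta>))\<^sup>2 \<le> (\<bar>Im p\<bar> + 2 * s)\<^sup>2"
        using s by (intro abs_le_square_iff [THEN iffD1]) auto
      then have "(norm (?z \<theta>))\<^sup>2 \<le> (Re p)\<^sup>2 + (\<bar>Im p\<bar> + 2 * s)\<^sup>2"
        unfolding cmod_power2 z by simp
      then have "((norm (?z \<theta>))\<^sup>2) ^ N \<le> ((Re p)\<^sup>2 + (\<bar>Im p\<bar> + 2 * s)\<^sup>2) ^ N"
        by (intro power_mono) auto
      then show ?thesis by (simp only: norm_power power_mult)
    qed
    then show "AE \<theta> in circ. norm (?z \<theta> ^ (2 * N)) \<le> ((Re p)\<^sup>2 + (\<bar>Im p\<bar> + 2 * s)\<^sup>2) ^ N"
      by (intro always_eventually allI)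
  qed
  ultimately show ?thesis by simp
qed

text \<open>The term with index j of the binomial expansion has frequency 2 j - 2 l, and the
  integral keeps the one with frequency 2 q.\<close>

lemma integral_circ_binomial:
  fixes a b :: complex and l :: nat and q :: int
  assumes q: "\<bar>q\<bar> \<le> int l"
  shows "(LINT \<theta>|circ. (a * cis (- \<theta>) + b * cis \<theta>) ^ (2 * l) * cis (- 2 * of_int q * \<theta>))
     = of_nat ((2 * l) choose nat (int l + q)) * b ^ nat (int l + q) * a ^ nat (int l - q)"
proof -
  define j0 where "j0 = nat (int l + q)"
  have rearrange: "C * (b * x) ^ i * (a * y) ^ k * z = C * b ^ i * a ^ k * (x ^ i * y ^ k * z)" for C x y z i k
    by (simp add: power_mult_distrib mult_ac)
  have j0: "j0 \<le> 2 * l" "nat (int l - q) = 2 * l - j0" "int j0 = int l + q"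
    using q by (auto simp: j0_def)
  have "(a * cis (- \<theta>) + b * cis \<theta>) ^ (2 * l) * cis (- 2 * of_int q * \<theta>)
     = (\<Sum>j\<le>2 * l. of_nat ((2 * l) choose j) * b ^ j * a ^ (2 * l - j) * cis (2 * real_of_int (int j - int j0) * \<theta>))" for \<theta>
  proof -
    have "(a * cis (- \<theta>) + b * cis \<theta>) ^ (2 * l) * cis (- 2 * of_int q * \<theta>)
      = (\<Sum>j\<le>2 * l. of_nat ((2 * l) choose j) * (b * cis \<theta>) ^ j * (a * cis (- \<theta>)) ^ (2 * l - j) * cis (- 2 * of_int q * \<theta>))"
      by (subst add.commute, subst binomial_ring) (simp add: sum_distrib_right)
    also have "\<dots> = (\<Sum>j\<le>2 * l. of_nat ((2 * l) choose j) * b ^ j * a ^ (2 * l - j) * cis (2 * real_of_int (int j - int j0) * \<theta>))"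
    proof (intro sum.cong refl)
      fix j assume "j \<in> {..2 * l}"
      then have "cis \<theta> ^ j * cis (- \<theta>) ^ (2 * l - j) * cis (- 2 * of_int q * \<theta>) = cis (2 * real_of_int (int j - int j0) * \<theta>)"
        by (simp add: Complex.DeMoivre cis_mult j0 of_nat_diff algebra_simps)
      then show "of_nat ((2 * l) choose j) * (b * cis \<theta>) ^ j * (a * cis (- \<theta>)) ^ (2 * l - j) * cis (- 2 * of_int q * \<theta>)
        = of_nat ((2 * l) choose j) * b ^ j * a ^ (2 * l - j) * cis (2 * real_of_int (int j - int j0) * \<theta>)"
        by (simp only: rearrange)
    qed
    finally show ?thesis .
  qed
  then have "(LINT \<theta>|circ. (a * cis (- \<theta>) + b * cis \<theta>) ^ (2 * l) * cis (- 2 * of_int q * \<theta>))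
     = (\<Sum>j\<le>2 * l. of_nat ((2 * l) choose j) * b ^ j * a ^ (2 * l - j) *
         (LINT \<theta>|circ. cis (2 * real_of_int (int j - int j0) * \<theta>)))"
    by (simp add: integrable_circ_continuous continuous_intros Bochner_Integration.integral_sum)
  also have "\<dots> = (\<Sum>j\<le>2 * l. if j = j0 then of_nat ((2 * l) choose j0) * b ^ j0 * a ^ (2 * l - j0) else 0)"
    unfolding integral_circ_cis by (intro sum.cong) auto
  finally show ?thesis using j0 by (simp add: j0_def)
qed

lemma integral_circ_shift:
  fixes f :: "real \<Rightarrow> real"
  assumes f: "continuous_on UNIV f" and per: "\<And>x. f (x + 2 * pi) = f x" and c: "0 \<le> c" "c \<le> 2 * pi"
  shows "(LINT \<theta>|circ. f (\<theta> + c)) = (LINT \<theta>|circ. f \<theta>)"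
proof -
  have int: "f integrable_on {a..b}" for a b
    using f by (intro integrable_continuous_real) (auto intro: continuous_on_subset)
  have shift: "integral {a..b} (\<lambda>x. f (x + t)) = integral {a + t..b + t} f" for a b t
    using integral_shift_Icc_real [of a b f t] by (simp add: o_def add.commute)
  have "integral {0..2 * pi} (\<lambda>x. f (x + c)) = integral {c..2 * pi + c} f"
    using shift [of 0 "2 * pi" c] by simp
  also have "\<dots> = integral {c..2 * pi} f + integral {2 * pi..2 * pi + c} f"
    using c int by (intro Henstock_Kurzweil_Integration.integral_combine [symmetric]) auto
  also have "integral {2 * pi..2 * pi + c} f = integral {0..c} (\<lambda>x. f (x + 2 * pi))"
    using shift [of 0 c "2 * pi"] by (simp add: add.commute)
  also have "\<dots> = integral {0..c} f" by (simp add: per)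
  also have "integral {c..2 * pi} f + integral {0..c} f = integral {0..2 * pi} f"
    using Henstock_Kurzweil_Integration.integral_combine [of 0 c "2 * pi" f] c int by simp
  finally show ?thesis
    using f by (subst (1 2) integral_circ_continuous) (auto intro!: continuous_intros continuous_on_compose2 [OF f])
qed

lemma integral_circ_cos_shift:
  fixes f :: "real \<Rightarrow> real"
  assumes f: "continuous_on UNIV f"
  shows "(LINT \<theta>|circ. f (Re (z * cis (2 * \<theta>)))) = (LINT \<theta>|circ. f (cmod z * cos (2 * \<theta>)))"
proof -
  \<comment> \<open>Half the argument, since the angle enters doubled.\<close>
  define c where "c = Arg2pi z / 2"
  let ?f = "\<lambda>\<theta>. f (cmod z * cos (2 * \<theta>))"
  have c: "0 \<le> c" "c \<le> 2 * pi"
    using Arg2pi [of z] by (auto simp: c_def)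
  have "z = of_real (cmod z) * cis (2 * c)"
    using Arg2pi_eq [of z] by (simp add: c_def cis_conv_exp)
  then have "z * cis (2 * \<theta>) = of_real (cmod z) * cis (2 * (\<theta> + c))" for \<theta>
    by (metis (no_types, lifting) add.commute cis_mult distrib_left mult.assoc)
  then have "Re (z * cis (2 * \<theta>)) = cmod z * cos (2 * (\<theta> + c))" for \<theta>
    by simp
  moreover have "(LINT \<theta>|circ. ?f (\<theta> + c)) = (LINT \<theta>|circ. ?f \<theta>)"
  proof (rule integral_circ_shift [OF _ _ c])
    show "continuous_on UNIV ?f"
      by (intro continuous_on_compose2 [OF f] continuous_intros) auto
    show "?f (x + 2 * pi) = ?f x" for x
    proof -
      have "cos (2 * (x + 2 * pi)) = cos (2 * x + 2 * pi + 2 * pi)" by (simp add: algebra_simps)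
      also have "\<dots> = cos (2 * x)" by (simp only: cos_periodic)
      finally show ?thesis by simp
    qed
  qed
  ultimately show ?thesis by simp
qed

section \<open>Haar integrals averaged over the diagonal torus of \<open>K\<close>\<close>

lemma torus_in_SU2: "torus \<theta> \<in> SU2"
  by (auto simp: SU2_def SL2_def torus_def det_2 cmat2_eq_iff cmat2_mult_nth cmat2_one_nth cis_mult cis_cnj)

lemma distr_haar:
  assumes "k \<in> SU2"
  shows "distr haar_SU2 haar_SU2 (\<lambda>x. k ** x) = haar_SU2" "distr haar_SU2 haar_SU2 (\<lambda>x. x ** k) = haar_SU2"
  unfolding haar_SU2_eq using quat_measure_invariant assms by auto

lemma measurable_haar_mult:
  assumes "f \<in> M \<rightarrow>\<^sub>M haar_SU2" "g \<in> M \<rightarrow>\<^sub>M haar_SU2"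
  shows "(\<lambda>x. f x ** g x) \<in> M \<rightarrow>\<^sub>M haar_SU2"
  using measurable_SU2_mult [of f M g] assms unfolding measurable_cong_sets [OF refl sets_haar] .

lemma integral_haar_left:
  fixes f :: "cmat2 \<Rightarrow> 'a::{banach, second_countable_topology}"
  assumes k: "k \<in> SU2" and f: "f \<in> borel_measurable haar_SU2"
  shows "(LINT x|haar_SU2. f (k ** x)) = (LINT x|haar_SU2. f x)"
proof -
  have "(\<lambda>x. k ** x) \<in> haar_SU2 \<rightarrow>\<^sub>M haar_SU2"
    using k by (intro measurable_haar_mult measurable_const) (auto simp: space_haar)
  from integral_distr [OF this f] show ?thesis by (simp add: distr_haar k)
qed

lemma measurable_torus: "torus \<in> circ \<rightarrow>\<^sub>M haar_SU2"
proof -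
  have "continuous_on UNIV torus"
  proof -
    have eq: "torus = (\<lambda>\<theta>. \<chi> i j. if i = 1 then if j = 1 then cis \<theta> else 0 else if j = 1 then 0 else cis (- \<theta>))"
      by (auto simp: fun_eq_iff torus_def cmat2_eq_iff)
    show ?thesis unfolding eq
    proof (intro continuous_on_vec_lambda)
      fix i j :: 2
      show "continuous_on UNIV (\<lambda>\<theta>. if i = 1 then if j = 1 then cis \<theta> else 0 else if j = 1 then 0 else cis (- \<theta>))"
        by (cases "i = 1"; cases "j = 1") (auto intro!: continuous_on_cis continuous_intros)
    qed
  qed
  then have "torus \<in> borel \<rightarrow>\<^sub>M restrict_space borel SU2"
    by (intro measurable_restrict_space2 borel_measurable_continuous_onI) (auto simp: torus_in_SU2)
  then show ?thesis
    unfolding measurable_cong_sets [OF sets_circ sets_haar] .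
qed

text \<open>Fubini and left invariance. The gain is that the torus commutes with the diagonal Cartan
  factor, so that the inner integral sees only the phases of the entries of
  \<open>k\<close>.\<close>

lemma integral_haar_torus:
  fixes f :: "cmat2 \<Rightarrow> 'a::{banach, second_countable_topology}"
  assumes f: "f \<in> borel_measurable haar_SU2" and B: "\<And>k. k \<in> SU2 \<Longrightarrow> norm (f k) \<le> B"
  shows "(LINT k|haar_SU2. f k) = (LINT k|haar_SU2. LINT \<theta>|circ. f (torus \<theta> ** k))"
proof -
  interpret H: prob_space haar_SU2 by (rule prob_space_haar)
  interpret C: prob_space circ by (rule prob_space_circ)
  interpret P: pair_prob_space circ haar_SU2 ..
  have m: "(\<lambda>p. torus (fst p) ** snd p) \<in> circ \<Otimes>\<^sub>M haar_SU2 \<rightarrow>\<^sub>M haar_SU2"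
    by (intro measurable_haar_mult measurable_compose [OF measurable_fst measurable_torus]) simp
  have "integrable (circ \<Otimes>\<^sub>M haar_SU2) (\<lambda>(\<theta>, k). f (torus \<theta> ** k))"
  proof (rule P.integrable_const_bound [where B = B])
    show "AE x in circ \<Otimes>\<^sub>M haar_SU2. norm (case x of (\<theta>, k) \<Rightarrow> f (torus \<theta> ** k)) \<le> B"
      by (intro AE_I2) (auto simp: space_pair_measure space_haar intro!: B SU2_mult torus_in_SU2)
    show "(\<lambda>(\<theta>, k). f (torus \<theta> ** k)) \<in> borel_measurable (circ \<Otimes>\<^sub>M haar_SU2)"
      using measurable_compose [OF m f] by (simp add: case_prod_beta')
  qed
  then have "(LINT k|haar_SU2. LINT \<theta>|circ. f (torus \<theta> ** k)) = (LINT \<theta>|circ. LINT k|haar_SU2. f (torus \<theta> ** k))"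
    by (rule P.Fubini_integral)
  also have "\<dots> = (LINT \<theta>|circ. LINT k|haar_SU2. f k)"
    by (simp add: integral_haar_left [OF torus_in_SU2 f])
  also have "\<dots> = (LINT k|haar_SU2. f k)" by (simp add: C.prob_space [unfolded space_circ])
  finally show ?thesis by simp
qed

section \<open>The kernel of the spherical trace function\<close>

lemma conj_transpose_mult: "conj_transpose (A ** B) = conj_transpose B ** conj_transpose A"
  by (simp add: cmat2_eq_iff cmat2_mult_nth algebra_simps)

lemma conj_transpose_conj_transpose [simp]: "conj_transpose (conj_transpose A) = A"
  by (simp add: cmat2_eq_iff)

lemma SU2_conj_transpose:
  assumes "k \<in> SU2"
  shows "k ** conj_transpose k = mat 1" "conj_transpose k ** k = mat 1" "conj_transpose k \<in> SU2"
proof -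
  show 1: "k ** conj_transpose k = mat 1" using assms by (simp add: SU2_def)
  then show 2: "conj_transpose k ** k = mat 1" by (simp add: matrix_left_right_inverse)
  have "det (conj_transpose k) = cnj (det k)" by (simp add: det_2 mult.commute)
  then show "conj_transpose k \<in> SU2" using assms 2 by (simp add: SU2_def SL2_def)
qed

lemma SU2_in_SL2: "k \<in> SU2 \<Longrightarrow> k \<in> SL2"
  by (simp add: SU2_def)

lemma SL2_mult: "g \<in> SL2 \<Longrightarrow> h \<in> SL2 \<Longrightarrow> g ** h \<in> SL2"
  by (simp add: SL2_def det_mul)

lemma matrix_inv_SU2:
  assumes "k \<in> SU2"
  shows "matrix_inv k = conj_transpose k"
proof -
  have "k ** matrix_inv k = mat 1 \<and> matrix_inv k ** k = mat 1"
    unfolding matrix_inv_def by (rule someI [of _ "conj_transpose k"]) (simp add: SU2_conj_transpose assms)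
  then show ?thesis
    by (metis SU2_conj_transpose(1) assms matrix_mul_assoc matrix_mul_lid matrix_mul_rid)
qed

lemma col_norm_sq_SU2_mult:
  assumes "h \<in> SU2"
  shows "col_norm_sq (h ** g) = col_norm_sq g"
proof -
  have "complex_of_real (col_norm_sq (h ** g)) = (conj_transpose (h ** g) ** (h ** g)) $ 1 $ 1"
    by (simp add: col_norm_sq_def cmat2_mult_nth [of "conj_transpose (h ** g)"] complex_norm_square mult.commute del: of_real_power)
  also have "conj_transpose (h ** g) ** (h ** g) = conj_transpose g ** (conj_transpose h ** h) ** g"
    by (simp add: conj_transpose_mult matrix_mul_assoc)
  also have "\<dots> = conj_transpose g ** g" by (simp add: SU2_conj_transpose assms)
  also have "(conj_transpose g ** g) $ 1 $ 1 = complex_of_real (col_norm_sq g)"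
    by (simp add: col_norm_sq_def cmat2_mult_nth complex_norm_square mult.commute del: of_real_power)
  finally show ?thesis by (simp only: of_real_eq_iff)
qed

lemma col_norm_sq_SU2: "k \<in> SU2 \<Longrightarrow> col_norm_sq k = 1"
  using SU2_column_norm by (simp add: col_norm_sq_def)

lemma norm_sq_sum_le:
  fixes a b c d :: complex
  shows "(cmod (a * b + c * d))\<^sup>2 \<le> ((cmod a)\<^sup>2 + (cmod c)\<^sup>2) * ((cmod b)\<^sup>2 + (cmod d)\<^sup>2)"
proof -
  have "cmod (a * b + c * d) \<le> cmod a * cmod b + cmod c * cmod d"
    by (metis norm_mult norm_triangle_ineq)
  then have "(cmod (a * b + c * d))\<^sup>2 \<le> (cmod a * cmod b + cmod c * cmod d)\<^sup>2"
    by (intro power_mono) auto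
  also have "\<dots> \<le> ((cmod a)\<^sup>2 + (cmod c)\<^sup>2) * ((cmod b)\<^sup>2 + (cmod d)\<^sup>2)"
    using zero_le_power2 [of "cmod a * cmod d - cmod c * cmod b"]
    by (simp add: power2_eq_square algebra_simps)
  finally show ?thesis .
qed

text \<open>The first column of \<open>k\<close> is the adjugate of \<open>g\<close> applied to the
  first column of \<open>g ** k\<close>, and Cauchy-Schwarz applies to each coordinate. The
  resulting uniform bound for the reciprocal of \<open>col_norm_sq (g ** k)\<close> makes the
  kernels bounded on \<open>K\<close>.\<close>

lemma col_norm_sq_mult_lower:
  assumes g: "g \<in> SL2" and k: "k \<in> SU2"
  shows "1 \<le> (col_norm_sq g + (cmod (g$1$2))\<^sup>2 + (cmod (g$2$2))\<^sup>2) * col_norm_sq (g ** k)"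
proof -
  define w1 w2 where "w1 = (g ** k)$1$1" and "w2 = (g ** k)$2$1"
  have det: "g$1$1 * g$2$2 - g$1$2 * g$2$1 = 1" using g by (simp add: SL2_def det_2)
  have "k$1$1 = (g$1$1 * g$2$2 - g$1$2 * g$2$1) * k$1$1" using det by simp
  also have "\<dots> = g$2$2 * w1 + (- g$1$2) * w2"
    by (simp add: w1_def w2_def cmat2_mult_nth algebra_simps)
  finally have 1: "(cmod (k$1$1))\<^sup>2 \<le> ((cmod (g$2$2))\<^sup>2 + (cmod (g$1$2))\<^sup>2) * col_norm_sq (g ** k)"
    using norm_sq_sum_le [of "g$2$2" w1 "- g$1$2" w2] by (simp add: col_norm_sq_def w1_def w2_def)
  have "k$2$1 = (g$1$1 * g$2$2 - g$1$2 * g$2$1) * k$2$1" using det by simp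
  also have "\<dots> = g$1$1 * w2 + (- g$2$1) * w1"
    by (simp add: w1_def w2_def cmat2_mult_nth algebra_simps)
  finally have 2: "(cmod (k$2$1))\<^sup>2 \<le> col_norm_sq g * col_norm_sq (g ** k)"
    using norm_sq_sum_le [of "g$1$1" w2 "- g$2$1" w1] by (simp add: col_norm_sq_def w1_def w2_def add.commute)
  show ?thesis using SU2_column_norm [OF k] 1 2 by (simp add: algebra_simps)
qed

lemma col_norm_sq_nonneg: "col_norm_sq g \<ge> 0"
  by (simp add: col_norm_sq_def)

lemma col_norm_sq_pos:
  assumes g: "g \<in> SL2"
  shows "col_norm_sq g > 0"
proof -
  have "mat 1 \<in> SU2"
    by (auto simp: SU2_def SL2_def det_2 cmat2_one_nth cmat2_eq_iff cmat2_mult_nth)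
  from col_norm_sq_mult_lower [OF g this] show ?thesis
    using col_norm_sq_nonneg [of g] by (cases "col_norm_sq g = 0") auto
qed

definition kernel :: "complex \<Rightarrow> int \<Rightarrow> cmat2 \<Rightarrow> cmat2 \<Rightarrow> complex" where
  "kernel \<nu> l g k = psi l (iwasawa_kappa (matrix_inv k ** g ** k)) *
     complex_of_real (col_norm_sq (g ** k)) powr (\<nu> - 1)"

lemma spherical_trace_eq_kernel:
  "spherical_trace \<nu> l g = of_int (2 * l + 1) * (LINT k|haar_SU2. kernel \<nu> l g k)"
  by (simp add: spherical_trace_def kernel_def)

text \<open>The entry (1,1) of the conjugate of \<open>g\<close> by \<open>k\<close>, as the
  Hermitian product of the first column of \<open>k\<close> with its image under \<open>g\<close>;
  this form is free of \<open>matrix_inv\<close>.\<close>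

definition inner_col :: "cmat2 \<Rightarrow> cmat2 \<Rightarrow> complex" where
  "inner_col g k = cnj (k$1$1) * (g ** k)$1$1 + cnj (k$2$1) * (g ** k)$2$1"

lemma kernel_eq:
  assumes k: "k \<in> SU2"
  shows "kernel \<nu> (int n) g k = cnj (inner_col g k) ^ (2 * n) / of_real (col_norm_sq (g ** k)) ^ n *
     complex_of_real (col_norm_sq (g ** k)) powr (\<nu> - 1)"
proof -
  have m: "matrix_inv k ** g ** k = conj_transpose k ** (g ** k)"
    by (simp add: matrix_inv_SU2 [OF k] matrix_mul_assoc)
  have 1: "(matrix_inv k ** g ** k) $ 1 $ 1 = inner_col g k"
    unfolding m by (simp add: cmat2_mult_nth [of "conj_transpose k"] inner_col_def)
  have 2: "col_norm_sq (matrix_inv k ** g ** k) = col_norm_sq (g ** k)"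
    unfolding m by (rule col_norm_sq_SU2_mult) (rule SU2_conj_transpose(3) [OF k])
  have 3: "complex_of_real (sqrt (col_norm_sq (g ** k))) ^ (2 * n) = of_real (col_norm_sq (g ** k)) ^ n"
    by (simp add: power_mult col_norm_sq_nonneg flip: of_real_power)
  have "psi (int n) (iwasawa_kappa (matrix_inv k ** g ** k))
     = (cnj (inner_col g k) / of_real (sqrt (col_norm_sq (g ** k)))) powi (int (2 * n))"
    by (simp add: psi_def iwasawa_kappa_def Let_def 1 2)
  also have "\<dots> = cnj (inner_col g k) ^ (2 * n) / of_real (sqrt (col_norm_sq (g ** k))) ^ (2 * n)"
    by (simp only: power_int_of_nat power_divide)
  finally show ?thesis by (simp only: 3 kernel_def)
qed

lemma borel_measurable_of_real_powr:
  assumes [measurable]: "f \<in> borel_measurable M" and f: "\<And>x. f x \<ge> 0"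
  shows "(\<lambda>x. complex_of_real (f x) powr z) \<in> borel_measurable M"
proof -
  have "(\<lambda>x. complex_of_real (f x) powr z) = (\<lambda>x. if f x = 0 then 0 else exp (z * of_real (ln (f x))))"
    using f by (auto simp: powr_def fun_eq_iff Ln_of_real order_less_le)
  then show ?thesis by simp
qed

lemma continuous_on_mult_left: "continuous_on X ((**) g :: cmat2 \<Rightarrow> cmat2)"
  using linear_cmat2_mult(1) [of g] by (intro linear_continuous_on) (simp add: linear_conv_bounded_linear)

lemma continuous_on_inner_col: "continuous_on X (inner_col g)"
  unfolding inner_col_def [abs_def] by (intro continuous_intros continuous_on_mult_left)

lemma continuous_on_col_norm_sq: "continuous_on X (\<lambda>k. col_norm_sq ((g::cmat2) ** k))"
  unfolding col_norm_sq_def by (intro continuous_intros continuous_on_mult_left)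

lemma borel_measurable_kernel: "kernel \<nu> (int n) g \<in> borel_measurable haar_SU2"
proof -
  have "(\<lambda>k. cnj (inner_col g k) ^ (2 * n) / of_real (col_norm_sq (g ** k)) ^ n *
     complex_of_real (col_norm_sq (g ** k)) powr (\<nu> - 1)) \<in> borel_measurable haar_SU2"
    by (intro borel_measurable_haar borel_measurable_times borel_measurable_divide
        borel_measurable_of_real_powr borel_measurable_continuous_onI col_norm_sq_nonneg
        continuous_intros continuous_on_inner_col continuous_on_col_norm_sq)
  then show ?thesis
    by (rule measurable_cong [THEN iffD1, rotated]) (simp add: kernel_eq space_haar)
qed

lemma inner_col_le:
  assumes "k \<in> SU2"
  shows "(cmod (inner_col g k))\<^sup>2 \<le> col_norm_sq (g ** k)"
  using norm_sq_sum_le [of "cnj (k$1$1)" "(g ** k)$1$1" "cnj (k$2$1)" "(g ** k)$2$1"] SU2_column_norm [OF assms]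
  by (simp add: inner_col_def col_norm_sq_def)

lemma norm_of_real_powr:
  assumes "Re \<nu> = 0" "x > 0"
  shows "norm (complex_of_real x powr (\<nu> - 1)) = 1 / x"
  using assms by (simp add: norm_powr_real_powr powr_minus_divide)

lemma norm_kernel:
  assumes k: "k \<in> SU2" and g: "g \<in> SL2" and \<nu>: "Re \<nu> = 0"
  shows "norm (kernel \<nu> (int n) g k) = (cmod (inner_col g k)) ^ (2 * n) / (col_norm_sq (g ** k)) ^ n / col_norm_sq (g ** k)"
proof -
  have N: "col_norm_sq (g ** k) > 0"
    using col_norm_sq_pos [OF SL2_mult [OF g SU2_in_SL2 [OF k]]] .
  then show ?thesis
    by (simp add: kernel_eq [OF k] norm_mult norm_divide norm_power norm_of_real_powr [OF \<nu> N])
qed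

lemma norm_kernel_le:
  assumes k: "k \<in> SU2" and g: "g \<in> SL2" and \<nu>: "Re \<nu> = 0"
  shows "norm (kernel \<nu> (int n) g k) \<le> col_norm_sq g + (cmod (g$1$2))\<^sup>2 + (cmod (g$2$2))\<^sup>2"
proof -
  let ?N = "col_norm_sq (g ** k)"
  have N: "?N > 0"
    using col_norm_sq_pos [OF SL2_mult [OF g SU2_in_SL2 [OF k]]] .
  have "((cmod (inner_col g k))\<^sup>2) ^ n \<le> ?N ^ n"
    using inner_col_le [OF k] by (intro power_mono) auto
  then have "(cmod (inner_col g k)) ^ (2 * n) / ?N ^ n / ?N \<le> 1 / ?N"
    using N by (intro divide_right_mono) (auto simp: power_mult)
  also have "\<dots> \<le> col_norm_sq g + (cmod (g$1$2))\<^sup>2 + (cmod (g$2$2))\<^sup>2"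
    using col_norm_sq_mult_lower [OF g k] N by (simp add: pos_divide_le_eq)
  finally show ?thesis by (simp add: norm_kernel [OF assms])
qed

text \<open>Substitution of \<open>h ** k\<close> for \<open>k\<close> in the Haar integral: left
  factors from \<open>K\<close> do not change \<open>col_norm_sq\<close>, and in the conjugated
  matrix they cancel.\<close>

lemma spherical_trace_conj:
  assumes h: "h \<in> SU2"
  shows "spherical_trace \<nu> (int n) (h ** g ** conj_transpose h) = spherical_trace \<nu> (int n) g"
proof -
  let ?g = "h ** g ** conj_transpose h"
  have "kernel \<nu> (int n) ?g (h ** k) = kernel \<nu> (int n) g k" if k: "k \<in> SU2" for k
  proof -
    have "?g ** (h ** k) = h ** g ** (conj_transpose h ** h) ** k" by (simp only: matrix_mul_assoc)
    then have 1: "?g ** (h ** k) = h ** (g ** k)"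
      by (simp add: SU2_conj_transpose [OF h] matrix_mul_assoc)
    have "matrix_inv (h ** k) ** ?g ** (h ** k) = conj_transpose k ** conj_transpose h ** (?g ** (h ** k))"
      by (simp add: matrix_inv_SU2 SU2_mult h k conj_transpose_mult matrix_mul_assoc)
    also have "\<dots> = conj_transpose k ** (conj_transpose h ** h) ** (g ** k)"
      unfolding 1 by (simp only: matrix_mul_assoc)
    also have "\<dots> = matrix_inv k ** g ** k"
      by (simp add: SU2_conj_transpose [OF h] matrix_inv_SU2 [OF k] matrix_mul_assoc)
    finally show ?thesis unfolding kernel_def 1 by (simp add: col_norm_sq_SU2_mult h)
  qed
  then have "(LINT k|haar_SU2. kernel \<nu> (int n) g k) = (LINT k|haar_SU2. kernel \<nu> (int n) ?g (h ** k))"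
    by (intro Bochner_Integration.integral_cong) (auto simp: space_haar)
  also have "\<dots> = (LINT k|haar_SU2. kernel \<nu> (int n) ?g k)"
    by (intro integral_haar_left h borel_measurable_kernel)
  finally show ?thesis by (simp add: spherical_trace_eq_kernel)
qed

section \<open>Pointwise estimate at \<open>k0 ** diag2 s\<close>\<close>

definition diag2 :: "real \<Rightarrow> cmat2" where
  "diag2 s = mat2 (of_real s) 0 0 (of_real (1 / s))"

lemma diag2_in_SL2: "s \<noteq> 0 \<Longrightarrow> diag2 s \<in> SL2"
  by (simp add: diag2_def SL2_def det_2)

context cartan_profile
begin

lemma borel_measurable_G [measurable]: "G n \<in> borel_measurable borel"
  unfolding G_def [abs_def] R_def E_def h_def d_def by measurable

lemma integrable_G_haar: "integrable haar_SU2 (\<lambda>k. G n ((cmod (k$1$1))\<^sup>2))"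
proof -
  interpret H: prob_space haar_SU2 by (rule prob_space_haar)
  have "compact (G n ` {0..1})"
    by (intro compact_continuous_image continuous_on_G) simp
  then obtain C where C: "\<And>x. x \<in> {0..1} \<Longrightarrow> norm (G n x) \<le> C"
    by (meson bounded_iff compact_imp_bounded image_eqI)
  show ?thesis
  proof (rule H.integrable_const_bound [where B = C])
    show "AE k in haar_SU2. norm (G n ((cmod (k$1$1))\<^sup>2)) \<le> C"
    proof (intro AE_I2 C)
      fix k assume "k \<in> space haar_SU2"
      then have "k \<in> SU2" by (simp add: space_haar)
      from SU2_column_norm [OF this] zero_le_power2 [of "cmod (k$2$1)"]
      show "(cmod (k$1$1))\<^sup>2 \<in> {0..1}" unfolding atLeastAtMost_iff by (intro conjI zero_le_power2) linarith
    qed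
  qed measurable
qed

text \<open>Since \<open>diag2 s\<close> commutes with the torus, \<open>col_norm_sq\<close> is
  constant on each torus orbit and equals \<open>R x\<close>. Only \<open>inner_col\<close> varies,
  as a trinomial in cis (2 \<theta>). Absolute values are taken after this inner integral and before
  the outer one.\<close>

lemma norm_spherical_trace_cartan_le:
  assumes \<nu>: "Re \<nu> = 0" and k0: "k0 \<in> SU2"
    and A_eq: "A = \<bar>Im (k0$1$1)\<bar>" and B_eq: "B = cmod (k0$1$2)"
  shows "norm (spherical_trace \<nu> (int n) (k0 ** diag2 s)) \<le> (2 * real n + 1) * integral {0..1} (G n)"
proof -
  let ?g = "k0 ** diag2 s"
  define \<alpha> \<beta> where "\<alpha> = k0$1$1" and "\<beta> = k0$1$2"
  have k0e: "k0$2$2 = cnj \<alpha>" "k0$2$1 = - cnj \<beta>"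
    using SU2_entries [OF k0] by (auto simp: \<alpha>_def \<beta>_def)
  have "(cmod \<alpha>)\<^sup>2 + (cmod \<beta>)\<^sup>2 = 1"
    using SU2_column_norm [OF k0] by (simp add: k0e \<alpha>_def)
  then have sph: "(Re \<alpha>)\<^sup>2 = 1 - A\<^sup>2 - B\<^sup>2"
    by (simp add: A_eq B_eq \<alpha>_def \<beta>_def cmod_power2)
  have g: "?g \<in> SL2" using s by (intro SL2_mult SU2_in_SL2 k0 diag2_in_SL2) auto
  have inner: "norm (LINT \<theta>|circ. kernel \<nu> (int n) ?g (torus \<theta> ** k)) \<le> G n ((cmod (k$1$1))\<^sup>2)"
    if k: "k \<in> SU2" for k
  proof -
    define x where "x = (cmod (k$1$1))\<^sup>2"
    have x1: "(cmod (k$2$1))\<^sup>2 = 1 - x" using SU2_column_norm [OF k] by (simp add: x_def)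
    have x: "0 \<le> x" "x \<le> 1" using x1 zero_le_power2 [of "cmod (k$2$1)"] by (auto simp: x_def)
    have xc: "cnj (k$1$1) * k$1$1 = of_real x" "cnj (k$2$1) * k$2$1 = of_real (1 - x)"
      unfolding x1 [symmetric] unfolding x_def complex_norm_square by (simp_all only: mult.commute)
    have R: "R x > 0" using x by (rule R_pos)
    have hx: "h x \<ge> 0" using x by (simp add: h_def)
    define P where "P = \<alpha> * of_real (s * x) + cnj \<alpha> * of_real ((1 - x) / s)"
    define m where "m = \<beta> * of_real (1 / s) * cnj (k$1$1) * k$2$1"
    define n' where "n' = - cnj \<beta> * of_real s * cnj (k$2$1) * k$1$1"
    have cis2: "cis (- \<theta>) * cis (- \<theta>) = cis (- 2 * \<theta>)" "cis \<theta> * cis \<theta> = cis (2 * \<theta>)" for \<theta>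
      by (simp_all add: cis_mult)
    have Nt: "col_norm_sq (?g ** (torus \<theta> ** k)) = R x" for \<theta>
    proof -
      have "col_norm_sq (?g ** (torus \<theta> ** k)) = col_norm_sq (diag2 s ** (torus \<theta> ** k))"
        using col_norm_sq_SU2_mult [OF k0] by (simp only: matrix_mul_assoc [symmetric])
      also have "\<dots> = R x"
        using s by (simp add: col_norm_sq_def cmat2_mult_nth diag2_def torus_def norm_mult norm_divide power_mult_distrib power_divide x1 R_def flip: x_def)
      finally show ?thesis .
    qed
    have It: "inner_col ?g (torus \<theta> ** k) = P + m * cis (- 2 * \<theta>) + n' * cis (2 * \<theta>)" for \<theta>
    proof -
      have c1: "cis \<theta> * cis (- \<theta>) = 1" by (simp add: cis_mult)
      have "inner_col ?g (torus \<theta> ** k) =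
         \<alpha> * of_real s * (cnj (k$1$1) * k$1$1) * (cis \<theta> * cis (- \<theta>))
         + \<beta> * of_real (1 / s) * cnj (k$1$1) * k$2$1 * (cis (- \<theta>) * cis (- \<theta>))
         + (- cnj \<beta> * of_real s * cnj (k$2$1) * k$1$1) * (cis \<theta> * cis \<theta>)
         + cnj \<alpha> * of_real (1 / s) * (cnj (k$2$1) * k$2$1) * (cis \<theta> * cis (- \<theta>))"
        by (simp add: inner_col_def cmat2_mult_nth diag2_def torus_def k0e cis_cnj flip: \<alpha>_def \<beta>_def)
          (simp add: algebra_simps add_divide_distrib)
      also have "\<dots> = P + m * cis (- 2 * \<theta>) + n' * cis (2 * \<theta>)"
        unfolding c1 cis2 xc P_def m_def n'_def by (simp add: algebra_simps)
      finally show ?thesis .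
    qed
    have tk: "torus \<theta> ** k \<in> SU2" for \<theta> by (intro SU2_mult torus_in_SU2 k)
    define C where "C = of_real (R x) powr (\<nu> - 1) / of_real (R x) ^ n"
    have "(LINT \<theta>|circ. kernel \<nu> (int n) ?g (torus \<theta> ** k))
       = (LINT \<theta>|circ. C * cnj ((P + m * cis (- 2 * \<theta>) + n' * cis (2 * \<theta>)) ^ (2 * n)))"
      unfolding kernel_eq [OF tk] Nt It C_def by (simp add: mult.commute)
    also have "\<dots> = C * cnj (LINT \<theta>|circ. (P + m * cis (- 2 * \<theta>) + n' * cis (2 * \<theta>)) ^ (2 * n))"
      by (simp only: integral_mult_right_zero Bochner_Integration.integral_cnj)
    finally have "norm (LINT \<theta>|circ. kernel \<nu> (int n) ?g (torus \<theta> ** k))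
       = norm C * norm (LINT \<theta>|circ. (P + m * cis (- 2 * \<theta>) + n' * cis (2 * \<theta>)) ^ (2 * n))"
      by (simp only: norm_mult complex_mod_cnj)
    also have "\<dots> \<le> norm C * ((Re P)\<^sup>2 + (\<bar>Im P\<bar> + 2 * (B * h x))\<^sup>2) ^ n"
    proof (intro mult_left_mono norm_integral_circ_trinomial_le)
      \<comment> \<open>The factors s and 1 / s cancel in the product, while the moduli of
        \<open>m\<close> and \<open>n'\<close> differ by the factor s^2.\<close>
      have "m * n' = - (\<beta> * cnj \<beta>) * (of_real (1 / s) * of_real s) * ((cnj (k$1$1) * k$1$1) * (cnj (k$2$1) * k$2$1))"
        unfolding m_def n'_def by (simp add: mult_ac)
      also have "\<dots> = - of_real ((B * h x)\<^sup>2)"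
        using s unfolding xc complex_norm_square [symmetric] \<beta>_def B_eq [symmetric]
        by (simp add: power_mult_distrib h_sq [OF x] flip: of_real_power)
      finally show "m * n' = - of_real ((B * h x)\<^sup>2)" .
      show "n' = 0 \<longleftrightarrow> m = 0" using s by (auto simp: m_def n'_def)
      show "0 \<le> B * h x" using B hx by simp
    qed simp
    also have "(Re P)\<^sup>2 + (\<bar>Im P\<bar> + 2 * (B * h x))\<^sup>2 = R x - E x"
    proof -
      have ReP: "Re P = Re \<alpha> * p x" and "Im P = Im \<alpha> * d x"
        by (simp_all add: P_def p_def d_def add_divide_distrib diff_divide_distrib algebra_simps)
      then have ImP: "\<bar>Im P\<bar> = A * \<bar>d x\<bar>"
        by (simp add: A_eq \<alpha>_def abs_mult)
      show ?thesis
        unfolding ReP ImP R_minus_E [OF x] power_mult_distrib sph p_eq_d [OF x]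
        by (simp add: power2_eq_square algebra_simps)
    qed
    also have "norm C = 1 / R x / R x ^ n"
      using R by (simp add: C_def norm_divide norm_power norm_of_real_powr [OF \<nu> R])
    also have "1 / R x / R x ^ n * (R x - E x) ^ n = G n x"
      by (simp add: G_def power_divide)
    finally show ?thesis by (simp add: x_def)
  qed
  have "(LINT k|haar_SU2. kernel \<nu> (int n) ?g k)
     = (LINT k|haar_SU2. LINT \<theta>|circ. kernel \<nu> (int n) ?g (torus \<theta> ** k))"
    by (rule integral_haar_torus [OF borel_measurable_kernel norm_kernel_le [OF _ g \<nu>]])
  then have "norm (LINT k|haar_SU2. kernel \<nu> (int n) ?g k)
     \<le> (LINT k|haar_SU2. norm (LINT \<theta>|circ. kernel \<nu> (int n) ?g (torus \<theta> ** k)))"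
    by (simp only: integral_norm_bound)
  also have "\<dots> \<le> (LINT k|haar_SU2. G n ((cmod (k$1$1))\<^sup>2))"
    by (rule integral_mono' [OF integrable_G_haar]) (use inner in \<open>auto simp: space_haar intro: order_trans [OF norm_ge_zero]\<close>)
  also have "\<dots> = integral {0..1} (G n)"
    by (rule integral_haar_entry [OF continuous_on_G])
  finally have "norm (spherical_trace \<nu> (int n) ?g) \<le> norm (of_int (2 * int n + 1) :: complex) * integral {0..1} (G n)"
    unfolding spherical_trace_eq_kernel norm_mult by (intro mult_left_mono) auto
  also have "norm (of_int (2 * int n + 1) :: complex) = 2 * real n + 1"
    by (subst norm_of_int) simp
  finally show ?thesis .
qed

end

section \<open>Cartan decomposition and distances\<close>

lemma mat2_in_SU2:
  assumes "(cmod a)\<^sup>2 + (cmod c)\<^sup>2 = 1"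
  shows "mat2 a (- cnj c) c (cnj a) \<in> SU2"
proof -
  have "complex_of_real ((cmod a)\<^sup>2 + (cmod c)\<^sup>2) = 1" using assms by simp
  then have "a * cnj a + c * cnj c = 1" by (simp only: of_real_add complex_norm_square)
  then show ?thesis
    by (auto simp: SU2_def SL2_def det_2 cmat2_eq_iff cmat2_mult_nth cmat2_one_nth algebra_simps)
qed

text \<open>The quadratic equation for the slope of an eigenvector (1, cnj t) of a Hermitian matrix
  with upper off-diagonal entry q, where \<open>e\<close> is the lower minus the upper diagonal
  entry.\<close>

lemma hermitian_eigen_slope:
  fixes q :: complex and e :: complex
  shows "\<exists>t. cnj q * t\<^sup>2 - e * t - q = 0"
proof (cases "q = 0")
  case False
  define Q where "Q = cnj q"
  define D where "D = csqrt (e\<^sup>2 + 4 * Q * q)"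
  have Q: "Q \<noteq> 0" using False by (simp add: Q_def)
  have "D\<^sup>2 = e\<^sup>2 + 4 * Q * q" by (simp add: D_def)
  then have D: "D * D = e * e + 4 * (Q * q)" by (simp add: power2_eq_square)
  have "Q * ((e + D) / (2 * Q))\<^sup>2 - e * ((e + D) / (2 * Q)) - q
      = (D * D - e * e - 4 * (Q * q)) / (4 * Q)"
    using Q by (simp add: field_simps power2_eq_square)
  also have "\<dots> = 0" unfolding D by simp
  finally show ?thesis unfolding Q_def by (rule exI)
qed (auto intro: exI [of _ 0])

text \<open>The inner product of the columns of \<open>g ** k\<close> is an off-diagonal entry of
  the Hermitian matrix \<open>conj_transpose g ** g\<close> conjugated by \<open>k\<close>. It
  vanishes when the first column of \<open>k\<close> is an eigenvector of that matrix, whose entries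
  are \<open>p\<close>, \<open>q\<close>, \<open>cnj q\<close> and \<open>r\<close>.\<close>

lemma orthogonal_columns:
  fixes g :: cmat2
  obtains k where "k \<in> SU2"
    "cnj ((g ** k)$1$1) * (g ** k)$1$2 + cnj ((g ** k)$2$1) * (g ** k)$2$2 = 0"
proof -
  define p r where "p = cnj (g$1$1) * g$1$1 + cnj (g$2$1) * g$2$1"
    and "r = cnj (g$1$2) * g$1$2 + cnj (g$2$2) * g$2$2"
  define q where "q = cnj (g$1$1) * g$1$2 + cnj (g$2$1) * g$2$2"
  obtain t where t: "cnj q * t\<^sup>2 - (r - p) * t - q = 0"
    using hermitian_eigen_slope by blast
  define x where "x = complex_of_real (1 / sqrt (1 + (cmod t)\<^sup>2))"
  define k where "k = mat2 x (- cnj (x * cnj t)) (x * cnj t) (cnj x)"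
  have pos: "1 + (cmod t)\<^sup>2 > 0" by (simp add: add_pos_nonneg)
  then have "(cmod x)\<^sup>2 = 1 / (1 + (cmod t)\<^sup>2)"
    unfolding x_def norm_of_real by (simp add: power_divide)
  then have "(cmod x)\<^sup>2 + (cmod (x * cnj t))\<^sup>2 = 1"
    using pos by (simp add: norm_mult power_mult_distrib field_simps)
  then have "k \<in> SU2" unfolding k_def by (rule mat2_in_SU2)
  moreover have cx: "cnj x = x" by (simp add: x_def)
  have "cnj ((g ** k)$1$1) * (g ** k)$1$2 + cnj ((g ** k)$2$1) * (g ** k)$2$2
     = - (x * x) * (cnj q * t\<^sup>2 - (r - p) * t - q)"
    by (simp add: k_def cmat2_mult_nth cx p_def q_def r_def power2_eq_square algebra_simps)
  ultimately show thesis using that t by simp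
qed

lemma cartan_decomposition:
  assumes g: "g \<in> SL2"
  obtains k1 k2 s where "k1 \<in> SU2" "k2 \<in> SU2" "s > 0" "g = k1 ** diag2 s ** k2"
proof -
  obtain k where k: "k \<in> SU2"
    and orth: "cnj ((g ** k)$1$1) * (g ** k)$1$2 + cnj ((g ** k)$2$1) * (g ** k)$2$2 = 0"
    using orthogonal_columns by blast
  define w where "w = g ** k"
  have w: "w \<in> SL2" unfolding w_def using g SU2_in_SL2 [OF k] by (rule SL2_mult)
  then have det: "w$1$1 * w$2$2 - w$1$2 * w$2$1 = 1" by (simp add: SL2_def det_2)
  define N where "N = col_norm_sq w"
  define s where "s = sqrt N"
  have N: "N > 0" unfolding N_def by (rule col_norm_sq_pos [OF w])
  have s: "s > 0" "s\<^sup>2 = N" using N by (auto simp: s_def)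
  have Nc: "complex_of_real N = w$1$1 * cnj (w$1$1) + w$2$1 * cnj (w$2$1)"
    by (simp only: N_def col_norm_sq_def of_real_add complex_norm_square)
  \<comment> \<open>The determinant and the orthogonality relation are two linear equations for the
    second column of \<open>w\<close>. This combination of them isolates one entry, the analogous
    one below the other.\<close>
  have "w$2$2 * of_real N = cnj (w$1$1) * (w$1$1 * w$2$2 - w$1$2 * w$2$1)
      + w$2$1 * (cnj (w$1$1) * w$1$2 + cnj (w$2$1) * w$2$2)"
    unfolding Nc by (simp add: algebra_simps)
  then have w22: "w$2$2 * of_real N = cnj (w$1$1)" using det orth by (simp add: w_def)
  have "w$1$2 * of_real N = - cnj (w$2$1) * (w$1$1 * w$2$2 - w$1$2 * w$2$1)
      + w$1$1 * (cnj (w$1$1) * w$1$2 + cnj (w$2$1) * w$2$2)"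
    unfolding Nc by (simp add: algebra_simps)
  then have w12: "w$1$2 * of_real N = - cnj (w$2$1)" using det orth by (simp add: w_def)
  define k1 where "k1 = mat2 (w$1$1 / of_real s) (- cnj (w$2$1 / of_real s)) (w$2$1 / of_real s) (cnj (w$1$1 / of_real s))"
  have "(cmod (w$1$1 / of_real s))\<^sup>2 + (cmod (w$2$1 / of_real s))\<^sup>2 = 1"
    using s N by (simp add: norm_divide power_divide add_divide_distrib [symmetric])
      (simp add: N_def col_norm_sq_def)
  then have k1: "k1 \<in> SU2" unfolding k1_def by (rule mat2_in_SU2)
  have Ns: "complex_of_real N = of_real s * of_real s" using s(2) by (simp add: power2_eq_square flip: of_real_mult)
  have "k1 ** diag2 s = w"
    using s(1) w12 w22 N unfolding Ns
    by (simp add: cmat2_eq_iff cmat2_mult_nth k1_def diag2_def field_simps)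
  then have "k1 ** diag2 s ** conj_transpose k = g ** (k ** conj_transpose k)"
    by (simp add: w_def matrix_mul_assoc)
  then have "g = k1 ** diag2 s ** conj_transpose k" by (simp add: SU2_conj_transpose [OF k])
  then show thesis using that k1 SU2_conj_transpose(3) [OF k] s(1) by blast
qed

section \<open>Norm and distances in Cartan coordinates\<close>

lemma norm_SU2_mult:
  fixes g :: cmat2
  assumes k: "k \<in> SU2"
  shows "norm (k ** g) = norm g" "norm (g ** k) = norm g"
proof -
  have "trace ((k ** g) ** conj_transpose (k ** g)) = trace (k ** (g ** conj_transpose g ** conj_transpose k))"
    by (simp add: conj_transpose_mult matrix_mul_assoc)
  also have "\<dots> = trace (g ** conj_transpose g ** (conj_transpose k ** k))"
    by (subst trace_mul_sym) (simp add: matrix_mul_assoc)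
  also have "\<dots> = trace (g ** conj_transpose g)"
    by (simp add: SU2_conj_transpose [OF k])
  finally show "norm (k ** g) = norm g" by (simp add: norm_eq_frobenius)
  have "(g ** k) ** conj_transpose (g ** k) = g ** (k ** conj_transpose k) ** conj_transpose g"
    by (simp add: conj_transpose_mult matrix_mul_assoc)
  then show "norm (g ** k) = norm g" by (simp add: norm_eq_frobenius SU2_conj_transpose [OF k])
qed

lemma norm_cmat2_sq:
  fixes A :: cmat2
  shows "(norm A)\<^sup>2 = (cmod (A$1$1))\<^sup>2 + (cmod (A$1$2))\<^sup>2 + (cmod (A$2$1))\<^sup>2 + (cmod (A$2$2))\<^sup>2"
  by (simp add: norm_vec_def L2_set_def sum_2 sum_nonneg)

lemma norm_cmat2_le:
  fixes A :: cmat2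
  shows "norm A \<le> cmod (A$1$1) + cmod (A$1$2) + cmod (A$2$1) + cmod (A$2$2)"
proof (rule power2_le_imp_le)
  show "(norm A)\<^sup>2 \<le> (cmod (A$1$1) + cmod (A$1$2) + cmod (A$2$1) + cmod (A$2$2))\<^sup>2"
    unfolding norm_cmat2_sq by (simp add: power2_eq_square algebra_simps)
qed simp

text \<open>The distances stand in the denominator of the final bound, so upper bounds are wanted,
  and comparison with the single point \<open>k1 ** k2\<close> gives one.\<close>

lemma infdist_SU2_cartan_le:
  assumes "k1 \<in> SU2" "k2 \<in> SU2" "s > 0"
  shows "infdist (k1 ** diag2 s ** k2) SU2 \<le> \<bar>s - 1 / s\<bar>"
proof -
  have "infdist (k1 ** diag2 s ** k2) SU2 \<le> norm (k1 ** diag2 s ** k2 - k1 ** k2)"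
    using SU2_mult [OF assms(1,2)] by (metis dist_norm infdist_le)
  also have "k1 ** diag2 s ** k2 - k1 ** k2 = k1 ** ((diag2 s - mat 1) ** k2)"
    by (simp add: cmat2_eq_iff cmat2_mult_nth cmat2_one_nth algebra_simps)
  also have "norm \<dots> = norm (diag2 s - mat 1)"
    by (simp add: norm_SU2_mult assms)
  also have "\<dots> \<le> \<bar>s - 1 / s\<bar>"
  proof (rule power2_le_imp_le)
    have "(diag2 s - mat 1)$1$1 = of_real (s - 1)" "(diag2 s - mat 1)$2$2 = of_real (1 / s - 1)"
      "(diag2 s - mat 1)$1$2 = 0" "(diag2 s - mat 1)$2$1 = 0"
      by (simp_all add: diag2_def cmat2_one_nth)
    then have "(norm (diag2 s - mat 1))\<^sup>2 = (s - 1)\<^sup>2 + (1 / s - 1)\<^sup>2"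
      unfolding norm_cmat2_sq by (simp only: norm_of_real power2_abs norm_zero) simp
    also have "\<dots> = \<bar>s - 1 / s\<bar>\<^sup>2 - 2 * ((s - 1)\<^sup>2 / s)"
      using assms(3) by (simp add: power2_eq_square field_simps)
    also have "\<dots> \<le> \<bar>s - 1 / s\<bar>\<^sup>2" using assms(3) by simp
    finally show "(norm (diag2 s - mat 1))\<^sup>2 \<le> \<bar>s - 1 / s\<bar>\<^sup>2" .
  qed simp
  finally show ?thesis .
qed

lemma norm_cartan_ge:
  assumes "k1 \<in> SU2" "k2 \<in> SU2" "s > 0"
  shows "s + 1 / s \<le> 2 * norm (k1 ** diag2 s ** k2)"
proof (rule power2_le_imp_le)
  have "(norm (k1 ** diag2 s ** k2))\<^sup>2 = s\<^sup>2 + (1 / s)\<^sup>2"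
    using assms by (simp add: norm_SU2_mult) (simp add: norm_cmat2_sq diag2_def norm_divide)
  moreover have "(s + 1 / s)\<^sup>2 \<le> 4 * (s\<^sup>2 + (1 / s)\<^sup>2)"
  proof -
    have "4 * (s\<^sup>2 + w\<^sup>2) - (s + w)\<^sup>2 = (s - w)\<^sup>2 + 2 * s\<^sup>2 + 2 * w\<^sup>2" for w
      by (simp add: power2_eq_square algebra_simps)
    from this [of "1 / s"] show ?thesis by (smt (verit) zero_le_power2)
  qed
  ultimately show "(s + 1 / s)\<^sup>2 \<le> (2 * norm (k1 ** diag2 s ** k2))\<^sup>2"
    by (simp add: power_mult_distrib)
qed simp

lemma infdist_Diag2_le_diag:
  assumes "l * l' = 1"
  shows "infdist g Diag2 \<le> cmod (g$1$1 - l) + cmod (g$2$2 - l') + (cmod (g$1$2) + cmod (g$2$1))"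
proof -
  have "mat2 l 0 0 l' \<in> Diag2"
    using assms by (auto simp: Diag2_def SL2_def det_2 forall_2)
  then have "infdist g Diag2 \<le> norm (g - mat2 l 0 0 l')"
    by (metis dist_norm infdist_le)
  also have "\<dots> \<le> cmod (g$1$1 - l) + cmod (g$2$2 - l') + (cmod (g$1$2) + cmod (g$2$1))"
    by (rule order_trans [OF norm_cmat2_le]) simp
  finally show ?thesis .
qed

text \<open>The nearby diagonal matrix keeps the larger diagonal entry \<open>a\<close>. The error
  in the other entry is b c / a, so |b c| <= M |a| has to be shown. For M <= 1 the determinant
  forces |a| >= 1/2, while |b c| <= M^2 / 4 <= M / 2. Otherwise M <= |a| and |b c| <= M^2 / 4
  suffice.\<close>

lemma quotient_le_off_diagonal:
  fixes a b c d :: complex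
  assumes det: "a * d = 1 + b * c" and ad: "cmod d \<le> cmod a"
    and M: "M = cmod b + cmod c" and "M \<le> 1 \<or> M \<le> cmod a"
  shows "a \<noteq> 0" "cmod (d - 1 / a) \<le> M"
proof -
  have M0: "M \<ge> 0" by (simp add: M)
  have "0 \<le> (cmod b - cmod c)\<^sup>2" by simp
  then have bc: "cmod (b * c) \<le> M\<^sup>2 / 4"
    unfolding M norm_mult by (simp add: power2_eq_square algebra_simps)
  have *: "a \<noteq> 0 \<and> cmod (b * c) \<le> M * cmod a"
  proof (cases "M \<le> 1")
    case True
    have "M\<^sup>2 \<le> M" using True M0 by (simp add: power2_eq_square mult_left_le)
    have "1 - cmod (b * c) \<le> cmod (1 + b * c)"
      by (metis add.commute diff_minus_eq_add minus_mult_left norm_minus_cancel norm_one norm_triangle_ineq2)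
    also have "\<dots> = cmod a * cmod d" by (simp flip: det add: norm_mult)
    also have "\<dots> \<le> cmod a * cmod a" using ad by (intro mult_left_mono) auto
    finally have "(1 / 2)\<^sup>2 \<le> (cmod a)\<^sup>2"
      using bc True \<open>M\<^sup>2 \<le> M\<close> by (simp add: power2_eq_square)
    then have a: "1 / 2 \<le> cmod a" by (rule power2_le_imp_le) simp
    have "cmod (b * c) \<le> M * (1 / 2)" using bc \<open>M\<^sup>2 \<le> M\<close> M0 by linarith
    also have "\<dots> \<le> M * cmod a" using a M0 by (intro mult_left_mono)
    finally show ?thesis using a by auto
  next
    case False
    then have Ma: "M \<le> cmod a" using assms by auto
    then have "M * M \<le> M * cmod a" using M0 by (intro mult_left_mono)
    moreover have "0 \<le> M * M" by simp
    ultimately have "cmod (b * c) \<le> M * cmod a" using bc unfolding power2_eq_square by linarith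
    then show ?thesis using False Ma by auto
  qed
  then show "a \<noteq> 0" by simp
  then have "d - 1 / a = b * c / a" using det by (simp add: field_simps)
  then show "cmod (d - 1 / a) \<le> M"
    using * by (simp add: norm_divide divide_le_eq)
qed

lemma infdist_Diag2_le:
  assumes g: "g \<in> SL2"
  shows "infdist g Diag2 \<le> 5 * (cmod (g$1$2) + cmod (g$2$1))"
proof -
  define M where "M = cmod (g$1$2) + cmod (g$2$1)"
  have M0: "M \<ge> 0" by (simp add: M_def)
  have det: "g$1$1 * g$2$2 = 1 + g$1$2 * g$2$1" using g by (simp add: SL2_def det_2 diff_eq_eq)
  consider "cmod (g$2$2) \<le> cmod (g$1$1)" "M \<le> 1 \<or> M \<le> cmod (g$1$1)"
    | "cmod (g$1$1) \<le> cmod (g$2$2)" "M \<le> 1 \<or> M \<le> cmod (g$2$2)"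
    | "M > 1" "cmod (g$1$1) \<le> M" "cmod (g$2$2) \<le> M" by linarith
  then show ?thesis
  proof cases
    case 1
    from quotient_le_off_diagonal [OF det 1(1) M_def 1(2)] infdist_Diag2_le_diag [of "g$1$1" "1 / g$1$1" g]
    have "infdist g Diag2 \<le> M + M" by (simp add: M_def)
    with M0 have "infdist g Diag2 \<le> 5 * M" by linarith
    then show ?thesis by (simp only: M_def)
  next
    case 2
    have det': "g$2$2 * g$1$1 = 1 + g$1$2 * g$2$1" using det by (simp add: mult.commute)
    from quotient_le_off_diagonal [OF det' 2(1) M_def 2(2)] infdist_Diag2_le_diag [of "1 / g$2$2" "g$2$2" g]
    have "infdist g Diag2 \<le> M + M" by (simp add: M_def)
    with M0 have "infdist g Diag2 \<le> 5 * M" by linarith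
    then show ?thesis by (simp only: M_def)
  next
    \<comment> \<open>Both diagonal entries have modulus at most M, and M > 1, so the identity is
      close enough: 2 (M + 1) + M <= 5 M.\<close>
    case 3
    have "cmod (g$1$1 - 1) \<le> M + 1" "cmod (g$2$2 - 1) \<le> M + 1"
      using 3 norm_triangle_ineq4 [of "g$1$1" 1] norm_triangle_ineq4 [of "g$2$2" 1] by simp_all
    then show ?thesis using infdist_Diag2_le_diag [of 1 1 g] 3(1) by (simp add: M_def)
  qed
qed

text \<open>As a function of \<rho>, the entry \<beta> is a sum of two exponentials, and
  \<open>m\<close> is the larger modulus of their coefficients. Up to conjugation and sign, both
  off-diagonal entries of the product combine the same two coefficients with weights s and 1 / s.
  This links \<beta> to the distance from the diagonal matrices. Each entry contributes 5 to the
  constant 10.\<close>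

lemma infdist_Diag2_cartan_le:
  assumes k1: "k1 \<in> SU2" and k2: "k2 \<in> SU2" and s: "s > 0"
    and m: "m = max (cmod (k2$1$1 * k1$1$2)) (cmod (k2$1$2 * k1$1$1))"
  shows "infdist (k1 ** diag2 s ** k2) Diag2 \<le> 10 * m * (s + 1 / s)"
proof -
  let ?g = "k1 ** diag2 s ** k2"
  note e = SU2_entries [OF k1] SU2_entries [OF k2]
  have c21: "k2$2$1 = - cnj (k2$1$2)" "k1$2$1 = - cnj (k1$1$2)" using e by auto
  have m1: "cmod (k2$1$1 * k1$1$2) \<le> m" and m2: "cmod (k2$1$2 * k1$1$1) \<le> m" by (simp_all add: m)
  have "?g$1$2 = of_real s * (k2$1$2 * k1$1$1) + of_real (1 / s) * (k1$1$2 * cnj (k2$1$1))"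
    by (simp add: cmat2_mult_nth diag2_def e algebra_simps)
  then have "cmod (?g$1$2) \<le> s * cmod (k2$1$2 * k1$1$1) + (1 / s) * cmod (k2$1$1 * k1$1$2)"
    using s norm_triangle_ineq [of "of_real s * (k2$1$2 * k1$1$1)" "of_real (1 / s) * (k1$1$2 * cnj (k2$1$1))"]
    by (simp add: norm_mult norm_divide mult_ac)
  also have "\<dots> \<le> s * m + (1 / s) * m"
    using s by (intro add_mono mult_left_mono m1 m2) auto
  finally have 1: "cmod (?g$1$2) \<le> m * (s + 1 / s)" by (simp add: algebra_simps)
  have "?g$2$1 = - (of_real s * (k2$1$1 * cnj (k1$1$2)) + of_real (1 / s) * cnj (k2$1$2 * k1$1$1))"
    by (simp add: cmat2_mult_nth diag2_def e(1,3) c21 algebra_simps)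
  then have "cmod (?g$2$1) \<le> s * cmod (k2$1$1 * k1$1$2) + (1 / s) * cmod (k2$1$2 * k1$1$1)"
    using s norm_triangle_ineq [of "of_real s * (k2$1$1 * cnj (k1$1$2))" "of_real (1 / s) * cnj (k2$1$2 * k1$1$1)"]
    by (simp only: norm_minus_cancel) (simp add: norm_mult norm_divide mult_ac)
  also have "\<dots> \<le> s * m + (1 / s) * m"
    using s by (intro add_mono mult_left_mono m1 m2) auto
  finally have 2: "cmod (?g$2$1) \<le> m * (s + 1 / s)" by (simp add: algebra_simps)
  have "?g \<in> SL2" using k1 k2 s by (intro SL2_mult SU2_in_SL2 diag2_in_SL2) auto
  note 3 = infdist_Diag2_le [OF this]
  define X where "X = m * (s + 1 / s)"
  have "infdist ?g Diag2 \<le> 10 * X"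
    using 3 1 [folded X_def] 2 [folded X_def] by argo
  then show ?thesis by (simp only: X_def mult.assoc)
qed

text \<open>Conjugation by \<open>k2 ** torus \<rho>\<close> collects all unitary factors to the
  left of \<open>diag2 s\<close>, and \<beta> is the entry (1,2) of their product. The first bound
  serves near the zeros of \<beta>.\<close>

lemma spherical_trace_torus_le:
  assumes k1: "k1 \<in> SU2" and k2: "k2 \<in> SU2" and s: "s > 0" and \<nu>: "Re \<nu> = 0" and n: "n > 0"
    and \<beta>: "\<beta> = k2$1$1 * k1$1$2 * cis \<rho> + k2$1$2 * cnj (k1$1$1) * cis (- \<rho>)"
    and \<phi>: "\<phi> = norm (spherical_trace \<nu> (int n) (k1 ** diag2 s ** k2 ** torus \<rho>))"
  shows "\<phi> \<le> 6 * real n"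
    and "s \<noteq> 1 \<Longrightarrow> \<beta> \<noteq> 0 \<Longrightarrow>
      \<phi> \<le> 48 / (sqrt (real n) * (s - 1 / s)\<^sup>2 * cmod \<beta>) + 12 * real n * (1 / 2) ^ n"
proof -
  define h where "h = k2 ** torus \<rho>"
  define k0 where "k0 = h ** k1"
  have h: "h \<in> SU2" unfolding h_def by (intro SU2_mult k2 torus_in_SU2)
  have k0: "k0 \<in> SU2" unfolding k0_def by (intro SU2_mult h k1)
  have "k0 ** diag2 s = h ** (k1 ** diag2 s ** k2 ** torus \<rho>) ** conj_transpose h"
  proof -
    have "h ** (k1 ** diag2 s ** k2 ** torus \<rho>) ** conj_transpose h = h ** k1 ** diag2 s ** (h ** conj_transpose h)"
      by (simp add: h_def matrix_mul_assoc)
    then show ?thesis by (simp add: SU2_conj_transpose [OF h] k0_def)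
  qed
  then have \<phi>': "\<phi> = norm (spherical_trace \<nu> (int n) (k0 ** diag2 s))"
    using spherical_trace_conj [OF h] by (simp add: \<phi>)
  have k012: "k0$1$2 = \<beta>"
    by (simp add: k0_def h_def \<beta> cmat2_mult_nth torus_def SU2_entries(1) [OF k1] algebra_simps)
  define A B where "A = \<bar>Im (k0$1$1)\<bar>" and "B = cmod (k0$1$2)"
  interpret cartan_profile s A B by standard (auto simp: s A_def B_def)
  have "(cmod (k0$1$1))\<^sup>2 + B\<^sup>2 = 1"
    using SU2_column_norm [OF k0] SU2_entries(2) [OF k0] by (simp add: B_def)
  then have AB: "A\<^sup>2 + B\<^sup>2 \<le> 1"
    unfolding cmod_power2 A_def power2_abs using zero_le_power2 [of "Re (k0$1$1)"] by linarith
  have le: "\<phi> \<le> (2 * real n + 1) * integral {0..1} (G n)"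
    unfolding \<phi>' by (rule norm_spherical_trace_cartan_le [OF \<nu> k0 A_def B_def])
  have n3: "2 * real n + 1 \<le> 3 * real n" using n by simp
  have "\<phi> \<le> (2 * real n + 1) * (pi / 2)"
    using integral_G_le_trivial [OF AB] by (intro order_trans [OF le] mult_left_mono) auto
  also have "\<dots> \<le> 3 * real n * 2"
    using n3 pi_less_4 by (intro mult_mono) auto
  finally show "\<phi> \<le> 6 * real n" by simp
  assume s1: "s \<noteq> 1" and "\<beta> \<noteq> 0"
  have "s - 1 / s \<noteq> 0"
  proof
    assume "s - 1 / s = 0"
    then have "s\<^sup>2 = 1" using s by (simp add: power2_eq_square field_simps)
    with s s1 show False by (simp add: power2_eq_1_iff)
  qed
  then have T: "T > 0" by (simp add: T_def)
  have B': "B > 0" using \<open>\<beta> \<noteq> 0\<close> by (simp add: B_def k012)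
  let ?J = "16 / (real n * sqrt (real n) * (T\<^sup>2 * B)) + pi * (1/2) ^ n"
  have "\<phi> \<le> (2 * real n + 1) * ?J"
    using integral_G_le [OF AB T B' n] by (intro order_trans [OF le] mult_left_mono) auto
  also have "\<dots> \<le> 3 * real n * ?J"
    using n3 B' by (intro mult_right_mono) auto
  also have "\<dots> = 48 / (sqrt (real n) * (T\<^sup>2 * B)) + pi * (3 * real n * (1/2) ^ n)"
    using n by (simp add: algebra_simps)
  also have "\<dots> \<le> 48 / (sqrt (real n) * (T\<^sup>2 * B)) + 4 * (3 * real n * (1/2) ^ n)"
    using pi_less_4 by (intro add_left_mono mult_right_mono) auto
  finally show "\<phi> \<le> 48 / (sqrt (real n) * (s - 1 / s)\<^sup>2 * cmod \<beta>) + 12 * real n * (1 / 2) ^ n"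
    by (simp add: T_def B_def k012 mult_ac)
qed

section \<open>Averaging the pointwise bound\<close>

lemma abs_sin_ge:
  assumes "\<bar>y\<bar> \<le> pi / 2"
  shows "\<bar>sin y\<bar> \<ge> \<bar>y\<bar> / 3"
proof -
  have "(\<Sum>m<3. sin_coeff m * y ^ m) = y"
    by (simp add: eval_nat_numeral sin_coeff_def)
  then have "\<bar>sin y - y\<bar> \<le> inverse (fact 3) * \<bar>y\<bar> ^ 3"
    using Maclaurin_sin_bound [of y 3] by simp
  also have "\<dots> = \<bar>y\<bar> * (\<bar>y\<bar>\<^sup>2 / 6)" by (simp add: eval_nat_numeral fact_numeral)
  \<comment> \<open>|y| <= pi / 2 < 2 leaves the factor 1 - 4 / 6 = 1 / 3.\<close>
  also have "\<dots> \<le> \<bar>y\<bar> * (2\<^sup>2 / 6)"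
    using assms pi_less_4 by (intro mult_left_mono divide_right_mono power_mono) auto
  finally show ?thesis by (simp add: abs_if split: if_splits)
qed

lemma integral_inverse_dist_le:
  fixes a b e :: real
  assumes e: "e > 0" and a: "0 \<le> a" "a \<le> b"
  shows "integral {0..b} (\<lambda>x. 1 / (\<bar>x - a\<bar> + e)) \<le> 2 * ln (1 + b / e)"
proof -
  have 1: "((\<lambda>x. 1 / (\<bar>x - a\<bar> + e)) has_integral (- ln (a - a + e) - (- ln (a - 0 + e)))) {0..a}"
  proof (rule has_integral_eq [OF _ fundamental_theorem_of_calculus [of 0 a "\<lambda>x. - ln (a - x + e)" "\<lambda>x. 1 / (a - x + e)"]])
    show "((\<lambda>x. - ln (a - x + e)) has_vector_derivative 1 / (a - x + e)) (at x within {0..a})"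
      if "x \<in> {0..a}" for x
      using that e unfolding has_real_derivative_iff_has_vector_derivative [symmetric]
      by (auto intro!: derivative_eq_intros simp: field_simps)
  qed (use a in auto)
  have 2: "((\<lambda>x. 1 / (\<bar>x - a\<bar> + e)) has_integral (ln (b - a + e) - ln (a - a + e))) {a..b}"
  proof (rule has_integral_eq [OF _ fundamental_theorem_of_calculus [of a b "\<lambda>x. ln (x - a + e)" "\<lambda>x. 1 / (x - a + e)"]])
    show "((\<lambda>x. ln (x - a + e)) has_vector_derivative 1 / (x - a + e)) (at x within {a..b})"
      if "x \<in> {a..b}" for x
      using that e unfolding has_real_derivative_iff_has_vector_derivative [symmetric]
      by (auto intro!: derivative_eq_intros)
  qed (use a in auto)
  have "((\<lambda>x. 1 / (\<bar>x - a\<bar> + e)) has_integral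
      ((- ln (a - a + e) - (- ln (a - 0 + e))) + (ln (b - a + e) - ln (a - a + e)))) {0..b}"
    using has_integral_combine [OF a 1 2] .
  then have "integral {0..b} (\<lambda>x. 1 / (\<bar>x - a\<bar> + e)) = (ln (a + e) - ln e) + (ln (b - a + e) - ln e)"
    by (simp add: integral_unique)
  also have "\<dots> \<le> (ln (b + e) - ln e) + (ln (b + e) - ln e)"
    using a e by (intro add_mono diff_right_mono) auto
  also have "\<dots> = 2 * ln (1 + b / e)"
  proof -
    have "ln (b + e) - ln e = ln ((b + e) / e)" using a e by (simp add: ln_div)
    also have "(b + e) / e = 1 + b / e" using e by (simp add: field_simps)
    finally show ?thesis by simp
  qed
  finally show ?thesis .
qed

text \<open>The zeros of the sine are j * pi / 2 for j up to 4. The integrand is at most three times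
  the peak at the nearest zero, hence at most the sum over all five. Then 5 * 3 * 2 = 30, divided by
  2 * pi >= 6, gives the 5.\<close>

lemma integral_circ_inverse_sin_le:
  assumes e: "e > 0"
  shows "(LINT \<rho>|circ. 1 / (\<bar>sin (2 * \<rho>)\<bar> + e)) \<le> 5 * ln (1 + 2 * pi / e)"
proof -
  have pos: "\<bar>x\<bar> + e > 0" for x using e by (simp add: add_nonneg_pos)
  then have ne: "\<bar>x\<bar> + e \<noteq> 0" for x by (metis less_irrefl)
  let ?g = "\<lambda>\<rho>. \<Sum>j\<le>4::nat. 3 * (1 / (\<bar>\<rho> - real j * pi / 2\<bar> + e))"
  have le: "1 / (\<bar>sin (2 * \<rho>)\<bar> + e) \<le> ?g \<rho>" if \<rho>: "\<rho> \<in> {0..2 * pi}" for \<rho>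
  proof -
    \<comment> \<open>Rounding 2 \<rho> / pi to the nearest integer puts 2 \<rho> within pi / 2 of
      \<open>i * pi\<close>.\<close>
    define i where "i = \<lfloor>2 * \<rho> / pi + 1 / 2\<rfloor>"
    define j where "j = nat i"
    have b: "of_int i \<le> 2 * \<rho> / pi + 1 / 2" "2 * \<rho> / pi + 1 / 2 < of_int i + 1"
      unfolding i_def by linarith+
    have "0 \<le> 2 * \<rho> / pi" "2 * \<rho> / pi \<le> 4" using \<rho> by (auto simp: field_simps)
    with b have "0 \<le> i" "i \<le> 4" by linarith+
    then have j: "real j = of_int i" "j \<le> 4" by (auto simp: j_def)
    define y where "y = 2 * \<rho> - real j * pi"
    have "2 * \<rho> / pi - real j \<le> 1 / 2" "- (1 / 2) \<le> 2 * \<rho> / pi - real j" using b j by linarith+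
    then have "y \<le> pi / 2" "- (pi / 2) \<le> y" unfolding y_def by (auto simp: field_simps)
    then have "\<bar>y\<bar> \<le> pi / 2" by linarith
    then have "\<bar>sin y\<bar> \<ge> \<bar>y\<bar> / 3" by (rule abs_sin_ge)
    also have "\<bar>sin y\<bar> = \<bar>sin (2 * \<rho>)\<bar>"
      by (simp add: y_def sin_diff sin_npi2 cos_npi2 abs_mult mult.commute power_abs flip: power_minus)
    finally have "\<bar>y\<bar> / 3 \<le> \<bar>sin (2 * \<rho>)\<bar>" .
    moreover have "y = 2 * (\<rho> - real j * pi / 2)" by (simp add: y_def)
    then have "\<bar>y\<bar> = 2 * \<bar>\<rho> - real j * pi / 2\<bar>" by (simp only: abs_mult abs_numeral)
    ultimately have "2 * \<bar>\<rho> - real j * pi / 2\<bar> \<le> 3 * \<bar>sin (2 * \<rho>)\<bar>" by simp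
    moreover have "(X + e) / 3 \<le> S + e" if "2 * X \<le> 3 * S" "0 \<le> X" for X S
      using that e by argo
    ultimately have "(\<bar>\<rho> - real j * pi / 2\<bar> + e) / 3 \<le> \<bar>sin (2 * \<rho>)\<bar> + e"
      using abs_ge_zero by blast
    then have "1 / (\<bar>sin (2 * \<rho>)\<bar> + e) \<le> 1 / ((\<bar>\<rho> - real j * pi / 2\<bar> + e) / 3)"
      using pos by (intro divide_left_mono) (auto intro!: mult_pos_pos)
    also have "\<dots> = 3 * (1 / (\<bar>\<rho> - real j * pi / 2\<bar> + e))" by simp
    also have "\<dots> \<le> ?g \<rho>"
      using j pos by (intro member_le_sum [where f = "\<lambda>j. 3 * (1 / (\<bar>\<rho> - real j * pi / 2\<bar> + e))"]) (auto simp: less_imp_le)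
    finally show ?thesis .
  qed
  have cont: "continuous_on X (\<lambda>x. 1 / (\<bar>x - a\<bar> + e))" "continuous_on X (\<lambda>x. 1 / (\<bar>sin (2 * x)\<bar> + e))" for a X
    by (intro continuous_intros; use ne in auto)+
  have "integral {0..2*pi} (\<lambda>\<rho>. 1 / (\<bar>sin (2 * \<rho>)\<bar> + e)) \<le> integral {0..2*pi} ?g"
    using le by (intro integral_le integrable_continuous_real continuous_intros cont) auto
  also have "\<dots> = (\<Sum>j\<le>4::nat. 3 * integral {0..2*pi} (\<lambda>\<rho>. 1 / (\<bar>\<rho> - real j * pi / 2\<bar> + e)))"
    by (subst Henstock_Kurzweil_Integration.integral_sum)
      (auto intro!: integrable_continuous_real continuous_intros cont simp del: times_divide_eq_right)
  also have "\<dots> \<le> (\<Sum>j\<le>4::nat. 3 * (2 * ln (1 + 2 * pi / e)))"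
    using e by (intro sum_mono mult_left_mono integral_inverse_dist_le) (auto simp: field_simps)
  also have "\<dots> = 30 * ln (1 + 2 * pi / e)" by simp
  finally have "integral {0..2*pi} (\<lambda>\<rho>. 1 / (\<bar>sin (2 * \<rho>)\<bar> + e)) \<le> 30 * ln (1 + 2 * pi / e)" .
  moreover have "0 \<le> integral {0..2*pi} (\<lambda>\<rho>. 1 / (\<bar>sin (2 * \<rho>)\<bar> + e))"
    by (intro integral_nonneg integrable_continuous_real cont) (use e in auto)
  moreover have "1 / (2 * pi) \<le> 1 / 6" using pi_gt3 by (simp add: field_simps)
  ultimately have "(1 / (2 * pi)) *\<^sub>R integral {0..2*pi} (\<lambda>\<rho>. 1 / (\<bar>sin (2 * \<rho>)\<bar> + e)) \<le> (1 / 6) * (30 * ln (1 + 2 * pi / e))"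
    unfolding real_scaleR_def by (intro mult_mono) auto
  then show ?thesis
    by (subst integral_circ_continuous [OF cont(2)]) simp
qed

text \<open>With 0 as the integral of a non-integrable function, the comparison rests on the
  integrability of the majorant \<open>F\<close> alone.\<close>

lemma norm_spherical_trace_avg_le:
  assumes F: "continuous_on UNIV F" and le: "\<And>\<rho>. norm (spherical_trace \<nu> l (g ** torus \<rho>)) \<le> F \<rho>"
  shows "norm (spherical_trace_avg \<nu> l q g) \<le> (LINT \<rho>|circ. F \<rho>)"
proof -
  let ?f = "\<lambda>\<rho>. spherical_trace \<nu> l (g ** torus \<rho>) * cis (- 2 * of_int q * \<rho>)"
  have F': "continuous_on {0..2*pi} F" using F by (rule continuous_on_subset) simp
  have "norm (LINT \<rho>:{0..2*pi}|lborel. ?f \<rho>) \<le> (LINT \<rho>|lborel. norm (indicator {0..2*pi} \<rho> *\<^sub>R ?f \<rho>))"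
    unfolding set_lebesgue_integral_def by (rule integral_norm_bound)
  also have "\<dots> \<le> (LINT \<rho>|lborel. indicator {0..2*pi} \<rho> *\<^sub>R F \<rho>)"
  proof (rule integral_mono')
    show "integrable lborel (\<lambda>\<rho>. indicator {0..2*pi} \<rho> *\<^sub>R F \<rho>)"
      using borel_integrable_atLeastAtMost' [OF F'] by (simp add: set_integrable_def)
    show "norm (indicator {0..2*pi} \<rho> *\<^sub>R ?f \<rho>) \<le> indicator {0..2*pi} \<rho> *\<^sub>R F \<rho>" for \<rho>
      using le [of \<rho>] by (auto simp: indicator_def norm_mult)
    show "0 \<le> indicator {0..2*pi} \<rho> *\<^sub>R F \<rho>" for \<rho>
      using order_trans [OF norm_ge_zero le [of \<rho>]] by simp
  qed
  also have "\<dots> = integral {0..2*pi} F"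
    using set_borel_integral_eq_integral(2) [OF borel_integrable_atLeastAtMost' [OF F']]
    by (simp add: set_lebesgue_integral_def)
  finally have "norm (LINT \<rho>:{0..2*pi}|lborel. ?f \<rho>) \<le> integral {0..2*pi} F" .
  then have "(1 / (2 * pi)) * norm (LINT \<rho>:{0..2*pi}|lborel. ?f \<rho>) \<le> (1 / (2 * pi)) * integral {0..2*pi} F"
    by (intro mult_left_mono) auto
  then show ?thesis
    by (simp add: integral_circ_continuous [OF F] spherical_trace_avg_def norm_mult norm_divide torus_def)
qed

text \<open>Let a and b be the arguments of u and v. Multiplication by the unit cis (\<rho> - b)
  makes the second summand real, and the first then has imaginary part |u| sin (2 \<rho> + a - b).
  Exchanging the roles gives the same sine up to sign with |v|, so one shift serves both.\<close>

lemma cmod_rotated_sum_ge: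
  fixes u v :: complex
  obtains c where "0 \<le> c" "c \<le> 2 * pi"
    "\<And>\<rho>. max (cmod u) (cmod v) * \<bar>sin (2 * (\<rho> + c))\<bar> \<le> cmod (u * cis \<rho> + v * cis (- \<rho>))"
proof -
  define a b where "a = Arg2pi u" and "b = Arg2pi v"
  have u: "u = of_real (cmod u) * cis a" and v: "v = of_real (cmod v) * cis b"
    using Arg2pi_eq [of u] Arg2pi_eq [of v] by (simp_all add: a_def b_def cis_conv_exp)
  have ab: "0 \<le> a" "a < 2 * pi" "0 \<le> b" "b < 2 * pi"
    using Arg2pi [of u] Arg2pi [of v] by (simp_all add: a_def b_def)
  \<comment> \<open>(a - b) / 2 lies between - pi and pi. Adding pi, a full period after doubling,
    brings the shift into the range of \<open>integral_circ_shift\<close>.\<close>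
  define c where "c = (a - b) / 2 + pi"
  have sc: "sin (2 * (\<rho> + c)) = sin (2 * \<rho> + a - b)" for \<rho>
  proof -
    have "2 * (\<rho> + c) = (2 * \<rho> + a - b) + 2 * pi" by (simp add: c_def field_simps)
    then show ?thesis by (simp only: sin_periodic)
  qed
  have ge: "max (cmod u) (cmod v) * \<bar>sin (2 * (\<rho> + c))\<bar> \<le> cmod (u * cis \<rho> + v * cis (- \<rho>))" for \<rho>
  proof -
    let ?z = "u * cis \<rho> + v * cis (- \<rho>)"
    have e: "?z * w = of_real (cmod u) * (cis a * cis \<rho> * w) + of_real (cmod v) * (cis b * cis (- \<rho>) * w)" for w
      by (subst u, subst v) (simp add: algebra_simps)
    have "Im (?z * cis (\<rho> - b)) = cmod u * sin (2 * \<rho> + a - b)"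
      unfolding e by (simp add: cis_mult algebra_simps del: cis.simps) (simp add: algebra_simps)
    moreover have "\<bar>Im (?z * cis (\<rho> - b))\<bar> \<le> cmod ?z"
      using abs_Im_le_cmod [of "?z * cis (\<rho> - b)"] by (simp add: norm_mult)
    ultimately have 1: "cmod u * \<bar>sin (2 * \<rho> + a - b)\<bar> \<le> cmod ?z" by (simp add: abs_mult)
    define X where "X = 2 * \<rho> + a - b"
    have "Im (?z * cis (- \<rho> - a)) = cmod v * sin (- X)"
      unfolding e X_def by (simp add: cis_mult algebra_simps del: cis.simps) (simp add: algebra_simps)
    moreover have "\<bar>Im (?z * cis (- \<rho> - a))\<bar> \<le> cmod ?z"
      using abs_Im_le_cmod [of "?z * cis (- \<rho> - a)"] by (simp add: norm_mult)
    ultimately have "\<bar>cmod v * sin (- X)\<bar> \<le> cmod ?z" by (simp only:)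
    then have 2: "cmod v * \<bar>sin X\<bar> \<le> cmod ?z" by (simp add: abs_mult)
    show ?thesis unfolding sc X_def [symmetric] using 1 [folded X_def] 2 by (simp add: max_def)
  qed
  have "0 \<le> c" "c \<le> 2 * pi" unfolding c_def using ab by (simp_all add: field_simps)
  then show thesis using that ge by blast
qed

text \<open>The trivial bound multiplied by \<open>e\<close> and the decaying bound multiplied by S,
  the modulus of the sine, add up to a bound for (\<phi> - J) (S + e). Dividing by S + e leaves a
  weight whose integral is only logarithmic in \<open>e\<close>.\<close>

lemma norm_spherical_trace_avg_cartan_le:
  assumes k1: "k1 \<in> SU2" and k2: "k2 \<in> SU2" and s: "s > 0" "s \<noteq> 1" and \<nu>: "Re \<nu> = 0" and n: "n > 0"
    and m: "m = max (cmod (k2$1$1 * k1$1$2)) (cmod (k2$1$2 * k1$1$1))" "m > 0"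
    and e: "e > 0"
  shows "norm (spherical_trace_avg \<nu> (int n) q (k1 ** diag2 s ** k2))
     \<le> 12 * real n * (1 / 2) ^ n
       + (6 * real n * e + 48 / (sqrt (real n) * (s - 1 / s)\<^sup>2 * m)) * (5 * ln (1 + 2 * pi / e))"
proof -
  define u v where "u = k2$1$1 * k1$1$2" and "v = k2$1$2 * cnj (k1$1$1)"
  have m': "m = max (cmod u) (cmod v)" by (simp add: m u_def v_def norm_mult)
  obtain c where c: "0 \<le> c" "c \<le> 2 * pi"
    and ge: "\<And>\<rho>. m * \<bar>sin (2 * (\<rho> + c))\<bar> \<le> cmod (u * cis \<rho> + v * cis (- \<rho>))"
    using cmod_rotated_sum_ge [of u v] unfolding m' by blast
  define J where "J = 12 * real n * (1 / 2) ^ n"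
  define K where "K = 48 / (sqrt (real n) * (s - 1 / s)\<^sup>2 * m)"
  define f where "f \<rho> = J + (6 * real n * e + K) * (1 / (\<bar>sin (2 * \<rho>)\<bar> + e))" for \<rho>
  have J: "J \<ge> 0" by (simp add: J_def)
  have K: "K \<ge> 0" using m(2) by (simp add: K_def)
  have ne: "\<bar>x\<bar> + e \<noteq> 0" for x using e abs_ge_zero [of x] by linarith
  have contf: "continuous_on X f" for X
    unfolding f_def by (intro continuous_intros; use ne in auto)
  have bound: "norm (spherical_trace \<nu> (int n) (k1 ** diag2 s ** k2 ** torus \<rho>)) \<le> f (\<rho> + c)" for \<rho>
  proof -
    define \<phi> where "\<phi> = norm (spherical_trace \<nu> (int n) (k1 ** diag2 s ** k2 ** torus \<rho>))"
    define \<beta> where "\<beta> = u * cis \<rho> + v * cis (- \<rho>)"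
    define S where "S = \<bar>sin (2 * (\<rho> + c))\<bar>"
    have S: "S \<ge> 0" by (simp add: S_def)
    have \<beta>_eq: "\<beta> = k2$1$1 * k1$1$2 * cis \<rho> + k2$1$2 * cnj (k1$1$1) * cis (- \<rho>)"
      by (simp add: \<beta>_def u_def v_def)
    note b = spherical_trace_torus_le [OF k1 k2 s(1) \<nu> n \<beta>_eq \<phi>_def]
    have 1: "(\<phi> - J) * e \<le> 6 * real n * e" using b(1) J e by (intro mult_right_mono) auto
    have 2: "(\<phi> - J) * S \<le> K"
    proof (cases "S = 0")
      case True
      then show ?thesis using K by simp
    next
      case False
      then have S0: "S > 0" using S by simp
      have mS: "m * S \<le> cmod \<beta>" using ge [of \<rho>] by (simp add: S_def \<beta>_def)
      have "m * S > 0" using m(2) S0 by simp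
      with mS have \<beta>0: "\<beta> \<noteq> 0" by auto
      have s2: "(s - 1 / s)\<^sup>2 > 0"
      proof -
        have "s - 1 / s \<noteq> 0"
        proof
          assume "s - 1 / s = 0"
          then have "s\<^sup>2 = 1" using s by (simp add: power2_eq_square field_simps)
          with s show False by (simp add: power2_eq_1_iff)
        qed
        then show ?thesis by simp
      qed
      have "\<phi> \<le> 48 / (sqrt (real n) * (s - 1 / s)\<^sup>2 * cmod \<beta>) + J"
        using b(2) [OF s(2) \<beta>0] by (simp add: J_def)
      also have "48 / (sqrt (real n) * (s - 1 / s)\<^sup>2 * cmod \<beta>) \<le> 48 / (sqrt (real n) * (s - 1 / s)\<^sup>2 * (m * S))"
        using mS \<open>m * S > 0\<close> n s2 S0 m(2) \<beta>0 by (intro divide_left_mono mult_left_mono mult_pos_pos) (auto simp: zero_less_norm_iff)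
      also have "\<dots> = K / S" by (simp add: K_def)
      finally show ?thesis using S0 by (simp add: field_simps)
    qed
    have "(\<phi> - J) * (S + e) \<le> 6 * real n * e + K" using 1 2 by (simp add: distrib_left)
    then have "\<phi> - J \<le> (6 * real n * e + K) / (S + e)"
      using S e by (simp add: pos_le_divide_eq add_nonneg_pos)
    then show ?thesis by (simp add: f_def S_def \<phi>_def)
  qed
  have per: "f (x + 2 * pi) = f x" for x
  proof -
    have "sin (2 * (x + 2 * pi)) = sin (2 * x + 2 * pi + 2 * pi)" by (simp add: algebra_simps)
    also have "\<dots> = sin (2 * x)" by (simp only: sin_periodic)
    finally show ?thesis by (simp add: f_def)
  qed
  have "norm (spherical_trace_avg \<nu> (int n) q (k1 ** diag2 s ** k2)) \<le> (LINT \<rho>|circ. f (\<rho> + c))"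
    by (rule norm_spherical_trace_avg_le [OF _ bound])
      (intro continuous_on_compose2 [OF contf [of UNIV]] continuous_intros, auto)
  also have "\<dots> = (LINT \<rho>|circ. f \<rho>)"
    by (rule integral_circ_shift [OF contf per c])
  also have "\<dots> = J + (6 * real n * e + K) * (LINT \<rho>|circ. 1 / (\<bar>sin (2 * \<rho>)\<bar> + e))"
  proof -
    interpret C: prob_space circ by (rule prob_space_circ)
    have "integrable circ (\<lambda>\<rho>. 1 / (\<bar>sin (2 * \<rho>)\<bar> + e))"
      by (intro integrable_circ_continuous continuous_intros; use ne in auto)
    then show ?thesis unfolding f_def
      by (subst Bochner_Integration.integral_add)
        (simp_all only: integral_mult_right_zero C.prob_space lebesgue_integral_const integrable_const
          C.integrable_const integrable_mult_right real_scaleR_def mult_1)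
  qed
  also have "\<dots> \<le> J + (6 * real n * e + K) * (5 * ln (1 + 2 * pi / e))"
    using integral_circ_inverse_sin_le [OF e] K e by (intro add_left_mono mult_left_mono) auto
  finally show ?thesis by (simp add: J_def K_def)
qed

section \<open>The Jacobian of the action on the compact group\<close>

text \<open>A Beta integral. For i + j = 2 n its value is the reciprocal of 2 n + 1, which cancels
  the factor in front of the spherical trace function.\<close>

lemma integral_binomial_density:
  "((\<lambda>x::real. real ((i + j) choose i) * (x ^ i * (1 - x) ^ j)) has_integral 1 / real (i + j + 1)) {0..1}"
proof -
  have "((\<lambda>t::real. t powr (real (i + 1) - 1) * (1 - t) powr (real (j + 1) - 1)) has_integral Beta (real (i + 1)) (real (j + 1))) {0..1}"
    by (rule has_integral_Beta_real) auto
  then have I: "((\<lambda>x::real. x ^ i * (1 - x) ^ j) has_integral Beta (real (i + 1)) (real (j + 1))) {0<..<1}"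
    unfolding has_integral_Icc_iff_Ioo
    by (rule has_integral_eq [rotated]) (simp add: powr_realpow)
  have "real ((i + j) choose i) * Beta (real (i + 1)) (real (j + 1)) = 1 / real (i + j + 1)"
  proof -
    have f: "Gamma (real (Suc k)) = fact k" for k using Gamma_fact [of k, where 'a = real] by (simp add: add.commute)
    have "Beta (real (i + 1)) (real (j + 1)) = fact i * fact j / fact (Suc (i + j))"
      unfolding Beta_def using f [of i] f [of j] f [of "Suc (i + j)"] by (simp add: algebra_simps)
    also have "(fact (Suc (i + j)) :: real) = real (i + j + 1) * fact (i + j)" by simp
    finally have 1: "Beta (real (i + 1)) (real (j + 1)) = fact i * fact j / (real (i + j + 1) * fact (i + j))" .
    have 2: "real ((i + j) choose i) = fact (i + j) / (fact i * fact j)"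
      by (subst binomial_fact) auto
    have cancel: "F / P * (P / (D * F)) = 1 / D" if "F \<noteq> 0" "P \<noteq> 0" for F P D :: real
      using that by simp
    show ?thesis unfolding 1 2 by (rule cancel) simp_all
  qed
  with has_integral_mult_right [OF I, of "real ((i + j) choose i)"] show ?thesis
    unfolding has_integral_Icc_iff_Ioo by (simp only:)
qed

text \<open>The squared modulus of a z + b w for |z|^2 = y and |w|^2 = 1 - y, when the two summands
  have relative phase 2 \<theta>.\<close>

definition angular :: "complex \<Rightarrow> complex \<Rightarrow> real \<Rightarrow> real \<Rightarrow> real" where
  "angular a b y \<theta> = (cmod a)\<^sup>2 * y + (cmod b)\<^sup>2 * (1 - y) + 2 * cmod a * cmod b * sqrt (y * (1 - y)) * cos (2 * \<theta>)"

lemma continuous_on_angular_integral: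
  assumes \<Phi>: "continuous_on UNIV (\<Phi> :: real \<Rightarrow> real)"
  shows "continuous_on X (\<lambda>y. LINT \<theta>|circ. \<Phi> (angular a b y \<theta>))"
proof -
  have cont: "continuous_on Y (\<lambda>p. \<Phi> (angular a b (fst p) (snd p)))" for Y
    unfolding angular_def by (intro continuous_on_compose2 [OF \<Phi>] continuous_intros) auto
  have "(LINT \<theta>|circ. \<Phi> (angular a b y \<theta>)) = (1 / (2 * pi)) *\<^sub>R integral {0..2 * pi} (\<lambda>\<theta>. \<Phi> (angular a b y \<theta>))" for y
    unfolding angular_def
    by (intro integral_circ_continuous continuous_on_compose2 [OF \<Phi>] continuous_intros) auto
  moreover have "continuous_on X (\<lambda>y. integral (cbox 0 (2 * pi)) (\<lambda>\<theta>. \<Phi> (angular a b y \<theta>)))"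
    by (rule integral_continuous_on_param) (use cont in \<open>simp add: case_prod_beta'\<close>)
  ultimately show ?thesis by (simp add: continuous_intros)
qed

text \<open>The right-hand side does not depend on \<open>s\<close>: on the quotient by the torus the diagonal
  matrix acts by \<open>x \<mapsto> s\<^sup>2 * x / R x\<close>, whose Jacobian is \<open>1 / (R x)\<^sup>2\<close>.\<close>

lemma integral_haar_cartan:
  fixes \<Phi> :: "real \<Rightarrow> real"
  assumes \<Phi>: "continuous_on UNIV \<Phi>" and k1: "k1 \<in> SU2" and s: "s > 0"
  shows "(LINT k|haar_SU2. \<Phi> ((cmod ((k1 ** diag2 s ** k)$1$1))\<^sup>2 / col_norm_sq (k1 ** diag2 s ** k))
            / (col_norm_sq (k1 ** diag2 s ** k))\<^sup>2)
     = integral {0..1} (\<lambda>y. LINT \<theta>|circ. \<Phi> (angular (k1$1$1) (k1$1$2) y \<theta>))"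
proof -
  define a b where "a = k1$1$1" and "b = k1$1$2"
  define g where "g = k1 ** diag2 s"
  define \<Psi> where "\<Psi> y = (LINT \<theta>|circ. \<Phi> (angular a b y \<theta>))" for y
  define R where "R x = s\<^sup>2 * x + (1 - x) / s\<^sup>2" for x
  define Y where "Y x = s\<^sup>2 * x / R x" for x
  define f where "f k = \<Phi> ((cmod ((g ** k)$1$1))\<^sup>2 / col_norm_sq (g ** k)) / (col_norm_sq (g ** k))\<^sup>2" for k
  have g: "g \<in> SL2" unfolding g_def using s SU2_in_SL2 [OF k1] by (intro SL2_mult diag2_in_SL2) auto
  have R: "R x > 0" if "0 \<le> x" "x \<le> 1" for x
    using s that unfolding R_def by (cases "x = 0") (auto intro!: add_pos_nonneg)
  have R2: "R x \<noteq> 0" if "0 \<le> x" "x \<le> 1" for x using R [OF that] by simp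
  have contR: "continuous_on {0..1} R" unfolding R_def using s by (intro continuous_intros) auto
  have contY: "continuous_on {0..1} Y" unfolding Y_def
    by (intro continuous_intros contR) (use R in force)
  have cont\<Psi>: "continuous_on Z \<Psi>" for Z
    unfolding \<Psi>_def by (rule continuous_on_angular_integral [OF \<Phi>])
  have N: "col_norm_sq (g ** k) > 0" if "k \<in> SU2" for k
    using col_norm_sq_pos [OF SL2_mult [OF g SU2_in_SL2 [OF that]]] .
  define M where "M = col_norm_sq g + (cmod (g$1$2))\<^sup>2 + (cmod (g$2$2))\<^sup>2"
  have contf: "continuous_on SU2 f" unfolding f_def
    by (intro continuous_intros continuous_on_compose2 [OF \<Phi>] continuous_on_col_norm_sq continuous_on_mult_left)
      (use N in force)+
  have "compact (\<Phi> ` {0..1})" using \<Phi> by (intro compact_continuous_image) (auto intro: continuous_on_subset)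
  then obtain B where B: "\<And>y. y \<in> {0..1} \<Longrightarrow> \<bar>\<Phi> y\<bar> \<le> B"
    by (metis bounded_iff compact_imp_bounded image_eqI real_norm_def)
  have fB: "norm (f k) \<le> B * M\<^sup>2" if k: "k \<in> SU2" for k
  proof -
    let ?N = "col_norm_sq (g ** k)"
    have "(cmod ((g ** k)$1$1))\<^sup>2 / ?N \<in> {0..1}"
      using N [OF k] by (simp add: divide_le_eq) (simp add: col_norm_sq_def)
    then have 1: "\<bar>\<Phi> ((cmod ((g ** k)$1$1))\<^sup>2 / ?N)\<bar> \<le> B" by (rule B)
    have "1 / ?N \<le> M" using col_norm_sq_mult_lower [OF g k] N [OF k] by (simp add: pos_divide_le_eq M_def)
    then have "(1 / ?N)\<^sup>2 \<le> M\<^sup>2" using N [OF k] by (intro power_mono) auto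
    then have "\<bar>\<Phi> ((cmod ((g ** k)$1$1))\<^sup>2 / ?N)\<bar> * (1 / ?N)\<^sup>2 \<le> B * M\<^sup>2"
      using 1 by (intro mult_mono) auto
    then show ?thesis by (simp add: f_def abs_mult power_divide)
  qed
  have fm: "f \<in> borel_measurable haar_SU2"
    using borel_measurable_continuous_on_restrict [OF contf] measurable_cong_sets [OF sets_haar refl] by blast
  have avg: "(LINT \<theta>|circ. f (torus \<theta> ** k)) = \<Psi> (Y ((cmod (k$1$1))\<^sup>2)) / (R ((cmod (k$1$1))\<^sup>2))\<^sup>2" if k: "k \<in> SU2" for k
  proof -
    define x where "x = (cmod (k$1$1))\<^sup>2"
    have x1: "(cmod (k$2$1))\<^sup>2 = 1 - x" using SU2_column_norm [OF k] by (simp add: x_def)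
    have x: "0 \<le> x" "x \<le> 1" using x1 zero_le_power2 [of "cmod (k$2$1)"] by (auto simp: x_def)
    have Rx: "R x > 0" using x by (rule R)
    have Nt: "col_norm_sq (g ** (torus \<theta> ** k)) = R x" for \<theta>
    proof -
      have "col_norm_sq (g ** (torus \<theta> ** k)) = col_norm_sq (diag2 s ** (torus \<theta> ** k))"
        unfolding g_def using col_norm_sq_SU2_mult [OF k1] by (simp only: matrix_mul_assoc [symmetric])
      also have "\<dots> = R x"
        using s by (simp add: col_norm_sq_def cmat2_mult_nth diag2_def torus_def norm_mult norm_divide power_mult_distrib power_divide x1 R_def flip: x_def)
      finally show ?thesis .
    qed
    \<comment> \<open>Twice the cross term in the squared modulus of the entry (1,1), divided by
      \<open>R x\<close>. Its phase depends on \<open>k\<close>, but the integral over \<theta> sees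
      only its modulus.\<close>
    define z where "z = (2 / R x) *\<^sub>R (a * k$1$1 * cnj (b * k$2$1))"
    have Y: "1 - Y x = (1 - x) / s\<^sup>2 / R x" "Y x * (1 - Y x) = x * (1 - x) / (R x)\<^sup>2"
    proof -
      have "1 - Y x = (R x - s\<^sup>2 * x) / R x" using Rx by (simp add: Y_def diff_divide_distrib)
      also have "R x - s\<^sup>2 * x = (1 - x) / s\<^sup>2" by (simp add: R_def)
      finally show 1: "1 - Y x = (1 - x) / s\<^sup>2 / R x" .
      show "Y x * (1 - Y x) = x * (1 - x) / (R x)\<^sup>2"
        unfolding 1 using s by (simp add: Y_def power2_eq_square)
    qed
    have sx: "cmod (k$1$1) = sqrt x" "cmod (k$2$1) = sqrt (1 - x)"
      unfolding x1 [symmetric] by (simp_all add: x_def)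
    have cz: "cmod z = 2 * cmod a * cmod b * sqrt (Y x * (1 - Y x))"
      using Rx x unfolding Y(2) by (simp add: z_def norm_mult sx real_sqrt_divide real_sqrt_mult)
    have ent: "(cmod ((g ** (torus \<theta> ** k))$1$1))\<^sup>2 / R x = (cmod a)\<^sup>2 * Y x + (cmod b)\<^sup>2 * (1 - Y x) + Re (z * cis (2 * \<theta>))" for \<theta>
    proof -
      define w1 w2 where "w1 = a * (of_real s * k$1$1 * cis \<theta>)" and "w2 = b * (of_real (1 / s) * k$2$1 * cis (- \<theta>))"
      have "(g ** (torus \<theta> ** k))$1$1 = w1 + w2"
        by (simp add: w1_def w2_def g_def cmat2_mult_nth diag2_def torus_def a_def b_def algebra_simps)
      moreover have "(cmod (w1 + w2))\<^sup>2 = (cmod w1)\<^sup>2 + (cmod w2)\<^sup>2 + 2 * Re (w1 * cnj w2)"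
        unfolding cmod_power2 by (simp add: power2_eq_square algebra_simps)
      moreover have "w1 * cnj w2 = a * k$1$1 * cnj (b * k$2$1) * cis (2 * \<theta>)"
      proof -
        have "w1 * cnj w2 = a * k$1$1 * cnj (b * k$2$1) * (cis \<theta> * cis \<theta>) * (of_real s * of_real (1 / s))"
          by (simp add: w1_def w2_def cis_cnj)
        then show ?thesis using s by (simp add: cis_mult)
      qed
      moreover have "(cmod w1)\<^sup>2 = (cmod a)\<^sup>2 * (s\<^sup>2 * x)" "(cmod w2)\<^sup>2 = (cmod b)\<^sup>2 * ((1 - x) / s\<^sup>2)"
        using s x1 by (simp_all add: w1_def w2_def norm_mult norm_divide power_mult_distrib power_divide x_def)
      ultimately have "(cmod ((g ** (torus \<theta> ** k))$1$1))\<^sup>2 = (cmod a)\<^sup>2 * (s\<^sup>2 * x) + (cmod b)\<^sup>2 * ((1 - x) / s\<^sup>2)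
          + 2 * Re (a * k$1$1 * cnj (b * k$2$1) * cis (2 * \<theta>))" by simp
      moreover have "Re (z * cis (2 * \<theta>)) = 2 * Re (a * k$1$1 * cnj (b * k$2$1) * cis (2 * \<theta>)) / R x"
        unfolding z_def by (simp only: mult_scaleR_left scaleR_complex.sel(1)) simp
      ultimately show ?thesis
        unfolding Y(1) by (simp add: Y_def add_divide_distrib)
    qed
    let ?c = "(cmod a)\<^sup>2 * Y x + (cmod b)\<^sup>2 * (1 - Y x)"
    have "(LINT \<theta>|circ. f (torus \<theta> ** k)) = (LINT \<theta>|circ. \<Phi> (?c + Re (z * cis (2 * \<theta>))) / (R x)\<^sup>2)"
      unfolding f_def Nt ent ..
    also have "\<dots> = (LINT \<theta>|circ. \<Phi> (?c + Re (z * cis (2 * \<theta>)))) / (R x)\<^sup>2"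
      by (rule integral_divide_zero)
    also have "(LINT \<theta>|circ. \<Phi> (?c + Re (z * cis (2 * \<theta>)))) = (LINT \<theta>|circ. \<Phi> (?c + cmod z * cos (2 * \<theta>)))"
      by (rule integral_circ_cos_shift [where f = "\<lambda>t. \<Phi> (?c + t)"])
        (intro continuous_on_compose2 [OF \<Phi>] continuous_intros, auto)
    also have "\<dots> = \<Psi> (Y x)" unfolding \<Psi>_def angular_def cz by (simp only: add.assoc mult.assoc)
    finally show ?thesis by (simp only: x_def)
  qed
  have "(LINT k|haar_SU2. f k) = (LINT k|haar_SU2. LINT \<theta>|circ. f (torus \<theta> ** k))"
    by (rule integral_haar_torus [OF fm fB])
  also have "\<dots> = (LINT k|haar_SU2. \<Psi> (Y ((cmod (k$1$1))\<^sup>2)) / (R ((cmod (k$1$1))\<^sup>2))\<^sup>2)"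
    by (intro Bochner_Integration.integral_cong avg) (simp_all add: space_haar)
  also have "\<dots> = integral {0..1} (\<lambda>x. \<Psi> (Y x) / (R x)\<^sup>2)"
    by (rule integral_haar_entry [where F = "\<lambda>x. \<Psi> (Y x) / (R x)\<^sup>2"])
      (intro continuous_intros contR continuous_on_compose2 [OF cont\<Psi> [of UNIV] contY]; use R2 in auto)
  also have "\<dots> = integral {0..1} \<Psi>"
  proof -
    have Y01: "Y 0 = 0" "Y 1 = 1" using s by (auto simp: Y_def R_def)
    have "((\<lambda>x. (1 / (R x)\<^sup>2) *\<^sub>R \<Psi> (Y x)) has_integral (integral {Y 0..Y 1} \<Psi>)) {0..1}"
    \<comment> \<open>The rule asks for an interval that contains the image of \<open>Y\<close>.
      Infimum and supremum of the image provide one, and \<Psi> is continuous everywhere.\<close>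
    proof (rule has_integral_substitution [where c = "min 0 (Inf (Y ` {0..1}))" and d = "max 1 (Sup (Y ` {0..1}))"])
      have bY: "bounded (Y ` {0..1})" by (intro compact_imp_bounded compact_continuous_image contY) simp
      show "Y ` {0..1} \<subseteq> {min 0 (Inf (Y ` {0..1}))..max 1 (Sup (Y ` {0..1}))}"
        using bounded_imp_bdd_below [OF bY] bounded_imp_bdd_above [OF bY]
        by (auto intro!: max.coboundedI2 min.coboundedI2 cInf_lower cSup_upper)
      show "continuous_on {min 0 (Inf (Y ` {0..1}))..max 1 (Sup (Y ` {0..1}))} \<Psi>" by (rule cont\<Psi>)
      show "(Y has_real_derivative 1 / (R x)\<^sup>2) (at x within {0..1})" if "x \<in> {0..1}" for x
      proof -
        have Rx: "R x > 0" using that R by auto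
        have "(R has_real_derivative s\<^sup>2 - 1 / s\<^sup>2) (at x within {0..1})"
          unfolding R_def using s by (auto intro!: derivative_eq_intros simp: field_simps)
        then have "(Y has_real_derivative (s\<^sup>2 * R x - s\<^sup>2 * x * (s\<^sup>2 - 1 / s\<^sup>2)) / (R x * R x)) (at x within {0..1})"
          unfolding Y_def using Rx by (auto intro!: derivative_eq_intros)
        also have "s\<^sup>2 * R x - s\<^sup>2 * x * (s\<^sup>2 - 1 / s\<^sup>2) = 1"
          using s by (simp add: R_def field_simps)
        finally show ?thesis by (simp add: power2_eq_square)
      qed
    qed (use Y01 in auto)
    then show ?thesis by (simp add: Y01 integral_unique)
  qed
  finally show ?thesis unfolding f_def g_def \<Psi>_def [abs_def] a_def b_def .
qed

text \<open>The value in \<open>integral_haar_cartan\<close> is free of \<open>s\<close>, so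
  \<open>s\<close> may be replaced by 1, where the group element lies in \<open>K\<close> and left
  invariance finishes. In other words, \<open>g\<close> acts on the quotient of \<open>K\<close> by
  the torus with Jacobian \<open>col_norm_sq (g ** k)\<close> to the power - 2.\<close>

lemma integral_haar_jacobian:
  fixes \<Phi> :: "real \<Rightarrow> real"
  assumes \<Phi>: "continuous_on UNIV \<Phi>" and g: "g \<in> SL2"
  shows "(LINT k|haar_SU2. \<Phi> ((cmod ((g ** k)$1$1))\<^sup>2 / col_norm_sq (g ** k)) / (col_norm_sq (g ** k))\<^sup>2)
     = integral {0..1} \<Phi>"
proof -
  obtain k1 k2 s where k1: "k1 \<in> SU2" and k2: "k2 \<in> SU2" and s: "s > 0" and g_eq: "g = k1 ** diag2 s ** k2"
    using cartan_decomposition [OF g] by blast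
  let ?f = "\<lambda>s k. \<Phi> ((cmod ((k1 ** diag2 s ** k)$1$1))\<^sup>2 / col_norm_sq (k1 ** diag2 s ** k)) / (col_norm_sq (k1 ** diag2 s ** k))\<^sup>2"
  have m: "?f s \<in> borel_measurable haar_SU2"
    by (intro borel_measurable_haar borel_measurable_divide borel_measurable_power
        measurable_compose [OF _ borel_measurable_continuous_onI [OF \<Phi>]]
        borel_measurable_continuous_onI continuous_intros continuous_on_col_norm_sq continuous_on_mult_left)
  have "(LINT k|haar_SU2. \<Phi> ((cmod ((g ** k)$1$1))\<^sup>2 / col_norm_sq (g ** k)) / (col_norm_sq (g ** k))\<^sup>2)
     = (LINT k|haar_SU2. ?f s (k2 ** k))"
    by (simp add: g_eq matrix_mul_assoc)
  also have "\<dots> = (LINT k|haar_SU2. ?f s k)" by (rule integral_haar_left [OF k2 m])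
  also have "\<dots> = (LINT k|haar_SU2. ?f 1 k)"
    using integral_haar_cartan [OF \<Phi> k1 s] integral_haar_cartan [OF \<Phi> k1, of 1] by simp
  also have "\<dots> = (LINT k|haar_SU2. \<Phi> ((cmod ((k1 ** k)$1$1))\<^sup>2))"
  proof (rule Bochner_Integration.integral_cong)
    fix k assume "k \<in> space haar_SU2"
    then have "col_norm_sq (k1 ** k) = 1" using k1 by (simp add: space_haar col_norm_sq_SU2 SU2_mult)
    moreover have "diag2 1 = mat 1" by (simp add: cmat2_eq_iff diag2_def cmat2_one_nth)
    ultimately show "?f 1 k = \<Phi> ((cmod ((k1 ** k)$1$1))\<^sup>2)" by simp
  qed simp
  also have "\<dots> = (LINT k|haar_SU2. \<Phi> ((cmod (k$1$1))\<^sup>2))"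
    by (rule integral_haar_left [OF k1, of "\<lambda>k. \<Phi> ((cmod (k$1$1))\<^sup>2)"])
      (intro borel_measurable_haar borel_measurable_continuous_onI continuous_on_compose2 [OF \<Phi>] continuous_intros, auto)
  also have "\<dots> = integral {0..1} \<Phi>"
    by (rule integral_haar_entry) (use \<Phi> in \<open>rule continuous_on_subset\<close>, simp)
  finally show ?thesis .
qed

section \<open>The bound from unitarity\<close>

text \<open>Conjugation by the torus moves \<rho> to the left of \<open>g\<close>, where it
  multiplies the two summands of \<open>inner_col\<close> by opposite phases and leaves the norm
  alone. The integral over \<rho> is then one binomial term, in which the column of \<open>k\<close>
  and that of \<open>g ** k\<close> separate.\<close>

lemma norm_spherical_trace_avg_le_1:
  assumes \<nu>: "Re \<nu> = 0" and q: "\<bar>q\<bar> \<le> int n" and g: "g \<in> SL2"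
  shows "norm (spherical_trace_avg \<nu> (int n) q g) \<le> 1"
proof -
  interpret H: prob_space haar_SU2 by (rule prob_space_haar)
  interpret C: prob_space circ by (rule prob_space_circ)
  interpret P: pair_prob_space circ haar_SU2 ..
  define a where "a k = cnj (cnj (k$1$1) * (g ** k)$1$1)" for k :: cmat2
  define b where "b k = cnj (cnj (k$2$1) * (g ** k)$2$1)" for k :: cmat2
  define N where "N k = col_norm_sq (g ** k)" for k :: cmat2
  define c where "c k = complex_of_real (N k) powr (\<nu> - 1) / of_real (N k) ^ n" for k
  define f where "f \<rho> k = (a k * cis (- \<rho>) + b k * cis \<rho>) ^ (2 * n) * cis (- 2 * of_int q * \<rho>) * c k" for \<rho> k
  have kernel_f: "kernel \<nu> (int n) (torus \<rho> ** g) k * cis (- 2 * of_int q * \<rho>) = f \<rho> k" if k: "k \<in> SU2" for \<rho> k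
  proof -
    have 1: "col_norm_sq (torus \<rho> ** g ** k) = N k"
      using col_norm_sq_SU2_mult [OF torus_in_SU2] by (simp only: N_def matrix_mul_assoc [symmetric])
    have 2: "cnj (inner_col (torus \<rho> ** g) k) = a k * cis (- \<rho>) + b k * cis \<rho>"
      unfolding inner_col_def matrix_mul_assoc [symmetric] cmat2_mult_nth [of "torus \<rho>"]
      by (simp add: torus_def a_def b_def cis_cnj mult_ac)
    show ?thesis
      unfolding kernel_eq [OF k] 1 2 f_def c_def by (simp add: mult_ac)
  qed
  have tr: "spherical_trace \<nu> (int n) (g ** torus \<rho>) * cis (- 2 * of_int q * \<rho>) =
      of_int (2 * int n + 1) * (LINT k|haar_SU2. f \<rho> k)" for \<rho>
  proof -
    have "torus \<rho> ** (g ** torus \<rho>) ** conj_transpose (torus \<rho>) = torus \<rho> ** g ** (torus \<rho> ** conj_transpose (torus \<rho>))"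
      by (simp only: matrix_mul_assoc)
    then have "torus \<rho> ** g = torus \<rho> ** (g ** torus \<rho>) ** conj_transpose (torus \<rho>)"
      by (simp add: SU2_conj_transpose [OF torus_in_SU2])
    then have "spherical_trace \<nu> (int n) (g ** torus \<rho>) = spherical_trace \<nu> (int n) (torus \<rho> ** g)"
      using spherical_trace_conj [OF torus_in_SU2, of \<nu> n \<rho> "g ** torus \<rho>"] by simp
    also have "\<dots> * cis (- 2 * of_int q * \<rho>) = of_int (2 * int n + 1) *
        (LINT k|haar_SU2. kernel \<nu> (int n) (torus \<rho> ** g) k * cis (- 2 * of_int q * \<rho>))"
      unfolding spherical_trace_eq_kernel by (simp only: integral_mult_left_zero mult.assoc)
    also have "(LINT k|haar_SU2. kernel \<nu> (int n) (torus \<rho> ** g) k * cis (- 2 * of_int q * \<rho>)) = (LINT k|haar_SU2. f \<rho> k)"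
      by (intro Bochner_Integration.integral_cong kernel_f) (simp_all add: space_haar)
    finally show ?thesis .
  qed
  have Npos: "N k > 0" if "k \<in> SU2" for k
    unfolding N_def using col_norm_sq_pos [OF SL2_mult [OF g SU2_in_SL2 [OF that]]] .
  have nc: "norm (c k) = 1 / (N k) ^ n / N k" if "k \<in> SU2" for k
    using norm_of_real_powr [OF \<nu> Npos [OF that]] Npos [OF that]
    by (simp add: c_def norm_divide norm_power)
  have ma: "a \<in> borel_measurable haar_SU2" and mb: "b \<in> borel_measurable haar_SU2"
    unfolding a_def [abs_def] b_def [abs_def]
    by (intro borel_measurable_haar borel_measurable_continuous_onI continuous_intros continuous_on_mult_left)+
  have mc: "c \<in> borel_measurable haar_SU2"
    unfolding c_def [abs_def] N_def
    by (intro borel_measurable_haar borel_measurable_divide borel_measurable_of_real_powr borel_measurable_continuous_onI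
        col_norm_sq_nonneg continuous_intros continuous_on_col_norm_sq)
  have mcis: "(\<lambda>p. cis (r * fst p)) \<in> borel_measurable (circ \<Otimes>\<^sub>M haar_SU2)" for r
  proof -
    have "(\<lambda>x. cis (r * x)) \<in> borel_measurable borel"
      by (intro borel_measurable_continuous_onI continuous_intros)
    then have "(\<lambda>x. cis (r * x)) \<in> borel_measurable circ" by simp
    then show ?thesis by (rule measurable_compose [OF measurable_fst])
  qed
  have mf: "(\<lambda>(\<rho>, k). f \<rho> k) \<in> borel_measurable (circ \<Otimes>\<^sub>M haar_SU2)"
    unfolding f_def case_prod_beta'
    using mcis [of "-1"] mcis [of 1] mcis [of "- 2 * of_int q"]
    by (intro borel_measurable_times borel_measurable_power borel_measurable_add
        measurable_compose [OF measurable_snd ma] measurable_compose [OF measurable_snd mb]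
        measurable_compose [OF measurable_snd mc]) simp_all
  define M where "M = col_norm_sq g + (cmod (g$1$2))\<^sup>2 + (cmod (g$2$2))\<^sup>2"
  have fM: "norm (f \<rho> k) \<le> M" if k: "k \<in> SU2" for \<rho> k
  proof -
    have tg: "torus \<rho> ** g \<in> SL2" by (intro SL2_mult SU2_in_SL2 torus_in_SU2 g)
    have "col_norm_sq (torus \<rho> ** g) + (cmod ((torus \<rho> ** g)$1$2))\<^sup>2 + (cmod ((torus \<rho> ** g)$2$2))\<^sup>2 = M"
      by (simp add: M_def col_norm_sq_SU2_mult torus_in_SU2) (simp add: cmat2_mult_nth torus_def norm_mult)
    then show ?thesis
      using norm_kernel_le [OF k tg \<nu>, of n] by (simp add: norm_mult flip: kernel_f [OF k])
  qed
  have int_f: "integrable (circ \<Otimes>\<^sub>M haar_SU2) (\<lambda>(\<rho>, k). f \<rho> k)"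
  proof (rule P.integrable_const_bound [where B = M])
    show "AE x in circ \<Otimes>\<^sub>M haar_SU2. norm (case x of (\<rho>, k) \<Rightarrow> f \<rho> k) \<le> M"
      by (intro AE_I2) (auto simp: space_pair_measure space_haar fM)
  qed (rule mf)
  have "spherical_trace_avg \<nu> (int n) q g = (1 / (2 * pi)) *\<^sub>R
     (LINT \<rho>:{0..2 * pi}|lborel. of_int (2 * int n + 1) * (LINT k|haar_SU2. f \<rho> k))"
    unfolding spherical_trace_avg_def torus_def [symmetric] tr by (simp add: scaleR_conv_of_real)
  also have "\<dots> = (LINT \<rho>|circ. of_int (2 * int n + 1) * (LINT k|haar_SU2. f \<rho> k))"
  proof (rule integral_circ [symmetric])
    have "(\<lambda>\<rho>. LINT k|haar_SU2. f \<rho> k) \<in> borel_measurable circ"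
      by (rule H.borel_measurable_lebesgue_integral [OF mf])
    then show "(\<lambda>\<rho>. of_int (2 * int n + 1) * (LINT k|haar_SU2. f \<rho> k)) \<in> borel_measurable borel"
      by simp
  qed
  also have "\<dots> = of_int (2 * int n + 1) * (LINT \<rho>|circ. LINT k|haar_SU2. f \<rho> k)"
    by (rule integral_mult_right_zero)
  also have "(LINT \<rho>|circ. LINT k|haar_SU2. f \<rho> k) = (LINT k|haar_SU2. LINT \<rho>|circ. f \<rho> k)"
    using P.Fubini_integral [OF int_f] by simp
  finally have avg: "spherical_trace_avg \<nu> (int n) q g = of_int (2 * int n + 1) * (LINT k|haar_SU2. LINT \<rho>|circ. f \<rho> k)" .
  define j i where "j = nat (int n + q)" and "i = nat (int n - q)"
  have ij: "i + j = 2 * n" using q by (auto simp: i_def j_def)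
  have ch: "(2 * n) choose j = (i + j) choose i"
    using binomial_symmetric [of i "i + j"] by (simp add: ij [symmetric])
  define \<Phi> :: "real \<Rightarrow> real" where "\<Phi> x = real ((i + j) choose i) * (x ^ i * (1 - x) ^ j)" for x
  have cont\<Phi>: "continuous_on X \<Phi>" for X unfolding \<Phi>_def by (intro continuous_intros)
  have int\<Phi>: "integral {0..1} \<Phi> = 1 / real (i + j + 1)"
    unfolding \<Phi>_def by (rule integral_unique [OF integral_binomial_density])
  define y where "y k = (cmod ((g ** k)$1$1))\<^sup>2 / N k" for k :: cmat2
  have inner: "norm (LINT \<rho>|circ. f \<rho> k) \<le> (\<Phi> ((cmod (k$1$1))\<^sup>2) + \<Phi> (y k) / (N k)\<^sup>2) / 2" if k: "k \<in> SU2" for k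
  proof -
    define u where "u = (cmod (k$1$1)) ^ i * (cmod (k$2$1)) ^ j"
    define w where "w = (cmod ((g ** k)$1$1)) ^ i * (cmod ((g ** k)$2$1)) ^ j / N k ^ n / N k"
    have N: "N k > 0" using Npos [OF k] .
    have "(LINT \<rho>|circ. f \<rho> k) = (LINT \<rho>|circ. (a k * cis (- \<rho>) + b k * cis \<rho>) ^ (2 * n) * cis (- 2 * of_int q * \<rho>)) * c k"
      unfolding f_def by (rule integral_mult_left_zero)
    also have "\<dots> = of_nat ((i + j) choose i) * b k ^ j * a k ^ i * c k"
      unfolding integral_circ_binomial [OF q] j_def [symmetric] i_def [symmetric] ch ..
    finally have "norm (LINT \<rho>|circ. f \<rho> k) = real ((i + j) choose i) * (u * w)"
      by (simp add: norm_mult norm_power nc [OF k] a_def b_def u_def w_def power_mult_distrib)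
    also have "\<dots> \<le> real ((i + j) choose i) * ((u\<^sup>2 + w\<^sup>2) / 2)"
      using zero_le_power2 [of "u - w"] by (intro mult_left_mono) (auto simp: power2_diff)
    also have "u\<^sup>2 = ((cmod (k$1$1))\<^sup>2) ^ i * (1 - (cmod (k$1$1))\<^sup>2) ^ j"
    proof -
      have "1 - (cmod (k$1$1))\<^sup>2 = (cmod (k$2$1))\<^sup>2" using SU2_column_norm [OF k] by simp
      then show ?thesis by (simp add: u_def power_mult_distrib mult.commute flip: power_mult)
    qed
    \<comment> \<open>As i + j = 2 n, the power N^n is exactly what normalises the column of
      \<open>g ** k\<close>. The remaining factor 1 / N in \<open>w\<close> squares to the
      Jacobian.\<close>
    also have "w\<^sup>2 = (y k ^ i * (1 - y k) ^ j) / (N k)\<^sup>2"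
    proof -
      have y1: "1 - y k = (cmod ((g ** k)$2$1))\<^sup>2 / N k"
        using N unfolding y_def by (simp add: field_simps) (simp add: N_def col_norm_sq_def)
      have "(N k ^ n)\<^sup>2 = N k ^ i * N k ^ j" by (simp add: ij mult.commute flip: power_add power_mult)
      then show ?thesis
        unfolding y1 by (simp add: w_def y_def power_divide power_mult_distrib mult.commute flip: power_mult)
    qed
    finally show ?thesis by (simp add: \<Phi>_def algebra_simps add_divide_distrib)
  qed
  have i1: "integrable haar_SU2 (\<lambda>k. \<Phi> ((cmod (k$1$1))\<^sup>2))"
    and i2: "integrable haar_SU2 (\<lambda>k. \<Phi> (y k) / (N k)\<^sup>2)"
  proof -
    have "compact (\<Phi> ` {0..1})" by (intro compact_continuous_image cont\<Phi>) simp
    then obtain B where B: "\<And>y. y \<in> {0..1} \<Longrightarrow> \<bar>\<Phi> y\<bar> \<le> B"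
      by (metis bounded_iff compact_imp_bounded image_eqI real_norm_def)
    show "integrable haar_SU2 (\<lambda>k. \<Phi> ((cmod (k$1$1))\<^sup>2))"
    proof (rule H.integrable_const_bound [where B = B])
      have "\<bar>\<Phi> ((cmod (k$1$1))\<^sup>2)\<bar> \<le> B" if "k \<in> SU2" for k
      proof (rule B)
        show "(cmod (k$1$1))\<^sup>2 \<in> {0..1}"
          using SU2_column_norm [OF that] zero_le_power2 [of "cmod (k$2$1)"]
          unfolding atLeastAtMost_iff by (intro conjI zero_le_power2) linarith
      qed
      then show "AE k in haar_SU2. norm (\<Phi> ((cmod (k$1$1))\<^sup>2)) \<le> B"
        by (intro AE_I2) (simp add: space_haar)
      show "(\<lambda>k. \<Phi> ((cmod (k$1$1))\<^sup>2)) \<in> borel_measurable haar_SU2"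
        by (intro borel_measurable_haar borel_measurable_continuous_onI continuous_on_compose2 [OF cont\<Phi> [of UNIV]] continuous_intros) auto
    qed
    show "integrable haar_SU2 (\<lambda>k. \<Phi> (y k) / (N k)\<^sup>2)"
    proof (rule H.integrable_const_bound [where B = "B * M\<^sup>2"])
      have "norm (\<Phi> (y k) / (N k)\<^sup>2) \<le> B * M\<^sup>2" if k: "k \<in> SU2" for k
      proof -
        have "y k \<in> {0..1}"
          using Npos [OF k] unfolding y_def by (simp add: divide_le_eq) (simp add: N_def col_norm_sq_def)
        then have 1: "\<bar>\<Phi> (y k)\<bar> \<le> B" by (rule B)
        have "1 / N k \<le> M"
          using col_norm_sq_mult_lower [OF g k] Npos [OF k] by (simp add: pos_divide_le_eq M_def N_def)
        then have "(1 / N k)\<^sup>2 \<le> M\<^sup>2" using Npos [OF k] by (intro power_mono) auto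
        then have "\<bar>\<Phi> (y k)\<bar> * (1 / N k)\<^sup>2 \<le> B * M\<^sup>2"
          using 1 by (intro mult_mono) auto
        then show ?thesis by (simp add: power_divide)
      qed
      then show "AE k in haar_SU2. norm (\<Phi> (y k) / (N k)\<^sup>2) \<le> B * M\<^sup>2"
        by (intro AE_I2) (simp add: space_haar)
      show "(\<lambda>k. \<Phi> (y k) / (N k)\<^sup>2) \<in> borel_measurable haar_SU2"
        unfolding y_def N_def
        by (intro borel_measurable_haar borel_measurable_divide borel_measurable_power
            measurable_compose [OF _ borel_measurable_continuous_onI [OF cont\<Phi>]]
            borel_measurable_continuous_onI continuous_intros continuous_on_col_norm_sq continuous_on_mult_left)
    qed
  qed
  have "norm (LINT k|haar_SU2. LINT \<rho>|circ. f \<rho> k) \<le> (LINT k|haar_SU2. norm (LINT \<rho>|circ. f \<rho> k))"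
    by (rule integral_norm_bound)
  also have "\<dots> \<le> (LINT k|haar_SU2. (\<Phi> ((cmod (k$1$1))\<^sup>2) + \<Phi> (y k) / (N k)\<^sup>2) / 2)"
  proof (rule integral_mono')
    show "integrable haar_SU2 (\<lambda>k. (\<Phi> ((cmod (k$1$1))\<^sup>2) + \<Phi> (y k) / (N k)\<^sup>2) / 2)"
      by (intro integrable_divide_zero Bochner_Integration.integrable_add i1 i2)
    fix k assume "k \<in> space haar_SU2"
    then have k: "k \<in> SU2" by (simp add: space_haar)
    show "norm (LINT \<rho>|circ. f \<rho> k) \<le> (\<Phi> ((cmod (k$1$1))\<^sup>2) + \<Phi> (y k) / (N k)\<^sup>2) / 2" by (rule inner [OF k])
    then show "0 \<le> (\<Phi> ((cmod (k$1$1))\<^sup>2) + \<Phi> (y k) / (N k)\<^sup>2) / 2" by (rule order_trans [OF norm_ge_zero])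
  qed
  also have "\<dots> = ((LINT k|haar_SU2. \<Phi> ((cmod (k$1$1))\<^sup>2)) + (LINT k|haar_SU2. \<Phi> (y k) / (N k)\<^sup>2)) / 2"
    using i1 i2 by (simp only: integral_divide_zero Bochner_Integration.integral_add)
  also have "(LINT k|haar_SU2. \<Phi> ((cmod (k$1$1))\<^sup>2)) = integral {0..1} \<Phi>"
    by (rule integral_haar_entry [OF cont\<Phi>])
  also have "(LINT k|haar_SU2. \<Phi> (y k) / (N k)\<^sup>2) = integral {0..1} \<Phi>"
    unfolding y_def N_def by (rule integral_haar_jacobian [OF cont\<Phi> g])
  finally have "norm (LINT k|haar_SU2. LINT \<rho>|circ. f \<rho> k) \<le> 1 / real (2 * n + 1)"
    unfolding int\<Phi> ij by (simp only: field_sum_of_halves add_divide_distrib)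
  then have "real (2 * n + 1) * norm (LINT k|haar_SU2. LINT \<rho>|circ. f \<rho> k) \<le> 1"
    by (simp add: field_simps)
  moreover have "norm (of_int (2 * int n + 1) :: complex) = real (2 * n + 1)"
    by (subst norm_of_int) simp
  ultimately show ?thesis unfolding avg norm_mult by (simp only:)
qed

section \<open>The theorem\<close>

text \<open>The 9 is 1 + 2 * 4, from pi < 4. The bound is applied with the given \<epsilon> to the
  main term and with exponent 1 to the error term.\<close>

lemma ln_one_plus_powr_le:
  fixes x \<Lambda> \<epsilon> :: real
  assumes x: "x \<ge> 1" and \<Lambda>: "\<Lambda> > 0" and \<epsilon>: "\<epsilon> > 0"
  shows "ln (1 + 2 * pi / x powr (- \<Lambda> - 2)) \<le> (ln 9 + (\<Lambda> + 2) / \<epsilon>) * x powr \<epsilon>"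
proof -
  have x1: "x powr (\<Lambda> + 2) \<ge> 1" "x powr \<epsilon> \<ge> 1" using x \<Lambda> \<epsilon> by (auto intro: ge_one_powr_ge_zero)
  have "x powr (- \<Lambda> - 2) = 1 / x powr (\<Lambda> + 2)"
    by (simp add: powr_minus_divide [symmetric])
  then have "1 + 2 * pi / x powr (- \<Lambda> - 2) = 1 + 2 * pi * x powr (\<Lambda> + 2)" by simp
  also have "\<dots> \<le> x powr (\<Lambda> + 2) + 2 * 4 * x powr (\<Lambda> + 2)"
    using x1 pi_less_4 by (intro add_mono mult_right_mono) auto
  finally have "ln (1 + 2 * pi / x powr (- \<Lambda> - 2)) \<le> ln (9 * x powr (\<Lambda> + 2))"
    using x by (subst ln_le_cancel_iff) (auto intro!: add_pos_nonneg)
  also have "\<dots> = ln 9 + (\<Lambda> + 2) * ln x" using x by (simp add: ln_mult ln_powr)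
  also have "\<dots> \<le> ln 9 * x powr \<epsilon> + (\<Lambda> + 2) * (x powr \<epsilon> / \<epsilon>)"
    using x1 \<Lambda> ln_powr_bound [OF x \<epsilon>] by (intro add_mono mult_left_mono) auto
  finally show ?thesis by (simp add: algebra_simps)
qed

lemma exponential_decay_bound:
  fixes \<Lambda> :: real
  obtains C where "C > 0" "\<And>n::nat. n > 0 \<Longrightarrow> real n * (1 / 2) ^ n \<le> C * real n powr (- \<Lambda>)"
proof -
  have "(\<lambda>n. real n powr (\<Lambda> + 1) * (1 / 2) ^ n) \<longlonglongrightarrow> 0" by real_asymp
  then have "Bseq (\<lambda>n. real n powr (\<Lambda> + 1) * (1 / 2) ^ n)"
    using convergentI convergent_imp_Bseq by blast
  then obtain C where C: "C > 0" "\<And>n. norm (real n powr (\<Lambda> + 1) * (1 / 2) ^ n) \<le> C"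
    by (auto simp: Bseq_def)
  have "real n * (1 / 2) ^ n \<le> C * real n powr (- \<Lambda>)" if "n > 0" for n
  proof -
    have "real n * (1 / 2) ^ n = real n powr (- \<Lambda>) * (real n powr (\<Lambda> + 1) * (1 / 2) ^ n)"
      using that by (simp add: powr_add [symmetric] mult.assoc [symmetric])
    also have "\<dots> \<le> real n powr (- \<Lambda>) * C"
      using C(2) [of n] by (intro mult_left_mono) auto
    finally show ?thesis by (simp add: mult.commute)
  qed
  with C(1) show thesis using that by blast
qed

theorem theorem5:
  fixes \<epsilon> \<Lambda> :: real
  assumes "\<epsilon> > 0" and "\<Lambda> > 0"
  shows "\<exists>C::real. \<forall>(l::int) (q::int) (\<nu>::complex) (g::complex^2^2).
           l \<ge> max 1 \<bar>q\<bar> \<longrightarrow> Re \<nu> = 0 \<longrightarrow> g \<in> SL2 \<longrightarrow>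
           norm (spherical_trace_avg \<nu> l q g)
             \<le> C * (real_of_int l powr \<epsilon> *
                      min_one_quotient (norm g)
                        (sqrt (real_of_int l) * (infdist g SU2)\<^sup>2 * infdist g Diag2)
                    + real_of_int l powr (- \<Lambda>))"
proof -
  obtain C1 where C1: "C1 > 0" "\<And>n::nat. n > 0 \<Longrightarrow> real n * (1 / 2) ^ n \<le> C1 * real n powr (- \<Lambda>)"
    using exponential_decay_bound by blast
  define C2 where "C2 = ln 9 + (\<Lambda> + 2) / \<epsilon>"
  define C3 where "C3 = ln 9 + (\<Lambda> + 2)"
  \<comment> \<open>The 1 serves the case where the minimum is 1. The terms with \<open>C1\<close>
    and \<open>C3\<close> collect the errors of size l^(-\<Lambda>), with 30 = 6 * 5. The last term,
    with 4800 = 5 * 48 * 20, belongs to the quotient.\<close>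
  define C where "C = 1 + 12 * C1 + 30 * C3 + 4800 * C2"
  have ln9: "ln 9 > (0::real)" by simp
  have C2: "C2 > 0" and C3: "C3 > 0" unfolding C2_def C3_def using ln9 assms by (auto intro!: add_pos_pos)
  have C: "1 \<le> C" "12 * C1 + 30 * C3 \<le> C" "4800 * C2 \<le> C" using C1(1) C2 C3 by (auto simp: C_def)
  have "norm (spherical_trace_avg \<nu> l q g)
      \<le> C * (real_of_int l powr \<epsilon> * min_one_quotient (norm g) (sqrt (real_of_int l) * (infdist g SU2)\<^sup>2 * infdist g Diag2)
             + real_of_int l powr (- \<Lambda>))"
    if l: "l \<ge> max 1 \<bar>q\<bar>" and \<nu>: "Re \<nu> = 0" and g: "g \<in> SL2" for l q \<nu> g
  proof -
    define n where "n = nat l"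
    have n: "int n = l" "n > 0" "real_of_int l = real n" "real n \<ge> 1" using l by (auto simp: n_def)
    define \<phi> where "\<phi> = norm (spherical_trace_avg \<nu> (int n) q g)"
    define x where "x = sqrt (real n) * (infdist g SU2)\<^sup>2 * infdist g Diag2"
    have x0: "x \<ge> 0" by (simp add: x_def infdist_nonneg)
    have p\<epsilon>: "real n powr \<epsilon> \<ge> 1" using n(4) assms(1) by (intro ge_one_powr_ge_zero) auto
    have "\<phi> \<le> C * (real n powr \<epsilon> * min_one_quotient (norm g) x + real n powr (- \<Lambda>))"
    proof (cases "x = 0 \<or> norm g / x \<ge> 1")
      case True
      then have "min_one_quotient (norm g) x = 1" by (auto simp: min_one_quotient_def)
      moreover have "\<phi> \<le> 1"
        unfolding \<phi>_def using l n g by (intro norm_spherical_trace_avg_le_1 \<nu>) auto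
      moreover have "1 * 1 \<le> C * (real n powr \<epsilon> + real n powr (- \<Lambda>))"
        using C(1) p\<epsilon> by (intro mult_mono) (auto intro: order_trans [OF p\<epsilon>])
      ultimately show ?thesis by simp
    next
      case False
      then have x: "x > 0" and mq: "min_one_quotient (norm g) x = norm g / x"
        using x0 by (auto simp: min_one_quotient_def)
      obtain k1 k2 s where k1: "k1 \<in> SU2" and k2: "k2 \<in> SU2" and s: "s > 0" and g_eq: "g = k1 ** diag2 s ** k2"
        using cartan_decomposition [OF g] by blast
      define m where "m = max (cmod (k2$1$1 * k1$1$2)) (cmod (k2$1$2 * k1$1$1))"
      have dK: "infdist g SU2 \<le> \<bar>s - 1 / s\<bar>" unfolding g_eq by (rule infdist_SU2_cartan_le [OF k1 k2 s])
      have dD: "infdist g Diag2 \<le> 10 * m * (s + 1 / s)"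
        unfolding g_eq by (rule infdist_Diag2_cartan_le [OF k1 k2 s m_def])
      have ng: "s + 1 / s \<le> 2 * norm g" unfolding g_eq by (rule norm_cartan_ge [OF k1 k2 s])
      have S: "s + 1 / s > 0" using s by (simp add: add_pos_pos)
      have ng0: "norm g > 0" using ng S by linarith
      \<comment> \<open>Nonzero distances exclude s = 1 and m = 0, the degenerate cases of the
        averaged bound.\<close>
      have "infdist g SU2 \<noteq> 0" "infdist g Diag2 \<noteq> 0" using x by (auto simp: x_def)
      then have "infdist g SU2 > 0" "infdist g Diag2 > 0"
        using infdist_nonneg [of g SU2] infdist_nonneg [of g Diag2] by linarith+
      then have T: "\<bar>s - 1 / s\<bar> > 0" and "10 * m * (s + 1 / s) > 0" using dK dD by linarith+
      then have m: "m > 0" using S by (simp add: zero_less_mult_iff)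
      have s1: "s \<noteq> 1" using T by auto
      define D where "D = sqrt (real n) * (s - 1 / s)\<^sup>2 * m"
      have D: "D > 0" unfolding D_def using n m T by simp
      have "x \<le> sqrt (real n) * \<bar>s - 1 / s\<bar>\<^sup>2 * (10 * m * (s + 1 / s))"
        unfolding x_def using dK dD by (intro mult_mono power_mono) (auto simp: infdist_nonneg)
      also have "\<dots> \<le> sqrt (real n) * \<bar>s - 1 / s\<bar>\<^sup>2 * (10 * m * (2 * norm g))"
        using ng m by (intro mult_left_mono) auto
      also have "\<dots> = 20 * norm g * D" by (simp add: D_def)
      finally have "x \<le> 20 * norm g * D" .
      then have K: "48 / D \<le> 960 * (norm g / x)" using x D by (simp add: field_simps)
      \<comment> \<open>The extra exponent - 2 pays for the factor n of the trivial bound and for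
        the crude linear bound \<open>L2\<close> on the logarithm. In the main term the sharper
        \<open>L1\<close> is used.\<close>
      define e where "e = real n powr (- \<Lambda> - 2)"
      define L where "L = ln (1 + 2 * pi / e)"
      have e: "e > 0" using n by (simp add: e_def)
      have L0: "L \<ge> 0" using e by (simp add: L_def)
      have L1: "L \<le> C2 * real n powr \<epsilon>"
        unfolding L_def e_def C2_def by (rule ln_one_plus_powr_le [OF n(4) assms(2,1)])
      have L2: "L \<le> C3 * real n"
        using ln_one_plus_powr_le [OF n(4) assms(2), of 1] n by (simp add: L_def e_def C3_def)
      have "\<phi> \<le> 12 * real n * (1 / 2) ^ n + (6 * real n * e + 48 / D) * (5 * L)"
        unfolding \<phi>_def g_eq L_def D_def
        by (rule norm_spherical_trace_avg_cartan_le [OF k1 k2 s s1 \<nu> n(2) m_def m e])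
      also have "\<dots> = 12 * (real n * (1 / 2) ^ n) + 30 * (real n * e * L) + 5 * (48 / D * L)"
        by (simp add: algebra_simps)
      also have "\<dots> \<le> 12 * (C1 * real n powr (- \<Lambda>)) + 30 * (C3 * real n powr (- \<Lambda>))
          + 5 * (960 * (norm g / x) * (C2 * real n powr \<epsilon>))"
      proof (intro add_mono mult_left_mono C1(2) n(2))
        have "real n * e * L \<le> real n * e * (C3 * real n)"
          using L2 e by (intro mult_left_mono) auto
        also have "\<dots> = C3 * (real n powr 2 * e)" using n by (simp add: power2_eq_square)
        also have "real n powr 2 * e = real n powr (- \<Lambda>)"
          unfolding e_def powr_add [symmetric] by simp
        finally show "real n * e * L \<le> C3 * real n powr (- \<Lambda>)" .
        show "48 / D * L \<le> 960 * (norm g / x) * (C2 * real n powr \<epsilon>)"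
          using K L1 L0 x by (intro mult_mono) auto
      qed auto
      also have "\<dots> = (12 * C1 + 30 * C3) * real n powr (- \<Lambda>) + 4800 * C2 * (real n powr \<epsilon> * (norm g / x))"
        by (simp add: algebra_simps)
      also have "\<dots> \<le> C * real n powr (- \<Lambda>) + C * (real n powr \<epsilon> * (norm g / x))"
        using C x by (intro add_mono mult_right_mono) auto
      finally show ?thesis by (simp add: mq algebra_simps)
    qed
    then show ?thesis by (simp add: \<phi>_def x_def n(1,3))
  qed
  then show ?thesis by blast
qed

end
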